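(* Let $L>0$ and let $\gamma(s)=(x(s),y(s))$, $s\in[0,L]$, be a smooth, simple, non-closed plane curve parametrized by arc length and symmetric with respect to the $y$-axis, i.e. $x(L-s)=-x(s)$ and $y(L-s)=y(s)$ for $s\in[0,L/2]$. Let $k(s)$ be its signed curvature. Let $\delta:[0,L]\to(0,\infty)$ be smooth and even with respect to $s=L/2$. Put $$D^F=\{(s,r)\in\mathbb{R}^2: 0<s<L,\ 0<r<\delta(s)\},$$ and assume that the map $(s,r)\mapsto (x(s)+ry'(s),\,y(s)-rx'(s))$ is one-to-one on $\overline{D^F}$. For $\varepsilon>0$ let $$D_\varepsilon=\{(x(s)+ry'(s),\,y(s)-rx'(s)): 0<s<L,\ 0<r<\varepsilon\delta(s)\}.$$ Let $p>1$. If $1+rk(s)>0$ on $\overline{D^F}$, then $$\lim_{\varepsilon\to0^+}\mu_1(D_\varepsilon)=\mu_1(0,L;\delta),$$ where $\mu_1(0,L;\delta)$ denotes the first nonzero eigenvalue of the weighted Neumann $p$-Laplace problem $$-\left(\delta|u'|^{p-2}u'\right)'=\mu\,\delta|u|^{p-2}u\ \text{ in }(0,L),\qquad u'(0)=u'(L)=0.$$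
   Context: Signed curvature: $k(s)=x'(s)y''(s)-x''(s)y'(s)$, so that the Jacobian of the map $(s,r)\mapsto(x(s)+ry'(s),y(s)-rx'(s))$ has absolute value $|1+rk(s)|$. For a bounded Lipschitz domain $D\subset\mathbb{R}^2$ and $p>1$, $\mu_1(D)$ is the first nonzero eigenvalue of the Neumann problem $-\mathrm{div}(|\nabla u|^{p-2}\nabla u)=\mu|u|^{p-2}u$ in $D$, $|\nabla u|^{p-2}\frac{\partial u}{\partial\mathbf{n}}=0$ on $\partial D$, characterized by $$\mu_1(D)=\min\left\{\frac{\int_D|\nabla v|^p\,dxdy}{\int_D|v|^p\,dxdy}: v\in W^{1,p}(D)\setminus\{0\},\ \int_D|v|^{p-2}v\,dxdy=0\right\}.$$ Similarly, the weighted one-dimensional eigenvalue is characterized by $$\mu_1(0,L;\delta)=\inf\left\{\frac{\int_0^L|v'(s)|^p\delta(s)\,ds}{\int_0^L|v(s)|^p\delta(s)\,ds}: v\in W^{1,p}(0,L)\setminus\{0\},\ \int_0^L|v|^{p-2}v\,\delta\,ds=0\right\}.$$ *)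

theory Defs
  imports "HOL-Analysis.Analysis"
begin

section \<open>Sobolev spaces and the first nonzero Neumann eigenvalue\<close>

definition C1_compact_support :: "'a::euclidean_space set \<Rightarrow> ('a \<Rightarrow> real) set" where
  "C1_compact_support D =
    {\<phi>. (\<forall>x. \<phi> differentiable at x) \<and>
         (\<forall>b\<in>Basis. continuous_on UNIV (\<lambda>x. frechet_derivative \<phi> (at x) b)) \<and>
         compact (closure {x. \<phi> x \<noteq> 0}) \<and> closure {x. \<phi> x \<noteq> 0} \<subseteq> D}"

text \<open>Only the values of \<open>v\<close> and \<open>g\<close> on the open set \<open>D\<close> matter. For first-order weak
  derivatives the test space is taken to be $C^1_c(D)$, as in Gilbarg--Trudinger; by mollification
  this is equivalent to testing with $C^\infty_c(D)$.\<close>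

definition has_weak_gradient ::
    "'a::euclidean_space set \<Rightarrow> ('a \<Rightarrow> real) \<Rightarrow> ('a \<Rightarrow> 'a) \<Rightarrow> bool" where
  "has_weak_gradient D v g \<longleftrightarrow>
    (\<forall>\<phi>\<in>C1_compact_support D. \<forall>b\<in>Basis.
      (LINT x:D|lborel. v x * frechet_derivative \<phi> (at x) b) =
      - (LINT x:D|lborel. (g x \<bullet> b) * \<phi> x))"

definition Lp_on :: "real \<Rightarrow> 'a::euclidean_space set \<Rightarrow> ('a \<Rightarrow> 'b::euclidean_space) set" where
  "Lp_on p D = {f. set_borel_measurable lborel D f \<and>
                   set_integrable lborel D (\<lambda>x. norm (f x) powr p)}"

text \<open>\<open>W1p_with_gradient p D v g\<close>: the function \<open>v\<close> lies in $W^{1,p}(D)$ and \<open>g\<close> represents its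
  (almost everywhere unique) weak gradient. Elements of $W^{1,p}(D)$ are given by Borel
  representatives.\<close>

definition W1p_with_gradient ::
    "real \<Rightarrow> 'a::euclidean_space set \<Rightarrow> ('a \<Rightarrow> real) \<Rightarrow> ('a \<Rightarrow> 'a) \<Rightarrow> bool" where
  "W1p_with_gradient p D v g \<longleftrightarrow> v \<in> Lp_on p D \<and> g \<in> Lp_on p D \<and> has_weak_gradient D v g"

text \<open>The first nonzero eigenvalue of
  $-\mathrm{div}(w|\nabla u|^{p-2}\nabla u) = \mu w |u|^{p-2}u$ in $D$ with homogeneous Neumann
  boundary condition, through its variational characterization. It is intended for bounded $D$ and
  for $w$ measurable, positive and bounded on $D$, so that all integrands are integrable.\<close>

definition weighted_neumann_mu1 ::
    "real \<Rightarrow> 'a::euclidean_space set \<Rightarrow> ('a \<Rightarrow> real) \<Rightarrow> real" where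
  "weighted_neumann_mu1 p D w =
    Inf {(LINT x:D|lborel. norm (g x) powr p * w x) /
         (LINT x:D|lborel. \<bar>v x\<bar> powr p * w x) | v g.
         W1p_with_gradient p D v g \<and>
         \<not> (AE x in lborel. x \<in> D \<longrightarrow> v x = 0) \<and>
         (LINT x:D|lborel. \<bar>v x\<bar> powr (p - 2) * v x * w x) = 0}"

definition neumann_mu1 :: "real \<Rightarrow> 'a::euclidean_space set \<Rightarrow> real" where
  "neumann_mu1 p D = weighted_neumann_mu1 p D (\<lambda>_. 1)"


section \<open>Curves on a closed interval and thin strips along them\<close>

text \<open>The derivative relative to $[0,L]$, hence one-sided at the two endpoints.\<close>

definition ivl_deriv :: "real \<Rightarrow> (real \<Rightarrow> real) \<Rightarrow> real \<Rightarrow> real" where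
  "ivl_deriv L f s = vector_derivative f (at s within {0..L})"

definition smooth_on_ivl :: "real \<Rightarrow> (real \<Rightarrow> real) \<Rightarrow> bool" where
  "smooth_on_ivl L f \<longleftrightarrow> (\<forall>n. (ivl_deriv L ^^ n) f differentiable_on {0..L})"

definition signed_curvature ::
    "real \<Rightarrow> (real \<Rightarrow> real) \<Rightarrow> (real \<Rightarrow> real) \<Rightarrow> real \<Rightarrow> real" where
  "signed_curvature L x y s =
    ivl_deriv L x s * ivl_deriv L (ivl_deriv L y) s -
    ivl_deriv L (ivl_deriv L x) s * ivl_deriv L y s"

definition normal_map ::
    "real \<Rightarrow> (real \<Rightarrow> real) \<Rightarrow> (real \<Rightarrow> real) \<Rightarrow> real \<times> real \<Rightarrow> real \<times> real" where
  "normal_map L x y = (\<lambda>(s, r). (x s + r * ivl_deriv L y s, y s - r * ivl_deriv L x s))"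

definition subgraph_domain :: "real \<Rightarrow> (real \<Rightarrow> real) \<Rightarrow> (real \<times> real) set" where
  "subgraph_domain L \<delta> = {(s, r). 0 < s \<and> s < L \<and> 0 < r \<and> r < \<delta> s}"

definition thin_strip ::
    "real \<Rightarrow> (real \<Rightarrow> real) \<Rightarrow> (real \<Rightarrow> real) \<Rightarrow> (real \<Rightarrow> real) \<Rightarrow> real \<Rightarrow> (real \<times> real) set" where
  "thin_strip L x y \<delta> \<epsilon> = normal_map L x y ` subgraph_domain L (\<lambda>s. \<epsilon> * \<delta> s)"

end

theory Submission
  imports Defs
begin

text \<open>Write the strip as the image of \<open>{0<..<L} \<times> {0<..<1}\<close> under \<open>(s, t) \<mapsto> \<gamma> s + \<epsilon> (1 - t) \<delta> s \<nu> s\<close>; the Jacobian is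
  \<open>\<epsilon> \<delta> s (1 + O(\<epsilon>))\<close>. For $p > 1$ the constraint \<open>\<integral>\<bar>v\<bar> powr (p - 2) * v * w = 0\<close> says exactly that the constant
  $0$ is the best approximation of \<open>v\<close> in the weighted $L^p$ norm, so the eigenvalue is the best constant in
  a Poincare inequality for the distance to the constants, and no compactness argument is needed. Extending a function of \<open>s\<close> constantly
  along the normals gives \<open>\<mu>\<^sub>\<epsilon> \<le> (1 + O(\<epsilon>)) \<mu>\<^sub>0\<close>. Conversely, averaging a function on the strip over the
  normal fibres does not increase the energy by more than a factor \<open>1 + O(\<epsilon>)\<close>, and the function differs from its
  averages by $O(\epsilon)$ times the norm of its gradient, by the Poincare inequality on the fibres; this gives \<open>\<mu>\<^sub>0 \<le> (1 + o(1)) \<mu>\<^sub>\<epsilon>\<close>.\<close>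

text \<open>The constraint on admissible functions is nonlinear and is not preserved when a function
  is carried from one domain to the other. Both comparisons therefore use it asymmetrically: on the
  target side an arbitrary Sobolev function is shifted by the constant \<open>c\<close> that makes
  it admissible there, and on the source side minimality of the constant 0 lets the norm of
  \<open>v\<close> be replaced by that of \<open>v - c\<close> for this very \<open>c\<close>. Weak
  gradients are defined by testing with compactly supported C1 functions, so carrying one through
  the chart means constructing a test function whose derivative is the right one after substitution.
  This costs one derivative of the Jacobian matrix, hence charts of class C2. For the same reason
  fibre averages and fibre oscillations are obtained by testing with products of functions of one
  variable, not by restricting a representative to almost every fibre. The errors of the chart are
  collected in one number \<kappa> = 2 C e, where C bounds \<delta>, \<delta> times the curvature,
  and the derivatives of \<delta> x' and \<delta> y' on [0, L]; the limit is then a squeeze between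
  two explicit bounds.\<close>

section \<open>Elementary inequalities for powers\<close>

lemma abs_signed_powr:
  fixes a p :: real
  shows "\<bar>\<bar>a\<bar> powr (p - 2) * a\<bar> = \<bar>a\<bar> powr (p - 1)"
proof (cases "a = 0")
  case False
  have "\<bar>\<bar>a\<bar> powr (p - 2) * a\<bar> = \<bar>a\<bar> powr (p - 2) * \<bar>a\<bar> powr 1"
    using False by (simp add: abs_mult)
  also have "\<dots> = \<bar>a\<bar> powr (p - 1)" by (subst powr_add[symmetric]) simp
  finally show ?thesis .
\<comment> \<open>At 0 both sides vanish because \<open>0 powr q\<close> is 0 for every exponent,
  negative ones included; for p < 2 this convention gives the expression its continuous
  value.\<close>
qed simp

text \<open>Convexity of the p-th power of the absolute value, as the supporting line at
  \<open>a\<close>. Young's inequality with the conjugate exponents p and p / (p - 1) yields it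
  without differentiating. The characterization of the centring constant, Jensen's inequality and
  the weighted splitting of a sum all come from this one line.\<close>

lemma powr_tangent:
  fixes a b p :: real
  assumes p: "p > 1"
  shows "\<bar>a\<bar> powr p + p * (\<bar>a\<bar> powr (p - 2) * a) * (b - a) \<le> \<bar>b\<bar> powr p"
proof (cases "a = 0")
  case False
  have 1: "\<bar>a\<bar> powr (p - 2) * a * a = \<bar>a\<bar> powr p"
  proof -
    have "\<bar>a\<bar> powr (p - 2) * a * a = \<bar>a\<bar> powr (p - 2) * \<bar>a\<bar> powr 2"
      using False by (simp add: power2_eq_square)
    also have "\<dots> = \<bar>a\<bar> powr p" by (subst powr_add[symmetric]) simp
    finally show ?thesis .
  qed
  have 2: "\<bar>b\<bar> * \<bar>a\<bar> powr (p - 1) \<le> \<bar>b\<bar> powr p / p + (\<bar>a\<bar> powr (p - 1)) powr (p / (p - 1)) / (p / (p - 1))"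
    using p by (intro Youngs_inequality) (auto simp: field_simps)
  have "(\<bar>a\<bar> powr (p - 1)) powr (p / (p - 1)) = \<bar>a\<bar> powr p"
    using p by (simp add: powr_powr)
  with 2 have "p * (\<bar>b\<bar> * \<bar>a\<bar> powr (p - 1)) \<le> \<bar>b\<bar> powr p + (p - 1) * \<bar>a\<bar> powr p"
    using p by (simp add: field_simps)
  moreover have "\<bar>a\<bar> powr (p - 2) * a * b \<le> \<bar>b\<bar> * \<bar>a\<bar> powr (p - 1)"
    using abs_signed_powr[of a p] by (metis abs_ge_self abs_mult mult.commute)
  then have "p * (\<bar>a\<bar> powr (p - 2) * a * b) \<le> p * (\<bar>b\<bar> * \<bar>a\<bar> powr (p - 1))"
    using p by simp
  moreover have "p * (\<bar>a\<bar> powr (p - 2) * a) * (b - a) = p * (\<bar>a\<bar> powr (p - 2) * a * b) - p * \<bar>a\<bar> powr p"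
    by (subst 1[symmetric]) (simp add: algebra_simps)
  ultimately show ?thesis by (simp only: left_diff_distrib)
qed simp

text \<open>The exponent p - 2 may be negative; in this form only the positive exponent p - 1
  occurs, and monotonicity in \<open>a\<close> becomes visible.\<close>

lemma signed_powr_eq:
  fixes a p :: real
  shows "\<bar>a\<bar> powr (p - 2) * a = sgn a * \<bar>a\<bar> powr (p - 1)"
proof -
  have "\<bar>a\<bar> powr (p - 2) * a = sgn a * \<bar>\<bar>a\<bar> powr (p - 2) * a\<bar>"
    by (cases "a = 0"; cases "a > 0") (auto simp: abs_mult)
  then show ?thesis by (simp only: abs_signed_powr)
qed

lemma powr_le_one_plus_powr:
  fixes a p q :: real
  assumes "0 \<le> q" "q \<le> p" "0 \<le> a"
  shows "a powr q \<le> 1 + a powr p"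
proof (cases "a \<le> 1")
  case True
  then have "a powr q \<le> 1" using assms by (simp add: powr_le1)
  then show ?thesis by (simp add: add_increasing2)
next
  case False
  then have "a powr q \<le> a powr p" using assms by (intro powr_mono) auto
  then show ?thesis by simp
qed

text \<open>Convexity applied to a + b = (1 - l) (a / (1 - l)) + l (b / l). A small \<open>l\<close>
  leaves \<open>a\<close> with a factor close to 1 at the price of the large factor
  \<open>l powr (1 - p)\<close> on \<open>b\<close>; this is affordable when \<open>b\<close> is
  much smaller than \<open>a\<close>, as fibre oscillations are.\<close>

lemma powr_abs_convex:
  fixes a b p l :: real
  assumes p: "p > 1" and l: "0 < l" "l < 1"
  shows "\<bar>a + b\<bar> powr p \<le> (1 - l) powr (1 - p) * \<bar>a\<bar> powr p + l powr (1 - p) * \<bar>b\<bar> powr p"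
proof -
  define m where "m = a + b"
  have ta: "\<bar>m\<bar> powr p + p * (\<bar>m\<bar> powr (p - 2) * m) * (a / (1 - l) - m) \<le> \<bar>a / (1 - l)\<bar> powr p"
    and tb: "\<bar>m\<bar> powr p + p * (\<bar>m\<bar> powr (p - 2) * m) * (b / l - m) \<le> \<bar>b / l\<bar> powr p"
    by (rule powr_tangent[OF p])+
  define K where "K = p * (\<bar>m\<bar> powr (p - 2) * m)"
  have "(1 - l) * (\<bar>m\<bar> powr p + K * (a / (1 - l) - m)) + l * (\<bar>m\<bar> powr p + K * (b / l - m))
    \<le> (1 - l) * \<bar>a / (1 - l)\<bar> powr p + l * \<bar>b / l\<bar> powr p"
    using l ta tb unfolding K_def by (intro add_mono mult_left_mono) auto
  also have "(1 - l) * (\<bar>m\<bar> powr p + K * (a / (1 - l) - m)) + l * (\<bar>m\<bar> powr p + K * (b / l - m)) = \<bar>m\<bar> powr p"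
    using l by (simp add: m_def field_simps)
  also have "(1 - l) * \<bar>a / (1 - l)\<bar> powr p = (1 - l) powr (1 - p) * \<bar>a\<bar> powr p"
    using l by (simp add: powr_divide powr_diff)
  also have "l * \<bar>b / l\<bar> powr p = l powr (1 - p) * \<bar>b\<bar> powr p"
    using l by (simp add: powr_divide powr_diff)
  finally show ?thesis by (simp add: m_def)
qed

lemma powr_add_le:
  fixes a b p :: real
  assumes p: "p > 1"
  shows "\<bar>a + b\<bar> powr p \<le> 2 powr p * (\<bar>a\<bar> powr p + \<bar>b\<bar> powr p)"
proof -
  have "\<bar>a + b\<bar> powr p \<le> (1/2) powr (1 - p) * \<bar>a\<bar> powr p + (1/2) powr (1 - p) * \<bar>b\<bar> powr p"
    using powr_abs_convex[OF p, of "1/2" a b] by simp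
  also have "(1/2::real) powr (1 - p) = 2 powr (p - 1)"
    by (simp add: powr_divide powr_minus_divide[symmetric] powr_diff field_simps)
  also have "2 powr (p - 1) * \<bar>a\<bar> powr p + 2 powr (p - 1) * \<bar>b\<bar> powr p \<le> 2 powr p * \<bar>a\<bar> powr p + 2 powr p * \<bar>b\<bar> powr p"
    by (intro add_mono mult_right_mono powr_mono) auto
  finally show ?thesis by (simp add: algebra_simps)
qed

section \<open>The optimal constant in the p-norm of a finite measure\<close>

context finite_measure begin

lemma integrable_powr_smaller:
  fixes v :: "'a \<Rightarrow> real"
  assumes [measurable]: "v \<in> borel_measurable M" and i: "integrable M (\<lambda>x. \<bar>v x\<bar> powr p)"
    and q: "0 \<le> q" "q \<le> p"
  shows "integrable M (\<lambda>x. \<bar>v x\<bar> powr q)"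
proof (rule Bochner_Integration.integrable_bound)
  show "integrable M (\<lambda>x. 1 + \<bar>v x\<bar> powr p)" using i by simp
  show "AE x in M. norm (\<bar>v x\<bar> powr q) \<le> norm (1 + \<bar>v x\<bar> powr p)"
    using powr_le_one_plus_powr[OF q] by (intro AE_I2) (auto simp: add_nonneg_nonneg)
qed simp

lemma integrable_powr_diff:
  fixes v :: "'a \<Rightarrow> real"
  assumes [measurable]: "v \<in> borel_measurable M" "u \<in> borel_measurable M"
    and i: "integrable M (\<lambda>x. \<bar>v x\<bar> powr p)" "integrable M (\<lambda>x. \<bar>u x\<bar> powr p)" and p: "p > 1"
  shows "integrable M (\<lambda>x. \<bar>v x - u x\<bar> powr p)"
proof (rule Bochner_Integration.integrable_bound)
  show "integrable M (\<lambda>x. 2 powr p * (\<bar>v x\<bar> powr p + \<bar>u x\<bar> powr p))" using i by simp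
  show "AE x in M. norm (\<bar>v x - u x\<bar> powr p) \<le> norm (2 powr p * (\<bar>v x\<bar> powr p + \<bar>u x\<bar> powr p))"
    using powr_add_le[OF p, of "v _" "- u _"] by (intro AE_I2) (auto simp: add_nonneg_nonneg)
qed simp

lemma integrable_signed_powr:
  fixes v :: "'a \<Rightarrow> real"
  assumes [measurable]: "v \<in> borel_measurable M" and i: "integrable M (\<lambda>x. \<bar>v x\<bar> powr p)"
    and p: "p > 1"
  shows "integrable M (\<lambda>x. \<bar>v x\<bar> powr (p - 2) * v x)"
proof (rule Bochner_Integration.integrable_bound)
  show "integrable M (\<lambda>x. \<bar>v x\<bar> powr (p - 1))"
    using p by (intro integrable_powr_smaller[OF _ i]) auto
  show "AE x in M. norm (\<bar>v x\<bar> powr (p - 2) * v x) \<le> norm (\<bar>v x\<bar> powr (p - 1))"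
    by (simp only: real_norm_def abs_signed_powr) simp
qed simp

text \<open>The tangent inequality at \<open>v x\<close>, taken at the point \<open>v x - c\<close>,
  has the linear term - p c |v|^(p-2) v, whose integral is zero by hypothesis. The hypothesis is the
  first-order condition of a convex minimization in \<open>c\<close>, so it already implies a global
  minimum.\<close>

lemma integral_powr_le_diff_const:
  fixes v :: "'a \<Rightarrow> real"
  assumes [measurable]: "v \<in> borel_measurable M" and i: "integrable M (\<lambda>x. \<bar>v x\<bar> powr p)"
    and p: "p > 1" and z: "(\<integral>x. \<bar>v x\<bar> powr (p - 2) * v x \<partial>M) = 0"
  shows "(\<integral>x. \<bar>v x\<bar> powr p \<partial>M) \<le> (\<integral>x. \<bar>v x - c\<bar> powr p \<partial>M)"
proof -
  have s: "integrable M (\<lambda>x. \<bar>v x\<bar> powr (p - 2) * v x)" by (rule integrable_signed_powr[OF _ i p]) simp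
  have "(\<integral>x. \<bar>v x\<bar> powr p + (- p * c) * (\<bar>v x\<bar> powr (p - 2) * v x) \<partial>M) \<le> (\<integral>x. \<bar>v x - c\<bar> powr p \<partial>M)"
  proof (rule integral_mono)
    show "integrable M (\<lambda>x. \<bar>v x\<bar> powr p + (- p * c) * (\<bar>v x\<bar> powr (p - 2) * v x))"
      using i s by (intro Bochner_Integration.integrable_add integrable_mult_right) auto
    show "integrable M (\<lambda>x. \<bar>v x - c\<bar> powr p)" using i p by (intro integrable_powr_diff) auto
    fix x show "\<bar>v x\<bar> powr p + (- p * c) * (\<bar>v x\<bar> powr (p - 2) * v x) \<le> \<bar>v x - c\<bar> powr p"
      using powr_tangent[OF p, of "v x" "v x - c"] by (simp add: algebra_simps)
  qed
  also have "(\<integral>x. \<bar>v x\<bar> powr p + (- p * c) * (\<bar>v x\<bar> powr (p - 2) * v x) \<partial>M) = (\<integral>x. \<bar>v x\<bar> powr p \<partial>M)"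
    using i s z by (subst Bochner_Integration.integral_add) auto
  finally show ?thesis .
qed

text \<open>The tangent at the mean integrates to its value there, because the total mass is
  one.\<close>

lemma jensen_powr:
  fixes f :: "'a \<Rightarrow> real"
  assumes [measurable]: "f \<in> borel_measurable M" and i: "integrable M (\<lambda>x. \<bar>f x\<bar> powr p)"
    and p: "p > 1" and one: "measure M (space M) = 1"
  shows "\<bar>\<integral>x. f x \<partial>M\<bar> powr p \<le> (\<integral>x. \<bar>f x\<bar> powr p \<partial>M)"
proof -
  define m where "m = (\<integral>x. f x \<partial>M)"
  define K where "K = p * (\<bar>m\<bar> powr (p - 2) * m)"
  have "integrable M (\<lambda>x. \<bar>f x\<bar> powr 1)" using p by (intro integrable_powr_smaller[OF _ i]) auto
  then have fi: "integrable M f"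
    by (simp add: integrable_abs_iff)
  have "(\<integral>x. \<bar>m\<bar> powr p + K * (f x - m) \<partial>M) \<le> (\<integral>x. \<bar>f x\<bar> powr p \<partial>M)"
    using fi i powr_tangent[OF p, of m] unfolding K_def by (intro integral_mono) auto
  also have "(\<integral>x. \<bar>m\<bar> powr p + K * (f x - m) \<partial>M) = \<bar>m\<bar> powr p"
    using fi one by (simp add: m_def)
  finally show ?thesis by (simp add: m_def)
qed

text \<open>Provides one sign for the intermediate value theorem; the opposite sign comes from
  applying it to \<open>- v\<close>. The integrand is monotone in \<open>v x - c\<close> and tends
  to minus infinity pointwise as \<open>c\<close> grows.\<close>

lemma signed_powr_integral_eventually_neg:
  fixes v :: "'a \<Rightarrow> real"
  assumes [measurable]: "v \<in> borel_measurable M" and i: "integrable M (\<lambda>x. \<bar>v x\<bar> powr p)"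
    and p: "p > 1" and pos: "measure M (space M) > 0"
  shows "\<exists>c\<ge>0. (\<integral>x. \<bar>v x - c\<bar> powr (p - 2) * (v x - c) \<partial>M) < 0"
proof -
  define \<phi> where "\<phi> z = \<bar>z\<bar> powr (p - 2) * z" for z :: real
  have [measurable]: "\<phi> \<in> borel_measurable borel" unfolding \<phi>_def by measurable
  have mono: "\<phi> a \<le> \<phi> b" if "a \<le> b" for a b
    unfolding \<phi>_def signed_powr_eq using that p
    by (cases "a > 0"; cases "b > 0"; cases "a = 0"; cases "b = 0")
      (auto simp: powr_mono2 intro: order_trans[of _ 0])
  have int: "integrable M (\<lambda>x. \<phi> (v x - c))" for c
    unfolding \<phi>_def using p i by (intro integrable_signed_powr integrable_powr_diff) auto
  \<comment> \<open>Cutting off below at -1 gives a dominated sequence with limit -1, bounded above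
    by \<phi> (v x) through monotonicity. The cut-off integrals still bound the true ones from
    above, which is enough for negativity.\<close>
  have lim: "(\<lambda>n::nat. \<integral>x. max (\<phi> (v x - real n)) (-1) \<partial>M) \<longlonglongrightarrow> (\<integral>x. - 1 \<partial>M)"
  proof (rule integral_dominated_convergence)
    show "integrable M (\<lambda>x. \<bar>\<phi> (v x)\<bar> + 1)" using int[of 0] by simp
    show "AE x in M. (\<lambda>n. max (\<phi> (v x - real n)) (-1)) \<longlonglongrightarrow> - 1"
    proof (rule AE_I2)
      fix x
      have "\<phi> (v x - real n) \<le> - 1" if "n \<ge> nat \<lceil>v x + 1\<rceil>" for n
      proof -
        have "v x - real n \<le> - 1" using that by linarith
        from mono[OF this] show ?thesis by (simp add: \<phi>_def)
      qed
      then have "\<forall>\<^sub>F n in sequentially. max (\<phi> (v x - real n)) (-1) = - 1"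
        unfolding eventually_sequentially by (intro exI[of _ "nat \<lceil>v x + 1\<rceil>"]) auto
      then show "(\<lambda>n. max (\<phi> (v x - real n)) (-1)) \<longlonglongrightarrow> - 1" by (rule tendsto_eventually)
    qed
    show "AE x in M. norm (max (\<phi> (v x - real n)) (-1)) \<le> \<bar>\<phi> (v x)\<bar> + 1" for n
    proof (rule AE_I2)
      fix x
      have "\<phi> (v x - real n) \<le> \<phi> (v x)" by (rule mono) simp
      then show "norm (max (\<phi> (v x - real n)) (-1)) \<le> \<bar>\<phi> (v x)\<bar> + 1" by auto
    qed
  qed auto
  have "(\<integral>x. - 1 \<partial>M) < (0::real)" using pos by simp
  from order_tendstoD(2)[OF lim this]
  obtain n :: nat where n: "(\<integral>x. max (\<phi> (v x - real n)) (-1) \<partial>M) < 0"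
    by (auto simp: eventually_sequentially)
  have "(\<integral>x. \<phi> (v x - real n) \<partial>M) \<le> (\<integral>x. max (\<phi> (v x - real n)) (-1) \<partial>M)"
    using int by (intro integral_mono integrable_max) auto
  with n show ?thesis unfolding \<phi>_def by (intro exI[of _ "real n"]) auto
qed

text \<open>Intermediate value theorem for the integral as a function of \<open>c\<close>, with
  \<open>c1\<close> obtained from \<open>v\<close> and \<open>- c2\<close> from \<open>- v\<close>.
  Continuity in \<open>c\<close> is dominated convergence, the majorant being uniform for
  \<open>c\<close> in a bounded interval.\<close>

lemma exists_centering_const:
  fixes v :: "'a \<Rightarrow> real"
  assumes v[measurable]: "v \<in> borel_measurable M" and i: "integrable M (\<lambda>x. \<bar>v x\<bar> powr p)"
    and p: "p > 1" and pos: "measure M (space M) > 0"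
  shows "\<exists>c. (\<integral>x. \<bar>v x - c\<bar> powr (p - 2) * (v x - c) \<partial>M) = 0"
proof -
  let ?F = "\<lambda>c. \<integral>x. \<bar>v x - c\<bar> powr (p - 2) * (v x - c) \<partial>M"
  obtain c1 where c1: "c1 \<ge> 0" "?F c1 < 0"
    using signed_powr_integral_eventually_neg[OF v i p pos] by auto
  obtain c2 where c2: "c2 \<ge> 0" "(\<integral>x. \<bar>- v x - c2\<bar> powr (p - 2) * (- v x - c2) \<partial>M) < 0"
    using signed_powr_integral_eventually_neg[of "\<lambda>x. - v x" p] i p pos by auto
  have *: "\<bar>- v x - c2\<bar> powr (p - 2) * (- v x - c2) = - (\<bar>v x - (- c2)\<bar> powr (p - 2) * (v x - (- c2)))" for x
  proof -
    have "\<bar>- v x - c2\<bar> = \<bar>v x - (- c2)\<bar>" by linarith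
    then show ?thesis by (simp add: algebra_simps)
  qed
  have "(\<integral>x. \<bar>- v x - c2\<bar> powr (p - 2) * (- v x - c2) \<partial>M) = - ?F (- c2)"
    unfolding * by (rule Bochner_Integration.integral_minus)
  with c2 have c2': "?F (- c2) > 0" by simp
  have cont: "continuous_on {- c2..c1} ?F"
  proof (rule continuous_on_sequentiallyI)
    fix u c assume u: "\<forall>n. u n \<in> {- c2..c1}" and c: "c \<in> {- c2..c1}" and uc: "u \<longlonglongrightarrow> c"
    define C where "C = max c1 c2"
    show "(\<lambda>n. ?F (u n)) \<longlonglongrightarrow> ?F c"
    proof (rule integral_dominated_convergence)
      show "integrable M (\<lambda>x. 1 + 2 powr p * (\<bar>v x\<bar> powr p + C powr p))" using i by simp
      show "AE x in M. (\<lambda>n. \<bar>v x - u n\<bar> powr (p - 2) * (v x - u n)) \<longlonglongrightarrow> \<bar>v x - c\<bar> powr (p - 2) * (v x - c)"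
      proof (rule AE_I2)
        fix x
        let ?d = "v x - c"
        have d: "(\<lambda>n. v x - u n) \<longlonglongrightarrow> ?d" by (intro tendsto_intros uc)
        show "(\<lambda>n. \<bar>v x - u n\<bar> powr (p - 2) * (v x - u n)) \<longlonglongrightarrow> \<bar>?d\<bar> powr (p - 2) * ?d"
        proof (cases "?d = 0")
          case True
          \<comment> \<open>For p < 2 the factor with exponent p - 2 is unbounded near 0, so the
            limit is read off the absolute value of the product, whose exponent p - 1 is
            positive.\<close>
          have "(\<lambda>n. \<bar>v x - u n\<bar> powr (p - 1)) \<longlonglongrightarrow> 0"
            using tendsto_powr'[OF tendsto_rabs[OF d] tendsto_const[of "p - 1"]] True p by simp
          then have "(\<lambda>n. \<bar>v x - u n\<bar> powr (p - 2) * (v x - u n)) \<longlonglongrightarrow> 0"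
            by (subst tendsto_rabs_zero_iff[symmetric]) (simp only: abs_signed_powr)
          with True show ?thesis by simp
        next
          case False
          then show ?thesis using d by (intro tendsto_mult tendsto_powr tendsto_rabs tendsto_const) auto
        qed
      qed
      show "AE x in M. norm (\<bar>v x - u n\<bar> powr (p - 2) * (v x - u n)) \<le> 1 + 2 powr p * (\<bar>v x\<bar> powr p + C powr p)" for n
      proof (rule AE_I2)
        fix x
        have "\<bar>u n\<bar> \<le> C" using u c1(1) c2(1) unfolding C_def by (auto simp: abs_le_iff le_max_iff_disj) (smt (verit) atLeastAtMost_iff)+
        then have "\<bar>u n\<bar> powr p \<le> C powr p" using p by (intro powr_mono2) auto
        have "norm (\<bar>v x - u n\<bar> powr (p - 2) * (v x - u n)) = \<bar>v x - u n\<bar> powr (p - 1)"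
          by (simp only: real_norm_def abs_signed_powr)
        also have "\<dots> \<le> 1 + \<bar>v x - u n\<bar> powr p" using p by (intro powr_le_one_plus_powr) auto
        also have "\<bar>v x - u n\<bar> powr p \<le> 2 powr p * (\<bar>v x\<bar> powr p + \<bar>u n\<bar> powr p)"
          using powr_add_le[OF p, of "v x" "- u n"] by simp
        also have "\<dots> \<le> 2 powr p * (\<bar>v x\<bar> powr p + C powr p)"
          using \<open>\<bar>u n\<bar> powr p \<le> C powr p\<close> by simp
        finally show "norm (\<bar>v x - u n\<bar> powr (p - 2) * (v x - u n)) \<le> 1 + 2 powr p * (\<bar>v x\<bar> powr p + C powr p)" by simp
      qed
    qed auto
  qed
  have "\<exists>c. - c2 \<le> c \<and> c \<le> c1 \<and> ?F c = 0"
    using c1 c2 c2' by (intro IVT2' cont) auto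
  then show ?thesis by blast
qed

end

section \<open>Test functions\<close>

text \<open>\<open>D\<close> and the complement of \<open>K\<close> are two open sets covering the
  space. The function is C1 on the first and identically zero on the second, so regularity has to be
  checked on \<open>D\<close> only.\<close>

lemma C1_compact_supportI:
  fixes \<phi> :: "'a::euclidean_space \<Rightarrow> real"
  assumes D: "open D" and K: "compact K" "K \<subseteq> D"
    and der: "\<And>x. x \<in> D \<Longrightarrow> (\<phi> has_derivative \<phi>' x) (at x)"
    and cont: "\<And>b. b \<in> Basis \<Longrightarrow> continuous_on D (\<lambda>x. \<phi>' x b)"
    and zero: "\<And>x. x \<notin> K \<Longrightarrow> \<phi> x = 0"
  shows "\<phi> \<in> C1_compact_support D"
proof -
  have opn: "open (- K)" using K by (simp add: compact_imp_closed open_Compl)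
  have off: "(\<phi> has_derivative (\<lambda>_. 0)) (at x)" if "x \<notin> K" for x
    by (rule has_derivative_transform_within_open[OF has_derivative_const opn]) (use that zero in auto)
  have fr: "frechet_derivative \<phi> (at x) = \<phi>' x" if "x \<in> D" for x
    using frechet_derivative_at[OF der[OF that]] by simp
  have fr0: "frechet_derivative \<phi> (at x) = (\<lambda>_. 0)" if "x \<notin> K" for x
    using frechet_derivative_at[OF off[OF that]] by simp
  have U: "D \<union> - K = UNIV" using K by auto
  have "\<phi> differentiable at x" for x
    using der off U by (metis UnE UNIV_I ComplD differentiable_def)
  moreover have "continuous_on UNIV (\<lambda>x. frechet_derivative \<phi> (at x) b)" if b: "b \<in> Basis" for b
  proof (subst U[symmetric], rule continuous_on_open_Un[OF D opn])
    show "continuous_on D (\<lambda>x. frechet_derivative \<phi> (at x) b)"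
      using cont[OF b] by (rule continuous_on_eq) (simp add: fr)
    show "continuous_on (- K) (\<lambda>x. frechet_derivative \<phi> (at x) b)"
      by (rule continuous_on_eq[of _ "\<lambda>_. 0"]) (auto simp: fr0)
  qed
  moreover have "closure {x. \<phi> x \<noteq> 0} \<subseteq> K"
    using zero K by (intro closure_minimal) (auto simp: compact_imp_closed)
  moreover from this have "compact (closure {x. \<phi> x \<noteq> 0})"
    using K by (metis closed_closure compact_Int_closed inf.absorb2)
  ultimately show ?thesis using K unfolding C1_compact_support_def by auto
qed

lemma C1_compact_support_obtain:
  assumes "\<phi> \<in> C1_compact_support D"
  shows "\<exists>K. compact K \<and> K \<subseteq> D \<and> (\<forall>x. x \<notin> K \<longrightarrow> \<phi> x = 0 \<and> frechet_derivative \<phi> (at x) = (\<lambda>_. 0))"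
proof (intro exI conjI allI impI)
  let ?K = "closure {x. \<phi> x \<noteq> 0}"
  show "compact ?K" "?K \<subseteq> D" using assms by (auto simp: C1_compact_support_def)
  fix x assume x: "x \<notin> ?K"
  have z: "\<phi> x = 0" if "x \<notin> ?K" for x using that closure_subset[of "{x. \<phi> x \<noteq> 0}"] by auto
  from x show "\<phi> x = 0" by (rule z)
  have "(\<phi> has_derivative (\<lambda>_. 0)) (at x)"
  proof (rule has_derivative_transform_within_open[OF has_derivative_const])
    show "open (- ?K)" by (intro open_Compl closed_closure)
    show "x \<in> - ?K" using x by simp
    show "0 = \<phi> y" if "y \<in> - ?K" for y using z[of y] that by (metis ComplD)
  qed
  from frechet_derivative_at[OF this] show "frechet_derivative \<phi> (at x) = (\<lambda>_. 0)" by simp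
qed

lemma C1_compact_support_has_derivative:
  "\<phi> \<in> C1_compact_support D \<Longrightarrow> (\<phi> has_derivative frechet_derivative \<phi> (at x)) (at x)"
  by (auto simp: C1_compact_support_def frechet_derivative_works)

lemma C1_compact_support_continuous:
  "\<phi> \<in> C1_compact_support D \<Longrightarrow> continuous_on UNIV \<phi>"
  by (auto simp: C1_compact_support_def continuous_on_eq_continuous_at differentiable_imp_continuous_within)

lemma C1_compact_support_continuous_deriv:
  "\<phi> \<in> C1_compact_support D \<Longrightarrow> b \<in> Basis \<Longrightarrow> continuous_on UNIV (\<lambda>x. frechet_derivative \<phi> (at x) b)"
  by (auto simp: C1_compact_support_def)

lemma C1_compact_support_mono:
  "\<phi> \<in> C1_compact_support D \<Longrightarrow> D \<subseteq> D' \<Longrightarrow> \<phi> \<in> C1_compact_support D'"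
  by (auto simp: C1_compact_support_def)

lemma continuous_compact_support_bounded:
  fixes f :: "'a::euclidean_space \<Rightarrow> real"
  assumes "continuous_on UNIV f" "compact K" "\<And>x. x \<notin> K \<Longrightarrow> f x = 0"
  shows "\<exists>C\<ge>0. \<forall>x. \<bar>f x\<bar> \<le> C"
proof -
  have "compact (f ` K)" using assms by (intro compact_continuous_image) (auto intro: continuous_on_subset)
  then obtain C where C: "\<And>x. x \<in> K \<Longrightarrow> \<bar>f x\<bar> \<le> C"
    by (metis (no_types, lifting) bounded_iff compact_imp_bounded imageI real_norm_def)
  have "\<bar>f x\<bar> \<le> max C 0" for x
    using C[of x] assms(3)[of x] by (cases "x \<in> K") auto
  then show ?thesis by (intro exI[of _ "max C 0"]) auto
qed

lemma C1_compact_support_bounded: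
  assumes "\<phi> \<in> C1_compact_support D"
  shows "\<exists>C\<ge>0. \<forall>x. \<bar>\<phi> x\<bar> \<le> C"
proof -
  obtain K where K: "compact K" "\<And>x. x \<notin> K \<Longrightarrow> \<phi> x = 0"
    using C1_compact_support_obtain[OF assms] by blast
  show ?thesis
    by (rule continuous_compact_support_bounded[OF C1_compact_support_continuous[OF assms] K])
qed

lemma C1_compact_support_deriv_bounded:
  assumes "\<phi> \<in> C1_compact_support D" "b \<in> Basis"
  shows "\<exists>C\<ge>0. \<forall>x. \<bar>frechet_derivative \<phi> (at x) b\<bar> \<le> C"
proof -
  obtain K where K: "compact K" "\<And>x. x \<notin> K \<Longrightarrow> frechet_derivative \<phi> (at x) = (\<lambda>_. 0)"
    using C1_compact_support_obtain[OF assms(1)] by blast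
  show ?thesis
    by (rule continuous_compact_support_bounded[OF C1_compact_support_continuous_deriv[OF assms] K(1)])
      (simp add: K(2))
qed

lemma borel_measurable_C1_compact_support [measurable_dest]:
  "\<phi> \<in> C1_compact_support D \<Longrightarrow> \<phi> \<in> borel_measurable borel"
  by (intro borel_measurable_continuous_onI C1_compact_support_continuous)

lemma borel_measurable_C1_compact_support_deriv:
  "\<phi> \<in> C1_compact_support D \<Longrightarrow> b \<in> Basis \<Longrightarrow> (\<lambda>x. frechet_derivative \<phi> (at x) b) \<in> borel_measurable borel"
  by (intro borel_measurable_continuous_onI C1_compact_support_continuous_deriv)

text \<open>Translation invariance of Lebesgue measure makes every difference quotient integrate to zero.\<close>

lemma integral_derivative_C1_compact_support:
  fixes \<phi> :: "'a::euclidean_space \<Rightarrow> real"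
  assumes \<phi>: "\<phi> \<in> C1_compact_support D" and b: "b \<in> Basis"
  shows "(\<integral>x. frechet_derivative \<phi> (at x) b \<partial>lborel) = 0"
proof -
  let ?d = "\<lambda>x. frechet_derivative \<phi> (at x) b"
  obtain K where K: "compact K" "\<And>x. x \<notin> K \<Longrightarrow> \<phi> x = 0"
    using C1_compact_support_obtain[OF \<phi>] by blast
  obtain C where C: "C \<ge> 0" "\<And>x. \<bar>?d x\<bar> \<le> C" using C1_compact_support_deriv_bounded[OF \<phi> b] by blast
  obtain R where R: "\<And>x. x \<in> K \<Longrightarrow> norm x \<le> R" using compact_imp_bounded[OF K(1)] unfolding bounded_iff by blast
  have m[measurable]: "\<phi> \<in> borel_measurable borel" using \<phi> by (rule borel_measurable_C1_compact_support)
  \<comment> \<open>Increments of size at most 1 keep all difference quotients supported in the ball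
    of radius R + 1; together with the mean value bound \<open>C\<close> this gives the dominating
    function.\<close>
  define h where "h n = inverse (real (Suc n))" for n
  have h: "0 < h n" "h n \<le> 1" for n by (auto simp: h_def field_simps)
  have h0: "h \<longlonglongrightarrow> 0" unfolding h_def by (rule LIMSEQ_inverse_real_of_nat)
  define q where "q n x = (\<phi> (x + h n *\<^sub>R b) - \<phi> x) / h n" for n x
  have [measurable]: "q n \<in> borel_measurable borel" for n unfolding q_def by measurable
  have line: "((\<lambda>t. \<phi> (x + t *\<^sub>R b)) has_real_derivative ?d (x + t *\<^sub>R b)) (at t)" for x t
  proof -
    have "((\<lambda>t. \<phi> (x + t *\<^sub>R b)) has_derivative (\<lambda>s. frechet_derivative \<phi> (at (x + t *\<^sub>R b)) (s *\<^sub>R b))) (at t)"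
      by (rule has_derivative_compose[OF _ C1_compact_support_has_derivative[OF \<phi>], where f = "\<lambda>t. x + t *\<^sub>R b"])
        (auto intro!: derivative_eq_intros)
    moreover have "linear (frechet_derivative \<phi> (at (x + t *\<^sub>R b)))"
      using C1_compact_support_has_derivative[OF \<phi>] has_derivative_linear by blast
    ultimately show ?thesis
      by (simp add: has_field_derivative_def linear_scale mult.commute[of _ "frechet_derivative _ _ _"])
  qed
  have qC: "\<bar>q n x\<bar> \<le> C" for n x
  proof -
    obtain z where "\<phi> (x + h n *\<^sub>R b) - \<phi> (x + 0 *\<^sub>R b) = (h n - 0) * ?d (x + z *\<^sub>R b)"
      using MVT2[of 0 "h n" "\<lambda>t. \<phi> (x + t *\<^sub>R b)" "\<lambda>t. ?d (x + t *\<^sub>R b)"] h line by blast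
    then have "q n x = ?d (x + z *\<^sub>R b)" using h[of n] by (simp add: q_def)
    then show ?thesis using C by simp
  qed
  have bdd: "\<bar>q n x\<bar> \<le> C * indicator (cball 0 (R + 1)) x" for n x
  proof (cases "x \<in> cball 0 (R + 1)")
    case False
    then have "norm x > R + 1" by simp
    moreover have "norm (x + h n *\<^sub>R b) \<ge> norm x - 1"
      using norm_diff_ineq[of x "h n *\<^sub>R b"] h[of n] b by (simp add: norm_Basis)
    ultimately have "x \<notin> K" "x + h n *\<^sub>R b \<notin> K" using R by (smt (verit))+
    then have "q n x = 0" using K by (simp add: q_def)
    then show ?thesis using C by simp
  qed (use qC in auto)
  have dom: "integrable lborel (\<lambda>x. C * indicator (cball 0 (R + 1)) x :: real)"
    by (intro integrable_mult_right integrable_real_indicator) (simp, rule emeasure_lborel_cball_finite)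
  have K': "integrable lborel \<phi>"
  proof -
    have "integrable lborel (\<lambda>x. indicator K x *\<^sub>R \<phi> x)"
      using C1_compact_support_continuous[OF \<phi>] K by (intro borel_integrable_compact) (auto intro: continuous_on_subset)
    also have "(\<lambda>x. indicator K x *\<^sub>R \<phi> x) = \<phi>"
      by (rule ext) (use K(2) in \<open>auto simp: indicator_def\<close>)
    finally show ?thesis .
  qed
  have tr: "(\<integral>x. \<phi> (x + c) \<partial>lborel) = (\<integral>x. \<phi> x \<partial>lborel)" "integrable lborel (\<lambda>x. \<phi> (x + c))" for c
  proof -
    have "(\<integral>x. \<phi> x \<partial>lborel) = (\<integral>x. \<phi> x \<partial>distr lborel borel ((+) c))" by (simp add: lborel_distr_plus)
    also have "\<dots> = (\<integral>x. \<phi> (c + x) \<partial>lborel)" by (rule integral_distr) auto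
    finally show "(\<integral>x. \<phi> (x + c) \<partial>lborel) = (\<integral>x. \<phi> x \<partial>lborel)" by (simp add: add.commute)
    have "integrable (distr lborel borel ((+) c)) \<phi>" using K' by (simp add: lborel_distr_plus)
    then have "integrable lborel (\<lambda>x. \<phi> (c + x))" by (subst (asm) integrable_distr_eq) auto
    then show "integrable lborel (\<lambda>x. \<phi> (x + c))" by (simp add: add.commute)
  qed
  have "(\<lambda>n. \<integral>x. q n x \<partial>lborel) \<longlonglongrightarrow> (\<integral>x. ?d x \<partial>lborel)"
  proof (rule integral_dominated_convergence[OF _ _ dom])
    show "AE x in lborel. (\<lambda>n. q n x) \<longlonglongrightarrow> ?d x"
    proof (rule AE_I2)
      fix x
      have "((\<lambda>t. (\<phi> (x + t *\<^sub>R b) - \<phi> (x + 0 *\<^sub>R b)) / (t - 0)) \<longlongrightarrow> ?d (x + 0 *\<^sub>R b)) (at 0)"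
        using line[of x 0] by (simp only: has_field_derivative_iff)
      then have "(\<lambda>n. (\<phi> (x + h n *\<^sub>R b) - \<phi> (x + 0 *\<^sub>R b)) / (h n - 0)) \<longlonglongrightarrow> ?d (x + 0 *\<^sub>R b)"
        by (rule filterlim_compose) (use h0 h in \<open>auto simp: filterlim_at less_imp_neq[THEN not_sym]\<close>)
      then show "(\<lambda>n. q n x) \<longlonglongrightarrow> ?d x" by (simp add: q_def)
    qed
    show "AE x in lborel. norm (q n x) \<le> C * indicator (cball 0 (R + 1)) x" for n using bdd by auto
    show "?d \<in> borel_measurable lborel" using borel_measurable_C1_compact_support_deriv[OF \<phi> b] by simp
  qed auto
  moreover have "(\<integral>x. q n x \<partial>lborel) = 0" for n
    unfolding q_def using tr K' by simp
  ultimately show ?thesis by (simp add: LIMSEQ_const_iff)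
qed

section \<open>The eigenvalue and the normalization of competitors\<close>

text \<open>Absorbing the weight into the measure turns the quotient and the constraint into plain
  integrals, so that the results for finite measures apply to both eigenvalue problems
  alike.\<close>

definition weighted_on :: "'a::euclidean_space set \<Rightarrow> ('a \<Rightarrow> real) \<Rightarrow> 'a measure" where
  "weighted_on D w = density (restrict_space lborel D) (\<lambda>x. ennreal (w x))"

lemma borel_measurable_restrict_lborel_iff:
  fixes f :: "'a::euclidean_space \<Rightarrow> 'b::real_normed_vector"
  assumes "D \<in> sets borel"
  shows "f \<in> borel_measurable (restrict_space lborel D) \<longleftrightarrow> set_borel_measurable lborel D f"
  using assms by (simp add: borel_measurable_restrict_space_iff set_borel_measurable_def)

lemma integrable_restrict_lborel_iff:
  fixes f :: "'a::euclidean_space \<Rightarrow> 'b::{banach, second_countable_topology}"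
  assumes "D \<in> sets borel"
  shows "integrable (restrict_space lborel D) f \<longleftrightarrow> set_integrable lborel D f"
  using assms by (simp add: integrable_restrict_space set_integrable_def)

lemma integral_restrict_lborel:
  fixes f :: "'a::euclidean_space \<Rightarrow> 'b::{banach, second_countable_topology}"
  assumes "D \<in> sets borel"
  shows "integral\<^sup>L (restrict_space lborel D) f = (LINT x:D|lborel. f x)"
  using assms by (simp add: integral_restrict_space set_lebesgue_integral_def)

lemma Lp_on_iff:
  assumes "D \<in> sets borel"
  shows "f \<in> Lp_on p D \<longleftrightarrow> f \<in> borel_measurable (restrict_space lborel D) \<and>
    integrable (restrict_space lborel D) (\<lambda>x. norm (f x) powr p)"
  using assms by (simp add: Lp_on_def borel_measurable_restrict_lborel_iff integrable_restrict_lborel_iff)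

text \<open>Serves twice: the interval with weight \<delta>, and the strip with weight 1. The bound
  \<open>W\<close> makes Lebesgue integrability on \<open>D\<close> imply integrability for the
  weighted measure, and positivity of \<open>w\<close> makes the two measures share their null
  sets.\<close>

locale weighted_domain =
  fixes D :: "'a::euclidean_space set" and w :: "'a \<Rightarrow> real" and W :: real and p :: real
  assumes p: "p > 1"
    and open_D: "open D" and D_ne: "D \<noteq> {}" and fin_D: "emeasure lborel D < \<infinity>"
    and w_meas: "w \<in> borel_measurable (restrict_space lborel D)"
    and w_pos: "\<And>x. x \<in> D \<Longrightarrow> 0 < w x" and w_le: "\<And>x. x \<in> D \<Longrightarrow> w x \<le> W"
begin

abbreviation "MD \<equiv> restrict_space lborel D"
abbreviation "N \<equiv> weighted_on D w"

lemma borel_D: "D \<in> sets borel" using open_D by simp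

sublocale MD: finite_measure MD
  using fin_D borel_D by (intro finite_measureI) (simp add: emeasure_restrict_space space_restrict_space)

lemma measurable_N: "borel_measurable N = borel_measurable MD"
  unfolding weighted_on_def by (intro measurable_cong_sets) auto

lemma w_nonneg: "AE x in MD. 0 \<le> w x"
  using w_pos by (intro AE_I2) (auto simp: space_restrict_space less_imp_le)

lemma integral_N:
  fixes f :: "'a \<Rightarrow> real"
  assumes "f \<in> borel_measurable MD"
  shows "(\<integral>x. f x \<partial>N) = (LINT x:D|lborel. f x * w x)"
proof -
  have "(\<integral>x. f x \<partial>N) = (\<integral>x. w x *\<^sub>R f x \<partial>MD)"
    unfolding weighted_on_def using assms w_meas w_nonneg by (intro integral_density) auto
  then show ?thesis by (simp add: integral_restrict_lborel[OF borel_D] mult.commute)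
qed

lemma integrable_N:
  fixes f :: "'a \<Rightarrow> real"
  assumes f: "integrable MD f"
  shows "integrable N f"
proof -
  have [measurable]: "f \<in> borel_measurable MD" "w \<in> borel_measurable MD" using f w_meas by auto
  have "integrable MD (\<lambda>x. w x *\<^sub>R f x)"
  proof (rule Bochner_Integration.integrable_bound)
    show "integrable MD (\<lambda>x. W * f x)" using f by simp
    show "AE x in MD. norm (w x *\<^sub>R f x) \<le> norm (W * f x)"
    proof (rule AE_I2)
      fix x assume "x \<in> space MD"
      then have "x \<in> D" by (simp add: space_restrict_space)
      then have "\<bar>w x\<bar> \<le> \<bar>W\<bar>" using w_pos[of x] w_le[of x] by simp
      then show "norm (w x *\<^sub>R f x) \<le> norm (W * f x)" by (simp add: abs_mult mult_right_mono)
    qed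
  qed simp
  then show ?thesis unfolding weighted_on_def using w_nonneg by (subst integrable_density) auto
qed

sublocale N: finite_measure N
proof
  have "integrable N (\<lambda>_. 1::real)" by (rule integrable_N) simp
  then have "(\<integral>\<^sup>+x. ennreal (norm (1::real)) \<partial>N) < \<infinity>" by (simp only: integrable_iff_bounded)
  then show "emeasure N (space N) \<noteq> \<infinity>" by simp
qed

lemma AE_N: "(AE x in N. P x) \<longleftrightarrow> (AE x in lborel. x \<in> D \<longrightarrow> P x)"
proof -
  have "(AE x in N. P x) \<longleftrightarrow> (AE x in MD. 0 < w x \<longrightarrow> P x)"
    unfolding weighted_on_def using w_meas by (subst AE_density) auto
  also have "\<dots> \<longleftrightarrow> (AE x in MD. P x)"
    using w_pos by (intro AE_cong) (auto simp: space_restrict_space)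
  also have "\<dots> \<longleftrightarrow> (AE x in lborel. x \<in> D \<longrightarrow> P x)"
    using borel_D by (simp add: AE_restrict_space_iff)
  finally show ?thesis .
qed

lemma measure_N_pos: "measure N (space N) > 0"
proof (rule ccontr)
  assume "\<not> measure N (space N) > 0"
  then have "measure N (space N) = 0" using measure_nonneg[of N "space N"] by linarith
  then have "emeasure N (space N) = 0" by (simp add: N.emeasure_eq_measure)
  then have "space N \<in> null_sets N" by (simp add: null_sets_def)
  then have "AE x in N. False" using AE_not_in by fastforce
  then have "AE x in lborel. x \<notin> D" by (simp add: AE_N)
  then have "D \<in> null_sets lborel" using borel_D by (subst AE_iff_null_sets) auto
  then show False using open_D D_ne by (metis negligible_iff_null_sets null_sets_completionI open_not_negligible)
qed

lemma W1p_measurable: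
  assumes "W1p_with_gradient p D v g"
  shows "v \<in> borel_measurable MD" "g \<in> borel_measurable MD"
    "integrable MD (\<lambda>x. \<bar>v x\<bar> powr p)" "integrable MD (\<lambda>x. norm (g x) powr p)"
  using assms unfolding W1p_with_gradient_def Lp_on_iff[OF borel_D] by auto

text \<open>That a constant has weak gradient zero means here that partial derivatives of test
  functions have integral zero. The constant lies in the p-integrable class because \<open>D\<close>
  has finite measure.\<close>

lemma W1p_diff_const:
  assumes vg: "W1p_with_gradient p D v g"
  shows "W1p_with_gradient p D (\<lambda>x. v x - c) g"
proof -
  note [measurable] = W1p_measurable(1,2)[OF vg]
  have "integrable MD (\<lambda>x. \<bar>v x\<bar> powr 1)"
    by (rule MD.integrable_powr_smaller[OF _ W1p_measurable(3)[OF vg]]) (use p in auto)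
  then have iv: "integrable MD v" by (simp add: integrable_abs_iff)
  have "integrable MD (\<lambda>x. \<bar>v x - c\<bar> powr p)"
    using W1p_measurable(3)[OF vg] p by (intro MD.integrable_powr_diff) auto
  moreover have "has_weak_gradient D (\<lambda>x. v x - c) g"
    unfolding has_weak_gradient_def
  proof (intro ballI)
    fix \<phi> and b :: 'a assume \<phi>: "\<phi> \<in> C1_compact_support D" and b: "b \<in> Basis"
    let ?d = "\<lambda>x. frechet_derivative \<phi> (at x) b"
    note [measurable] = borel_measurable_C1_compact_support_deriv[OF \<phi> b]
    have dm[measurable]: "?d \<in> borel_measurable MD" by (intro measurable_restrict_space1) simp
    obtain C where C: "\<And>x. \<bar>?d x\<bar> \<le> C" using C1_compact_support_deriv_bounded[OF \<phi> b] by blast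
    obtain K where K: "K \<subseteq> D" "\<And>x. x \<notin> K \<Longrightarrow> frechet_derivative \<phi> (at x) = (\<lambda>_. 0)"
      using C1_compact_support_obtain[OF \<phi>] by blast
    have 1: "integrable MD (\<lambda>x. v x * ?d x)"
    proof (rule Bochner_Integration.integrable_bound)
      show "integrable MD (\<lambda>x. C * v x)" using iv by simp
      show "AE x in MD. norm (v x * ?d x) \<le> norm (C * v x)"
      proof (rule AE_I2)
        fix x
        have "\<bar>?d x\<bar> \<le> \<bar>C\<bar>" using C[of x] by linarith
        then show "norm (v x * ?d x) \<le> norm (C * v x)" by (simp add: abs_mult mult.commute[of "\<bar>v x\<bar>"] mult_right_mono)
      qed
    qed simp
    have 2: "integrable MD ?d" using C by (intro MD.integrable_const_bound[of _ C]) auto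
    have "(\<integral>x. ?d x \<partial>MD) = (\<integral>x. ?d x \<partial>lborel)"
      unfolding integral_restrict_lborel[OF borel_D] set_lebesgue_integral_def
    proof (rule Bochner_Integration.integral_cong[OF refl])
      fix x show "indicator D x *\<^sub>R ?d x = ?d x" using K(1) K(2)[of x] by (cases "x \<in> D"; cases "x \<in> K") auto
    qed
    also have "\<dots> = 0" by (rule integral_derivative_C1_compact_support[OF \<phi> b])
    finally have 3: "(\<integral>x. ?d x \<partial>MD) = 0" .
    have "(LINT x:D|lborel. (v x - c) * ?d x) = (\<integral>x. v x * ?d x - c * ?d x \<partial>MD)"
      unfolding integral_restrict_lborel[OF borel_D] by (simp add: algebra_simps)
    also have "\<dots> = (\<integral>x. v x * ?d x \<partial>MD)"
      using 1 2 3 by simp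
    also have "\<dots> = (LINT x:D|lborel. v x * ?d x)" by (rule integral_restrict_lborel[OF borel_D])
    also have "\<dots> = - (LINT x:D|lborel. (g x \<bullet> b) * \<phi> x)"
      using vg \<phi> b unfolding W1p_with_gradient_def has_weak_gradient_def by blast
    finally show "(LINT x:D|lborel. (v x - c) * ?d x) = - (LINT x:D|lborel. (g x \<bullet> b) * \<phi> x)" .
  qed
  ultimately show ?thesis
    using vg unfolding W1p_with_gradient_def Lp_on_iff[OF borel_D] by auto
qed

text \<open>The admissible pairs of the infimum, with nontriviality expressed as positivity of the
  denominator.\<close>

definition competitor :: "('a \<Rightarrow> real) \<Rightarrow> ('a \<Rightarrow> 'a) \<Rightarrow> bool" where
  "competitor v g \<longleftrightarrow> W1p_with_gradient p D v g \<and> (\<integral>x. \<bar>v x\<bar> powr p \<partial>N) > 0 \<and>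
    (\<integral>x. \<bar>v x\<bar> powr (p - 2) * v x \<partial>N) = 0"

lemma integral_N_pos_iff:
  assumes vg: "W1p_with_gradient p D v g"
  shows "(\<integral>x. \<bar>v x\<bar> powr p \<partial>N) > 0 \<longleftrightarrow> \<not> (AE x in lborel. x \<in> D \<longrightarrow> v x = 0)"
proof -
  have "(\<integral>x. \<bar>v x\<bar> powr p \<partial>N) = 0 \<longleftrightarrow> (AE x in N. \<bar>v x\<bar> powr p = 0)"
    by (intro integral_nonneg_eq_0_iff_AE integrable_N W1p_measurable(3)[OF vg]) auto
  also have "\<dots> \<longleftrightarrow> (AE x in lborel. x \<in> D \<longrightarrow> v x = 0)" by (simp add: AE_N)
  finally have "(\<integral>x. \<bar>v x\<bar> powr p \<partial>N) = 0 \<longleftrightarrow> (AE x in lborel. x \<in> D \<longrightarrow> v x = 0)" .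
  moreover have "(\<integral>x. \<bar>v x\<bar> powr p \<partial>N) \<ge> 0" by simp
  ultimately show ?thesis by linarith
qed

lemma mu1_eq:
  "weighted_neumann_mu1 p D w =
    Inf {(\<integral>x. norm (g x) powr p \<partial>N) / (\<integral>x. \<bar>v x\<bar> powr p \<partial>N) | v g. competitor v g}"
proof -
  have "competitor v g \<longleftrightarrow> W1p_with_gradient p D v g \<and> \<not> (AE x in lborel. x \<in> D \<longrightarrow> v x = 0) \<and>
      (LINT x:D|lborel. \<bar>v x\<bar> powr (p - 2) * v x * w x) = 0" for v g
  proof -
    have "(\<integral>x. \<bar>v x\<bar> powr (p - 2) * v x \<partial>N) = (LINT x:D|lborel. \<bar>v x\<bar> powr (p - 2) * v x * w x)"
      if "W1p_with_gradient p D v g"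
    proof -
      note [measurable] = W1p_measurable(1,2)[OF that]
      show ?thesis by (rule integral_N) simp
    qed
    then show ?thesis unfolding competitor_def using integral_N_pos_iff[of v g] by (cases "W1p_with_gradient p D v g") simp_all
  qed
  moreover have "(\<integral>x. norm (g x) powr p \<partial>N) = (LINT x:D|lborel. norm (g x) powr p * w x)"
      "(\<integral>x. \<bar>v x\<bar> powr p \<partial>N) = (LINT x:D|lborel. \<bar>v x\<bar> powr p * w x)"
    if "competitor v g" for v g
    using W1p_measurable[of v g] that by (auto simp: competitor_def intro!: integral_N)
  ultimately show ?thesis
    unfolding weighted_neumann_mu1_def by (intro arg_cong[of _ _ Inf]) (metis (no_types, lifting))
qed

lemma mu1_le_centered:
  assumes vg: "W1p_with_gradient p D v g"
  shows "\<exists>c. weighted_neumann_mu1 p D w * (\<integral>x. \<bar>v x - c\<bar> powr p \<partial>N) \<le> (\<integral>x. norm (g x) powr p \<partial>N)"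
proof -
  have "v \<in> borel_measurable N" "integrable N (\<lambda>x. \<bar>v x\<bar> powr p)"
    using W1p_measurable[OF vg] by (auto simp: measurable_N intro: integrable_N)
  from N.exists_centering_const[OF this p measure_N_pos]
  obtain c where c: "(\<integral>x. \<bar>v x - c\<bar> powr (p - 2) * (v x - c) \<partial>N) = 0" by blast
  have W: "W1p_with_gradient p D (\<lambda>x. v x - c) g" by (rule W1p_diff_const[OF vg])
  show ?thesis
  proof (cases "(\<integral>x. \<bar>v x - c\<bar> powr p \<partial>N) > 0")
    case True
    then have comp: "competitor (\<lambda>x. v x - c) g" using W c by (auto simp: competitor_def)
    have "weighted_neumann_mu1 p D w \<le> (\<integral>x. norm (g x) powr p \<partial>N) / (\<integral>x. \<bar>v x - c\<bar> powr p \<partial>N)"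
      unfolding mu1_eq
    proof (rule cInf_lower)
      show "bdd_below {(\<integral>x. norm (g x) powr p \<partial>N) / (\<integral>x. \<bar>v x\<bar> powr p \<partial>N) | v g. competitor v g}"
        by (rule bdd_belowI[of _ 0]) (auto intro!: divide_nonneg_nonneg)
    next
      show "(\<integral>x. norm (g x) powr p \<partial>N) / (\<integral>x. \<bar>v x - c\<bar> powr p \<partial>N)
        \<in> {(\<integral>x. norm (g x) powr p \<partial>N) / (\<integral>x. \<bar>v x\<bar> powr p \<partial>N) | v g. competitor v g}"
        unfolding mem_Collect_eq using comp by (intro exI[of _ "\<lambda>x. v x - c"] exI[of _ g]) simp
    qed
    then show ?thesis using True by (intro exI[of _ c]) (simp add: field_simps)
  next
    case False
    moreover have "(\<integral>x. \<bar>v x - c\<bar> powr p \<partial>N) \<ge> 0" by simp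
    ultimately have "(\<integral>x. \<bar>v x - c\<bar> powr p \<partial>N) = 0" by linarith
    then show ?thesis by (intro exI[of _ c]) simp
  qed
qed

text \<open>The first premise ensures that the infimum runs over a nonempty set of quotients; on the
  reals the infimum of the empty set is an unspecified value.\<close>

lemma mu1_ge:
  assumes "competitor v0 g0"
    and "\<And>v g. competitor v g \<Longrightarrow> m * (\<integral>x. \<bar>v x\<bar> powr p \<partial>N) \<le> (\<integral>x. norm (g x) powr p \<partial>N)"
  shows "m \<le> weighted_neumann_mu1 p D w"
  unfolding mu1_eq
proof (rule cInf_greatest)
  fix q assume "q \<in> {(\<integral>x. norm (g x) powr p \<partial>N) / (\<integral>x. \<bar>v x\<bar> powr p \<partial>N) | v g. competitor v g}"
  then obtain v g where "competitor v g" and q: "q = (\<integral>x. norm (g x) powr p \<partial>N) / (\<integral>x. \<bar>v x\<bar> powr p \<partial>N)"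
    by blast
  then show "m \<le> q" using assms(2)[of v g] by (simp add: competitor_def pos_le_divide_eq)
qed (use assms(1) in blast)

lemma mu1_nonneg:
  assumes "competitor v0 g0"
  shows "0 \<le> weighted_neumann_mu1 p D w"
  by (rule mu1_ge[OF assms]) simp

lemma competitor_le_diff_const:
  assumes "competitor v g"
  shows "(\<integral>x. \<bar>v x\<bar> powr p \<partial>N) \<le> (\<integral>x. \<bar>v x - c\<bar> powr p \<partial>N)"
  using assms W1p_measurable[of v g] p
  by (intro N.integral_powr_le_diff_const) (auto simp: competitor_def measurable_N intro: integrable_N)

lemma exists_competitor:
  assumes vg: "W1p_with_gradient p D v g" and nc: "\<And>c. \<not> (AE x in lborel. x \<in> D \<longrightarrow> v x = c)"
  shows "\<exists>c. competitor (\<lambda>x. v x - c) g"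
proof -
  have "v \<in> borel_measurable N" "integrable N (\<lambda>x. \<bar>v x\<bar> powr p)"
    using W1p_measurable[OF vg] by (auto simp: measurable_N intro: integrable_N)
  from N.exists_centering_const[OF this p measure_N_pos]
  obtain c where c: "(\<integral>x. \<bar>v x - c\<bar> powr (p - 2) * (v x - c) \<partial>N) = 0" by blast
  have W: "W1p_with_gradient p D (\<lambda>x. v x - c) g" by (rule W1p_diff_const[OF vg])
  have "(\<integral>x. \<bar>v x - c\<bar> powr p \<partial>N) > 0"
    using integral_N_pos_iff[OF W] nc[of c] by simp
  with W c show ?thesis by (auto simp: competitor_def)
qed

end

section \<open>Change of variables in the plane\<close>

text \<open>The change of variables theorem of the library lives on \<^typ>\<open>real^2\<close>.\<close>

definition vec_of_pair :: "real \<times> real \<Rightarrow> real^2" where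
  "vec_of_pair z = (\<chi> i. if i = 1 then fst z else snd z)"

definition pair_of_vec :: "real^2 \<Rightarrow> real \<times> real" where
  "pair_of_vec w = (w $ 1, w $ 2)"

lemma vec_of_pair_nth [simp]: "vec_of_pair z $ 1 = fst z" "vec_of_pair z $ 2 = snd z"
  by (simp_all add: vec_of_pair_def)

lemma pair_of_vec_of_pair [simp]: "pair_of_vec (vec_of_pair z) = z"
  by (simp add: pair_of_vec_def)

lemma vec_of_pair_of_vec [simp]: "vec_of_pair (pair_of_vec w) = w"
  by (simp add: vec_eq_iff forall_2 pair_of_vec_def)

lemma bounded_linear_pair_of_vec: "bounded_linear pair_of_vec"
  unfolding pair_of_vec_def by (intro bounded_linear_Pair bounded_linear_vec_nth)

lemma bounded_linear_vec_of_pair: "bounded_linear vec_of_pair"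
proof -
  have "linear vec_of_pair"
    by (rule linearI) (simp_all add: vec_eq_iff forall_2)
  then show ?thesis by (simp add: linear_conv_bounded_linear)
qed

lemma borel_measurable_vec_of_pair [measurable]: "vec_of_pair \<in> borel_measurable borel"
  by (intro borel_measurable_continuous_onI linear_continuous_on bounded_linear_vec_of_pair)

lemma borel_measurable_pair_of_vec [measurable]: "pair_of_vec \<in> borel_measurable borel"
  by (intro borel_measurable_continuous_onI linear_continuous_on bounded_linear_pair_of_vec)

lemma emeasure_lborel_rectangle:
  "l1 \<le> u1 \<Longrightarrow> l2 \<le> u2 \<Longrightarrow> emeasure lborel ({l1<..<u1} \<times> {l2<..<u2} :: (real \<times> real) set) = (u1 - l1) * (u2 - l2)"
  by (subst lborel_prod[symmetric], subst lborel.emeasure_pair_measure_Times)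
    (auto simp: ennreal_mult)

text \<open>Lebesgue measure is determined by its values on boxes, and the preimage of a box is a
  product of two intervals.\<close>

lemma distr_vec_of_pair: "distr lborel borel vec_of_pair = lborel"
proof (rule lborel_eqI[symmetric])
  fix l u :: "real^2" assume lu: "\<And>b. b \<in> Basis \<Longrightarrow> l \<bullet> b \<le> u \<bullet> b"
  have le: "l $ i \<le> u $ i" for i using lu[of "axis i 1"] by (simp add: inner_axis axis_in_Basis_iff)
  have eq: "vec_of_pair -` box l u = {l $ 1<..<u $ 1} \<times> {l $ 2<..<u $ 2}"
    by (auto simp: mem_box_cart forall_2)
  have "emeasure (distr lborel borel vec_of_pair) (box l u) = emeasure lborel (vec_of_pair -` box l u)"
    by (subst emeasure_distr) auto
  also have "\<dots> = (u $ 1 - l $ 1) * (u $ 2 - l $ 2)"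
    unfolding eq by (rule emeasure_lborel_rectangle) (rule le)+
  also have "(u $ 1 - l $ 1) * (u $ 2 - l $ 2) = (\<Prod>b\<in>Basis. (u - l) \<bullet> b)"
  proof -
    have "(\<Prod>b\<in>Basis. (u - l) \<bullet> b) = (\<Prod>i\<in>UNIV. (u - l) $ i)"
      unfolding Basis_vec_def
      by (subst prod.reindex_bij_betw[symmetric, of "\<lambda>i. axis i 1" UNIV])
        (auto simp: bij_betw_def inj_on_def axis_eq_axis inner_axis)
    then show ?thesis by (simp add: UNIV_2)
  qed
  finally show "emeasure (distr lborel borel vec_of_pair) (box l u) = (\<Prod>b\<in>Basis. (u - l) \<bullet> b)" .
qed simp

text \<open>The substitution formula for
  \<open>vec_of_pair \<circ> \<Psi> \<circ> pair_of_vec\<close>, carried back along the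
  measure-preserving identification. The determinant is the positive Jacobian, so no absolute value
  survives. The derivative is given by four scalar functions because all later computations with it
  are algebra in its entries.\<close>

lemma emeasure_differentiable_image_plane:
  fixes \<Psi> :: "real \<times> real \<Rightarrow> real \<times> real" and E :: "(real \<times> real) set"
  assumes E: "E \<in> sets borel"
    and der: "\<And>z. z \<in> E \<Longrightarrow> (\<Psi> has_derivative (\<lambda>h. (fst h * Ps z + snd h * Pt z, fst h * Rs z + snd h * Rt z))) (at z)"
    and inj: "inj_on \<Psi> E"
    and J: "\<And>z. z \<in> E \<Longrightarrow> 0 < Ps z * Rt z - Pt z * Rs z"
    and Jm: "(\<lambda>z. indicator E z * (Ps z * Rt z - Pt z * Rs z)) \<in> borel_measurable borel"
    and im: "\<Psi> ` E \<in> sets borel" and fin: "emeasure lborel (\<Psi> ` E) < \<infinity>"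
  shows "emeasure lborel (\<Psi> ` E) = (\<integral>\<^sup>+z. ennreal (indicator E z * (Ps z * Rt z - Pt z * Rs z)) \<partial>lborel)"
proof -
  let ?T = vec_of_pair and ?S = pair_of_vec
  define J where "J z = Ps z * Rt z - Pt z * Rs z" for z
  define f where "f = ?T \<circ> \<Psi> \<circ> ?S"
  define f' where "f' w = ?T \<circ> (\<lambda>h. (fst h * Ps (?S w) + snd h * Pt (?S w), fst h * Rs (?S w) + snd h * Rt (?S w))) \<circ> ?S" for w
  have E2: "?T ` A = ?S -` A" for A
  proof (rule set_eqI, rule iffI)
    fix w assume "w \<in> ?S -` A"
    then have "?S w \<in> A" by simp
    then have "?T (?S w) \<in> ?T ` A" by (rule imageI)
    then show "w \<in> ?T ` A" by simp
  qed auto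
  have vim: "?T -` (?S -` A) = A" for A by auto
  have bor: "?S -` A \<in> sets borel" if "A \<in> sets borel" for A
    using measurable_sets[OF borel_measurable_pair_of_vec that] by simp
  have meas: "emeasure lborel (?S -` A) = emeasure lborel A" if "A \<in> sets borel" for A
  proof -
    have "emeasure lborel (?S -` A) = emeasure (distr lborel borel ?T) (?S -` A)" by (simp add: distr_vec_of_pair)
    also have "\<dots> = emeasure lborel (?T -` (?S -` A))" using bor[OF that] by (subst emeasure_distr) auto
    finally show ?thesis by (simp add: vim)
  qed
  have detf: "\<bar>det (matrix (f' w))\<bar> = J (?S w)" if "w \<in> ?S -` E" for w
  proof -
    have "det (matrix (f' w)) = J (?S w)"
      by (simp add: det_2 matrix_def f'_def pair_of_vec_def J_def axis_def)
    then show ?thesis using J[of "?S w"] that by (simp add: J_def)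
  qed
  have img: "f ` (?S -` E) = ?S -` (\<Psi> ` E)"
    unfolding E2[symmetric] f_def by (auto simp: image_image)
  \<comment> \<open>The equivalence is read from left to right: measurability and finite measure of
    the image are known, and the value of the integral is the information gained.\<close>
  have "f ` (?S -` E) \<in> lmeasurable \<and> measure lebesgue (f ` (?S -` E)) = measure lborel (\<Psi> ` E)
    \<longleftrightarrow> ((\<lambda>x. \<bar>det (matrix (f' x))\<bar>) has_integral measure lborel (\<Psi> ` E)) (?S -` E)"
  proof (rule has_measure_differentiable_image)
    show "?S -` E \<in> sets lebesgue" using bor[OF E] by simp
    fix w assume w: "w \<in> ?S -` E"
    have d: "(\<Psi> has_derivative (\<lambda>h. (fst h * Ps (?S w) + snd h * Pt (?S w), fst h * Rs (?S w) + snd h * Rt (?S w)))) (at (?S w))"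
      using w by (intro der) simp
    have "(?T \<circ> (\<Psi> \<circ> ?S) has_derivative ?T \<circ> ((\<lambda>h. (fst h * Ps (?S w) + snd h * Pt (?S w), fst h * Rs (?S w) + snd h * Rt (?S w))) \<circ> ?S)) (at w)"
      by (intro diff_chain_at d bounded_linear_imp_has_derivative bounded_linear_vec_of_pair bounded_linear_pair_of_vec)
    from has_derivative_at_withinI[OF this] show "(f has_derivative f' w) (at w within ?S -` E)"
      by (simp only: f_def f'_def o_assoc)
  next
    show "inj_on f (?S -` E)"
    proof (rule inj_onI)
      fix u v assume uv: "u \<in> ?S -` E" "v \<in> ?S -` E" "f u = f v"
      then have "?S (f u) = ?S (f v)" by simp
      then have "\<Psi> (?S u) = \<Psi> (?S v)" by (simp add: f_def)
      then have "?S u = ?S v" using inj_onD[OF inj] uv by blast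
      then have "?T (?S u) = ?T (?S v)" by simp
      then show "u = v" by simp
    qed
  qed
  moreover have "f ` (?S -` E) \<in> lmeasurable"
    using fin bor[OF im] meas[OF im] unfolding img by (auto simp: fmeasurable_def)
  moreover have "measure lebesgue (f ` (?S -` E)) = measure lborel (\<Psi> ` E)"
    using bor[OF im] meas[OF im] unfolding img by (simp add: measure_def)
  ultimately have "((\<lambda>x. \<bar>det (matrix (f' x))\<bar>) has_integral measure lborel (\<Psi> ` E)) (?S -` E)" by blast
  then have "((\<lambda>w. J (?S w)) has_integral measure lborel (\<Psi> ` E)) (?S -` E)"
    by (rule has_integral_eq[rotated]) (use detf in auto)
  from nn_integral_has_integral_lebesgue[OF _ this]
  have "(\<integral>\<^sup>+w. ennreal (indicator (?S -` E) w * J (?S w)) \<partial>lborel) = measure lborel (\<Psi> ` E)"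
    using J by (auto simp: J_def less_imp_le)
  also have "(\<integral>\<^sup>+w. ennreal (indicator (?S -` E) w * J (?S w)) \<partial>lborel)
      = (\<integral>\<^sup>+w. ennreal (indicator (?S -` E) w * J (?S w)) \<partial>distr lborel borel ?T)" by (simp add: distr_vec_of_pair)
  also have "\<dots> = (\<integral>\<^sup>+z. ennreal (indicator (?S -` E) (?T z) * J (?S (?T z))) \<partial>lborel)"
  proof -
    have "(\<lambda>w. indicator E (?S w) * J (?S w)) \<in> borel_measurable borel"
      using measurable_compose[OF borel_measurable_pair_of_vec Jm] by (simp add: J_def)
    then have "(\<lambda>w. ennreal (indicator (?S -` E) w * J (?S w))) \<in> borel_measurable borel"
      by (simp add: indicator_def)
    then show ?thesis by (subst nn_integral_distr) simp_all
  qed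
  also have "\<dots> = (\<integral>\<^sup>+z. ennreal (indicator E z * J z) \<partial>lborel)" by (simp add: indicator_def)
  finally show ?thesis using fin by (simp add: J_def emeasure_eq_ennreal_measure less_top)
qed

text \<open>\<open>Ps\<close>, \<open>Pt\<close> and \<open>Rs\<close>, \<open>Rt\<close> are the
  partial derivatives, in the coordinates s and t, of the first and the second component of the
  chart. A positive determinant, rather than a nonzero one, spares absolute values
  throughout.\<close>

locale planar_chart =
  fixes Q :: "(real \<times> real) set" and \<Psi> :: "real \<times> real \<Rightarrow> real \<times> real"
    and Ps Pt Rs Rt :: "real \<times> real \<Rightarrow> real"
  assumes open_Q: "open Q"
    and inj: "inj_on \<Psi> Q"
    and der: "\<And>z. z \<in> Q \<Longrightarrow> (\<Psi> has_derivative (\<lambda>h. (fst h * Ps z + snd h * Pt z, fst h * Rs z + snd h * Rt z))) (at z)"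
    and cont: "continuous_on Q Ps" "continuous_on Q Pt" "continuous_on Q Rs" "continuous_on Q Rt"
    and J_pos: "\<And>z. z \<in> Q \<Longrightarrow> 0 < Ps z * Rt z - Pt z * Rs z"
    and fin: "emeasure lborel (\<Psi> ` Q) < \<infinity>"
begin

abbreviation "MQ \<equiv> restrict_space lborel Q"
abbreviation "D \<equiv> \<Psi> ` Q"
abbreviation "MD \<equiv> restrict_space lborel D"

definition J :: "real \<times> real \<Rightarrow> real" where "J z = Ps z * Rt z - Pt z * Rs z"

definition inverse_chart :: "real \<times> real \<Rightarrow> real \<times> real" where "inverse_chart = inv_into Q \<Psi>"

lemma inverse_chart [simp]: "z \<in> Q \<Longrightarrow> inverse_chart (\<Psi> z) = z"
  by (simp add: inverse_chart_def inj inv_into_f_f)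

lemma continuous_chart: "continuous_on Q \<Psi>"
  using der has_derivative_continuous by (blast intro: continuous_at_imp_continuous_on)

lemma open_D: "open D"
  by (rule invariance_of_domain[OF continuous_chart open_Q inj])

lemma continuous_inverse_chart: "continuous_on D inverse_chart"
  by (rule continuous_on_inverse_open[OF open_Q continuous_chart]) auto

lemma J_positive: "z \<in> Q \<Longrightarrow> 0 < J z"
  using J_pos[of z] by (simp add: J_def)

lemma continuous_J: "continuous_on Q J"
  unfolding J_def by (intro continuous_intros cont)

lemma borel_Q: "Q \<in> sets borel" and borel_D: "D \<in> sets borel"
  using open_Q open_D by simp_all

lemma measurable_continuous_MQ: "continuous_on Q f \<Longrightarrow> f \<in> borel_measurable MQ"
  for f :: "real \<times> real \<Rightarrow> 'b::{real_normed_vector, second_countable_topology}"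
  using borel_measurable_continuous_on_restrict[of Q f] by (simp cong: measurable_cong_sets)

lemma measurable_J: "J \<in> borel_measurable MQ"
  by (rule measurable_continuous_MQ[OF continuous_J])

lemma measurable_chart: "\<Psi> \<in> measurable MQ MD"
proof (rule measurable_restrict_space2)
  show "\<Psi> \<in> measurable MQ lborel"
    using measurable_continuous_MQ[OF continuous_chart] by simp
qed (auto simp: space_restrict_space)

lemma measurable_inverse_chart: "inverse_chart \<in> measurable MD MQ"
proof (rule measurable_restrict_space2)
  show "inverse_chart \<in> measurable MD lborel"
    using borel_measurable_continuous_on_restrict[OF continuous_inverse_chart]
    by (simp cong: measurable_cong_sets)
qed (auto simp: space_restrict_space)

text \<open>Change of variables as an identity of measures: the area formula for images of Borel
  sets gives at once the substitution rule and the integrability criterion for all measurable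
  functions on the image.\<close>

lemma MD_eq: "MD = distr (density MQ (\<lambda>z. ennreal (J z))) MD \<Psi>"
proof (rule measure_eqI)
  fix A assume A: "A \<in> sets MD"
  then have AD: "A \<subseteq> D" and Ab: "A \<in> sets borel" using borel_D by (auto simp: sets_restrict_space_iff)
  define E where "E = Q \<inter> \<Psi> -` A"
  have E: "E \<in> sets borel"
    using measurable_sets[OF measurable_chart A] borel_Q by (simp add: space_restrict_space sets_restrict_space_iff E_def Int_commute)
  have img: "\<Psi> ` E = A" using AD by (auto simp: E_def)
  have EQ: "E \<subseteq> Q" by (auto simp: E_def)
  have Jm: "(\<lambda>z. indicator E z * J z) \<in> borel_measurable borel"
  proof -
    have "(\<lambda>z. indicator Q z *\<^sub>R J z) \<in> borel_measurable borel"
      using measurable_J borel_Q by (simp add: borel_measurable_restrict_space_iff)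
    then have "(\<lambda>z. indicator E z * (indicator Q z *\<^sub>R J z)) \<in> borel_measurable borel" using E by measurable
    also have "(\<lambda>z. indicator E z * (indicator Q z *\<^sub>R J z)) = (\<lambda>z. indicator E z * J z)"
      by (rule ext) (use EQ in \<open>auto simp: indicator_def\<close>)
    finally show ?thesis .
  qed
  have "emeasure MD A = emeasure lborel A" using AD borel_D by (simp add: emeasure_restrict_space)
  also have "\<dots> = (\<integral>\<^sup>+z. ennreal (indicator E z * J z) \<partial>lborel)"
    unfolding img[symmetric] J_def
  proof (rule emeasure_differentiable_image_plane[OF E])
    show "emeasure lborel (\<Psi> ` E) < \<infinity>"
      using fin emeasure_mono[of A D lborel] AD borel_D by (simp add: img)
  qed (use EQ inj_on_subset[OF inj EQ] J_pos der Jm[unfolded J_def] Ab img in auto)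
  also have "\<dots> = (\<integral>\<^sup>+z. ennreal (J z) * indicator (\<Psi> -` A) z * indicator Q z \<partial>lborel)"
    by (intro nn_integral_cong) (auto simp: E_def indicator_def)
  also have "\<dots> = (\<integral>\<^sup>+z. ennreal (J z) * indicator (\<Psi> -` A) z \<partial>MQ)"
    using borel_Q by (subst nn_integral_restrict_space) auto
  also have "\<dots> = (\<integral>\<^sup>+z. ennreal (J z) * indicator (\<Psi> -` A \<inter> space MQ) z \<partial>MQ)"
    by (intro nn_integral_cong) (auto simp: indicator_def)
  also have "\<dots> = emeasure (density MQ (\<lambda>z. ennreal (J z))) (\<Psi> -` A \<inter> space MQ)"
    using measurable_sets[OF measurable_chart A] measurable_J by (subst emeasure_density) auto
  also have "\<dots> = emeasure (distr (density MQ (\<lambda>z. ennreal (J z))) MD \<Psi>) A"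
    using A measurable_chart by (subst emeasure_distr) auto
  finally show "emeasure MD A = emeasure (distr (density MQ (\<lambda>z. ennreal (J z))) MD \<Psi>) A" .
qed simp

lemma AE_J_nonneg: "AE z in MQ. 0 \<le> J z"
  by (intro AE_I2) (auto simp: space_restrict_space J_positive less_imp_le)

lemma integral_MD:
  fixes f :: "real \<times> real \<Rightarrow> real"
  assumes f[measurable]: "f \<in> borel_measurable MD"
  shows "(\<integral>z. f z \<partial>MD) = (\<integral>z. J z * f (\<Psi> z) \<partial>MQ)"
proof -
  note [measurable] = measurable_chart measurable_J
  have "(\<integral>z. f z \<partial>MD) = (\<integral>z. f (\<Psi> z) \<partial>density MQ (\<lambda>z. ennreal (J z)))"
    by (subst MD_eq, subst integral_distr) auto
  also have "\<dots> = (\<integral>z. J z *\<^sub>R f (\<Psi> z) \<partial>MQ)"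
    by (rule integral_density) (use AE_J_nonneg in auto)
  finally show ?thesis by simp
qed

lemma integrable_MD:
  fixes f :: "real \<times> real \<Rightarrow> real"
  assumes f[measurable]: "f \<in> borel_measurable MD"
  shows "integrable MD f \<longleftrightarrow> integrable MQ (\<lambda>z. J z * f (\<Psi> z))"
proof -
  note [measurable] = measurable_chart measurable_J
  have "integrable MD f \<longleftrightarrow> integrable (density MQ (\<lambda>z. ennreal (J z))) (\<lambda>z. f (\<Psi> z))"
    by (subst MD_eq, subst integrable_distr_eq) auto
  also have "\<dots> \<longleftrightarrow> integrable MQ (\<lambda>z. J z *\<^sub>R f (\<Psi> z))"
    by (rule integrable_density) (use AE_J_nonneg in auto)
  finally show ?thesis by simp
qed

end

section \<open>Weak gradients under planar diffeomorphisms\<close>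

text \<open>The multiplier has to be C1 on \<open>Q\<close> only, since the compact support of
  \<zeta> inside \<open>Q\<close> hides its other values. Jacobian entries and their quotients by
  \<open>J\<close> are multipliers of this kind.\<close>

lemma C1_compact_support_mult:
  fixes \<zeta> m :: "'a::euclidean_space \<Rightarrow> real"
  assumes Q: "open Q" and \<zeta>: "\<zeta> \<in> C1_compact_support Q"
    and m: "\<And>z. z \<in> Q \<Longrightarrow> (m has_derivative m' z) (at z)"
    and cont: "\<And>b. b \<in> Basis \<Longrightarrow> continuous_on Q (\<lambda>z. m' z b)"
  shows "(\<lambda>z. \<zeta> z * m z) \<in> C1_compact_support Q"
    and "z \<in> Q \<Longrightarrow> frechet_derivative (\<lambda>z. \<zeta> z * m z) (at z) h = \<zeta> z * m' z h + frechet_derivative \<zeta> (at z) h * m z"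
proof -
  obtain K where K: "compact K" "K \<subseteq> Q" "\<And>x. x \<notin> K \<Longrightarrow> \<zeta> x = 0"
    using C1_compact_support_obtain[OF \<zeta>] by blast
  have der: "((\<lambda>z. \<zeta> z * m z) has_derivative (\<lambda>h. \<zeta> z * m' z h + frechet_derivative \<zeta> (at z) h * m z)) (at z)"
    if "z \<in> Q" for z
    by (intro has_derivative_mult C1_compact_support_has_derivative[OF \<zeta>] m that)
  have cm: "continuous_on Q m"
    using m has_derivative_continuous by (blast intro: continuous_at_imp_continuous_on)
  show "(\<lambda>z. \<zeta> z * m z) \<in> C1_compact_support Q"
  proof (rule C1_compact_supportI[OF Q K(1,2) der])
    fix b :: 'a assume b: "b \<in> Basis"
    show "continuous_on Q (\<lambda>z. \<zeta> z * m' z b + frechet_derivative \<zeta> (at z) b * m z)"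
      by (intro continuous_intros cont[OF b] cm continuous_on_subset[OF C1_compact_support_continuous[OF \<zeta>]]
          continuous_on_subset[OF C1_compact_support_continuous_deriv[OF \<zeta> b]]) auto
  qed (use K in auto)
  show "frechet_derivative (\<lambda>z. \<zeta> z * m z) (at z) h = \<zeta> z * m' z h + frechet_derivative \<zeta> (at z) h * m z" if z: "z \<in> Q"
    by (rule fun_cong[OF frechet_derivative_at[OF der[OF z], symmetric]])
qed

abbreviation d1 :: "(real \<times> real \<Rightarrow> real) \<Rightarrow> real \<times> real \<Rightarrow> real" where
  "d1 \<phi> z \<equiv> frechet_derivative \<phi> (at z) (1, 0)"
abbreviation d2 :: "(real \<times> real \<Rightarrow> real) \<Rightarrow> real \<times> real \<Rightarrow> real" where
  "d2 \<phi> z \<equiv> frechet_derivative \<phi> (at z) (0, 1)"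

lemma Basis_real_pair: "(Basis :: (real \<times> real) set) = {(1, 0), (0, 1)}"
  by (auto simp: Basis_prod_def)

lemma linear_real_pair:
  fixes f :: "real \<times> real \<Rightarrow> real"
  assumes "linear f" shows "f h = fst h * f (1, 0) + snd h * f (0, 1)"
proof -
  have "h = fst h *\<^sub>R (1, 0) + snd h *\<^sub>R (0, 1)" by (cases h) simp
  then have "f h = f (fst h *\<^sub>R (1, 0) + snd h *\<^sub>R (0, 1))" by simp
  also have "\<dots> = fst h * f (1, 0) + snd h * f (0, 1)"
    using assms by (simp only: linear_add linear_scale real_scaleR_def)
  finally show ?thesis .
qed

lemma frechet_derivative_real_pair:
  assumes "\<phi> \<in> C1_compact_support D"
  shows "frechet_derivative \<phi> (at z) h = fst h * d1 \<phi> z + snd h * d2 \<phi> z"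
  by (rule linear_real_pair)
    (rule has_derivative_linear[OF C1_compact_support_has_derivative[OF assms]])

lemma C1_real_pair:
  fixes \<phi> :: "real \<times> real \<Rightarrow> real"
  assumes \<phi>: "\<phi> \<in> C1_compact_support D"
  shows "\<phi> \<in> borel_measurable borel" "d1 \<phi> \<in> borel_measurable borel" "d2 \<phi> \<in> borel_measurable borel"
    "\<exists>C. \<forall>z. \<bar>\<phi> z\<bar> \<le> C" "\<exists>C. \<forall>z. \<bar>d1 \<phi> z\<bar> \<le> C" "\<exists>C. \<forall>z. \<bar>d2 \<phi> z\<bar> \<le> C"
proof -
  have B: "(1, 0) \<in> (Basis :: (real \<times> real) set)" "(0, 1) \<in> (Basis :: (real \<times> real) set)"
    by (simp_all add: Basis_real_pair)
  show "\<phi> \<in> borel_measurable borel" by (rule borel_measurable_C1_compact_support[OF \<phi>])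
  show "d1 \<phi> \<in> borel_measurable borel" "d2 \<phi> \<in> borel_measurable borel"
    by (rule borel_measurable_C1_compact_support_deriv[OF \<phi>], rule B)+
  show "\<exists>C. \<forall>z. \<bar>\<phi> z\<bar> \<le> C" using C1_compact_support_bounded[OF \<phi>] by blast
  show "\<exists>C. \<forall>z. \<bar>d1 \<phi> z\<bar> \<le> C" using C1_compact_support_deriv_bounded[OF \<phi> B(1)] by blast
  show "\<exists>C. \<forall>z. \<bar>d2 \<phi> z\<bar> \<le> C" using C1_compact_support_deriv_bounded[OF \<phi> B(2)] by blast
qed

lemma borel_measurable_restrict_lborelI:
  fixes f :: "'a::euclidean_space \<Rightarrow> 'b::topological_space"
  shows "f \<in> borel_measurable borel \<Longrightarrow> f \<in> borel_measurable (restrict_space lborel D)"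
  by (intro measurable_restrict_space1) simp

lemma integrable_mult_bounded:
  fixes u f :: "'a \<Rightarrow> real"
  assumes "integrable M u" and [measurable]: "f \<in> borel_measurable M" and "\<exists>C. \<forall>z. \<bar>f z\<bar> \<le> C"
  shows "integrable M (\<lambda>z. u z * f z)"
proof -
  obtain C where C: "\<And>z. \<bar>f z\<bar> \<le> C" using assms by blast
  show ?thesis
  proof (rule Bochner_Integration.integrable_bound)
    show "integrable M (\<lambda>z. C * u z)" using assms by simp
    show "AE z in M. norm (u z * f z) \<le> norm (C * u z)"
    proof (rule AE_I2)
      fix z
      have "\<bar>f z\<bar> \<le> \<bar>C\<bar>" using C[of z] by linarith
      then show "norm (u z * f z) \<le> norm (C * u z)"
        by (simp add: abs_mult mult.commute[of "\<bar>u z\<bar>"] mult_right_mono)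
    qed
  qed (use assms in measurable)
qed

lemma has_weak_gradient_real_pair:
  assumes "D \<in> sets borel"
  shows "has_weak_gradient D v g \<longleftrightarrow>
    (\<forall>\<phi>\<in>C1_compact_support D.
      (\<integral>z. v z * d1 \<phi> z \<partial>restrict_space lborel D) = - (\<integral>z. fst (g z) * \<phi> z \<partial>restrict_space lborel D) \<and>
      (\<integral>z. v z * d2 \<phi> z \<partial>restrict_space lborel D) = - (\<integral>z. snd (g z) * \<phi> z \<partial>restrict_space lborel D))"
  unfolding has_weak_gradient_def by (simp add: Basis_real_pair integral_restrict_lborel[OF assms] inner_prod_def)

lemma weak_gradient_test:
  fixes v :: "real \<times> real \<Rightarrow> real"
  assumes D: "D \<in> sets borel" and v: "integrable (restrict_space lborel D) v" and g: "integrable (restrict_space lborel D) g"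
    and wg: "has_weak_gradient D v g" and f: "f \<in> C1_compact_support D"
  shows "(\<integral>z. v z * d1 f z \<partial>restrict_space lborel D) = - (\<integral>z. fst (g z) * f z \<partial>restrict_space lborel D)"
    "(\<integral>z. v z * d2 f z \<partial>restrict_space lborel D) = - (\<integral>z. snd (g z) * f z \<partial>restrict_space lborel D)"
    "integrable (restrict_space lborel D) (\<lambda>z. v z * d1 f z)" "integrable (restrict_space lborel D) (\<lambda>z. v z * d2 f z)"
    "integrable (restrict_space lborel D) (\<lambda>z. fst (g z) * f z)" "integrable (restrict_space lborel D) (\<lambda>z. snd (g z) * f z)"
    "f \<in> borel_measurable (restrict_space lborel D)" "d1 f \<in> borel_measurable (restrict_space lborel D)"
    "d2 f \<in> borel_measurable (restrict_space lborel D)"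
proof -
  let ?M = "restrict_space lborel D"
  have gs: "integrable ?M (\<lambda>z. fst (g z))" "integrable ?M (\<lambda>z. snd (g z))"
    using g by (auto simp: integrable_bounded_linear[OF bounded_linear_fst] integrable_bounded_linear[OF bounded_linear_snd])
  note C = C1_real_pair[OF f]
  note R = C(1-3)[THEN borel_measurable_restrict_lborelI]
  show "(\<integral>z. v z * d1 f z \<partial>?M) = - (\<integral>z. fst (g z) * f z \<partial>?M)" "(\<integral>z. v z * d2 f z \<partial>?M) = - (\<integral>z. snd (g z) * f z \<partial>?M)"
    using wg f unfolding has_weak_gradient_real_pair[OF D] by blast+
  show "integrable ?M (\<lambda>z. v z * d1 f z)" "integrable ?M (\<lambda>z. v z * d2 f z)"
    "integrable ?M (\<lambda>z. fst (g z) * f z)" "integrable ?M (\<lambda>z. snd (g z) * f z)"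
    by (rule integrable_mult_bounded[OF v R(2) C(5)] integrable_mult_bounded[OF v R(3) C(6)]
        integrable_mult_bounded[OF gs(1) R(1) C(4)] integrable_mult_bounded[OF gs(2) R(1) C(4)])+
  show "f \<in> borel_measurable ?M" "d1 f \<in> borel_measurable ?M" "d2 f \<in> borel_measurable ?M" by (rule R)+
qed

lemma borel_measurable_fst_snd:
  fixes g :: "'a \<Rightarrow> real \<times> real"
  assumes "g \<in> borel_measurable M"
  shows "(\<lambda>z. fst (g z)) \<in> borel_measurable M" "(\<lambda>z. snd (g z)) \<in> borel_measurable M"
  by (rule measurable_compose[OF assms], intro borel_measurable_continuous_onI continuous_intros)+

text \<open>\<open>a\<close>, \<open>b\<close>, \<open>c\<close>, \<open>d\<close> stand for
  \<open>Ps\<close>, \<open>Pt\<close>, \<open>Rs\<close>, \<open>Rt\<close>, \<open>j\<close> and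
  \<open>i\<close> for the two partial derivatives of \<open>J\<close>, \<open>z\<close> for the
  value of a test function \<zeta>, and \<open>F1\<close> to \<open>G2\<close> for the partial
  derivatives of \<zeta> Ps / J and \<zeta> Rs / J. The second derivatives of the chart combine
  exactly to \<open>j\<close>, because the mixed ones \<open>a2\<close> and \<open>e1\<close> are
  shared, and this cancels the derivative of 1 / J; only the derivative of \<zeta> remains.
  Multiplying by the square of \<open>J\<close> keeps the computation polynomial.\<close>

lemma piola_identity:
  fixes a b c d :: real
  assumes J: "J = a * d - b * c" and j: "j = a1 * d + a * e1 - a2 * c - b * c1" "i = a2 * d + a * e2 - b2 * c - b * e1"
    and F: "F1 * J\<^sup>2 = z * (a1 * J - a * j) + z1 * a * J" "F2 * J\<^sup>2 = z * (a2 * J - a * i) + z2 * a * J"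
    and G: "G1 * J\<^sup>2 = z * (c1 * J - c * j) + z1 * c * J" "G2 * J\<^sup>2 = z * (e1 * J - c * i) + z2 * c * J"
    and "J \<noteq> 0"
  shows "d * F1 - c * F2 + (a * G2 - b * G1) = z1"
proof -
  have "(d * F1 - c * F2 + (a * G2 - b * G1)) * J\<^sup>2
    = d * (F1 * J\<^sup>2) - c * (F2 * J\<^sup>2) + (a * (G2 * J\<^sup>2) - b * (G1 * J\<^sup>2))"
    by (simp add: algebra_simps)
  also have "\<dots> = z * J * (d * a1 - c * a2 + a * e1 - b * c1) + (z1 * J - z * j) * (a * d - b * c)"
    unfolding F G by (simp add: algebra_simps)
  also have "\<dots> = z * J * j + (z1 * J - z * j) * J" unfolding J[symmetric] j(1) by (simp add: algebra_simps)
  also have "\<dots> = z1 * J\<^sup>2" by (simp add: algebra_simps power2_eq_square)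
  finally show ?thesis using \<open>J \<noteq> 0\<close> by simp
qed

text \<open>The same cancellation for the second column \<open>Pt\<close>, \<open>Rt\<close> of the
  Jacobian matrix, where the second derivatives combine to \<open>i\<close>.\<close>

lemma piola_identity':
  fixes a b c d :: real
  assumes J: "J = a * d - b * c" and j: "j = a1 * d + a * e1 - a2 * c - b * c1" "i = a2 * d + a * e2 - b2 * c - b * e1"
    and F: "F1 * J\<^sup>2 = z * (a2 * J - b * j) + z1 * b * J" "F2 * J\<^sup>2 = z * (b2 * J - b * i) + z2 * b * J"
    and G: "G1 * J\<^sup>2 = z * (e1 * J - d * j) + z1 * d * J" "G2 * J\<^sup>2 = z * (e2 * J - d * i) + z2 * d * J"
    and "J \<noteq> 0"
  shows "d * F1 - c * F2 + (a * G2 - b * G1) = z2"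
proof -
  have "(d * F1 - c * F2 + (a * G2 - b * G1)) * J\<^sup>2
    = d * (F1 * J\<^sup>2) - c * (F2 * J\<^sup>2) + (a * (G2 * J\<^sup>2) - b * (G1 * J\<^sup>2))"
    by (simp add: algebra_simps)
  also have "\<dots> = z * J * (d * a2 - c * b2 + a * e2 - b * e1) + (z2 * J - z * i) * (a * d - b * c)"
    unfolding F G by (simp add: algebra_simps)
  also have "\<dots> = z * J * i + (z2 * J - z * i) * J" unfolding J[symmetric] j(2) by (simp add: algebra_simps)
  also have "\<dots> = z2 * J\<^sup>2" by (simp add: algebra_simps power2_eq_square)
  finally show ?thesis using \<open>J \<noteq> 0\<close> by simp
qed

section \<open>Charts of class C2 and the transport of weak gradients\<close>

text \<open>A single \<open>Pst\<close> serves in the derivatives of both \<open>Ps\<close> and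
  \<open>Pt\<close>, and likewise \<open>Rst\<close>: this encodes the symmetry of second
  derivatives on which the cancellations rest.\<close>

locale planar_C2_chart = planar_chart +
  fixes Pss Pst Ptt Rss Rst Rtt :: "real \<times> real \<Rightarrow> real"
  assumes der_Ps: "\<And>z. z \<in> Q \<Longrightarrow> (Ps has_derivative (\<lambda>h. fst h * Pss z + snd h * Pst z)) (at z)"
    and der_Pt: "\<And>z. z \<in> Q \<Longrightarrow> (Pt has_derivative (\<lambda>h. fst h * Pst z + snd h * Ptt z)) (at z)"
    and der_Rs: "\<And>z. z \<in> Q \<Longrightarrow> (Rs has_derivative (\<lambda>h. fst h * Rss z + snd h * Rst z)) (at z)"
    and der_Rt: "\<And>z. z \<in> Q \<Longrightarrow> (Rt has_derivative (\<lambda>h. fst h * Rst z + snd h * Rtt z)) (at z)"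
    and cont2: "continuous_on Q Pss" "continuous_on Q Pst" "continuous_on Q Ptt"
      "continuous_on Q Rss" "continuous_on Q Rst" "continuous_on Q Rtt"
begin

definition pull_test :: "(real \<times> real \<Rightarrow> real) \<Rightarrow> real \<times> real \<Rightarrow> real" where
  "pull_test \<phi> z = (if z \<in> Q then \<phi> (\<Psi> z) else 0)"

definition push_test :: "(real \<times> real \<Rightarrow> real) \<Rightarrow> real \<times> real \<Rightarrow> real" where
  "push_test f y = (if y \<in> D then f (inverse_chart y) else 0)"

lemma pull_test:
  assumes \<phi>: "\<phi> \<in> C1_compact_support D"
  shows "pull_test \<phi> \<in> C1_compact_support Q"
    and "z \<in> Q \<Longrightarrow> d1 (pull_test \<phi>) z = Ps z * d1 \<phi> (\<Psi> z) + Rs z * d2 \<phi> (\<Psi> z)"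
    and "z \<in> Q \<Longrightarrow> d2 (pull_test \<phi>) z = Pt z * d1 \<phi> (\<Psi> z) + Rt z * d2 \<phi> (\<Psi> z)"
proof -
  obtain K where K: "compact K" "K \<subseteq> D" "\<And>x. x \<notin> K \<Longrightarrow> \<phi> x = 0"
    using C1_compact_support_obtain[OF \<phi>] by blast
  let ?L = "\<lambda>z h. (fst h * Ps z + snd h * Pt z) * d1 \<phi> (\<Psi> z) + (fst h * Rs z + snd h * Rt z) * d2 \<phi> (\<Psi> z)"
  have der': "(pull_test \<phi> has_derivative ?L z) (at z)" if z: "z \<in> Q" for z
  proof (rule has_derivative_transform_within_open[OF _ open_Q z])
    have "((\<lambda>z. \<phi> (\<Psi> z)) has_derivative (\<lambda>h. frechet_derivative \<phi> (at (\<Psi> z)) (fst h * Ps z + snd h * Pt z, fst h * Rs z + snd h * Rt z))) (at z)"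
      by (rule has_derivative_compose[OF der[OF z] C1_compact_support_has_derivative[OF \<phi>]])
    then show "((\<lambda>z. \<phi> (\<Psi> z)) has_derivative ?L z) (at z)"
      by (subst (asm) frechet_derivative_real_pair[OF \<phi>]) simp
  qed (simp add: pull_test_def)
  have comp: "continuous_on Q (\<lambda>z. f (\<Psi> z))" if "continuous_on UNIV f" for f :: "real \<times> real \<Rightarrow> real"
    using continuous_on_compose2[OF that continuous_chart] by auto
  have cd: "continuous_on Q (\<lambda>z. d1 \<phi> (\<Psi> z))" "continuous_on Q (\<lambda>z. d2 \<phi> (\<Psi> z))"
    by (rule comp, rule C1_compact_support_continuous_deriv[OF \<phi>], simp add: Basis_real_pair)+
  show "pull_test \<phi> \<in> C1_compact_support Q"
  proof (rule C1_compact_supportI[OF open_Q _ _ der'])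
    show "compact (inverse_chart ` K)"
      using K continuous_inverse_chart by (intro compact_continuous_image) (auto intro: continuous_on_subset)
    show "inverse_chart ` K \<subseteq> Q" using K(2) by auto
    show "continuous_on Q (\<lambda>z. ?L z b)" for b by (intro continuous_intros cont cd)
    fix z assume z: "z \<notin> inverse_chart ` K"
    show "pull_test \<phi> z = 0"
    proof (cases "z \<in> Q")
      case True
      then have "\<Psi> z \<notin> K" using z by (metis image_eqI inverse_chart)
      then show ?thesis by (simp add: pull_test_def K)
    qed (simp add: pull_test_def)
  qed
  show "z \<in> Q \<Longrightarrow> d1 (pull_test \<phi>) z = Ps z * d1 \<phi> (\<Psi> z) + Rs z * d2 \<phi> (\<Psi> z)"
    "z \<in> Q \<Longrightarrow> d2 (pull_test \<phi>) z = Pt z * d1 \<phi> (\<Psi> z) + Rt z * d2 \<phi> (\<Psi> z)"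
    using frechet_derivative_at[OF der'[of z], symmetric] by simp_all
qed

text \<open>Cramer's rule for the Jacobian matrix. Continuity of the inverse chart is already
  available from invariance of domain, so only the algebraic inverse of the derivative has to be
  exhibited.\<close>

lemma has_derivative_inverse_chart:
  assumes z: "z \<in> Q"
  shows "(inverse_chart has_derivative
    (\<lambda>h. ((fst h * Rt z - snd h * Pt z) / J z, (snd h * Ps z - fst h * Rs z) / J z))) (at (\<Psi> z))"
proof (rule has_derivative_inverse_basic[where T = D])
  let ?g = "\<lambda>h. ((fst h * Rt z - snd h * Pt z) / J z, (snd h * Ps z - fst h * Rs z) / J z)"
  show "(\<Psi> has_derivative (\<lambda>h. (fst h * Ps z + snd h * Pt z, fst h * Rs z + snd h * Rt z))) (at (inverse_chart (\<Psi> z)))"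
    using der[OF z] z by simp
  show "bounded_linear ?g"
    by (auto intro!: bounded_linear_intros bounded_linear_Pair bounded_linear_sub
        bounded_linear_mult_const[OF bounded_linear_fst, unfolded fst_def] simp: divide_inverse)
  show "?g \<circ> (\<lambda>h. (fst h * Ps z + snd h * Pt z, fst h * Rs z + snd h * Rt z)) = id"
  proof (rule ext)
    fix h :: "real \<times> real"
    have "(fst h * Ps z + snd h * Pt z) * Rt z - (fst h * Rs z + snd h * Rt z) * Pt z = fst h * J z"
      "(fst h * Rs z + snd h * Rt z) * Ps z - (fst h * Ps z + snd h * Pt z) * Rs z = snd h * J z"
      by (simp_all add: J_def algebra_simps)
    then show "(?g \<circ> (\<lambda>h. (fst h * Ps z + snd h * Pt z, fst h * Rs z + snd h * Rt z))) h = id h"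
      using J_positive[OF z] by (simp add: prod_eq_iff)
  qed
  show "continuous (at (\<Psi> z)) inverse_chart"
    using continuous_inverse_chart open_D z by (simp add: continuous_on_eq_continuous_at)
  show "\<Psi> (inverse_chart y) = y" if "y \<in> D" for y using that by auto
qed (use z open_D in auto)

lemma push_test:
  assumes f: "f \<in> C1_compact_support Q"
  shows "push_test f \<in> C1_compact_support D"
    and "z \<in> Q \<Longrightarrow> d1 (push_test f) (\<Psi> z) = (Rt z * d1 f z - Rs z * d2 f z) / J z"
    and "z \<in> Q \<Longrightarrow> d2 (push_test f) (\<Psi> z) = (Ps z * d2 f z - Pt z * d1 f z) / J z"
proof -
  obtain K where K: "compact K" "K \<subseteq> Q" "\<And>x. x \<notin> K \<Longrightarrow> f x = 0"
    using C1_compact_support_obtain[OF f] by blast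
  let ?L = "\<lambda>z h. (fst h * Rt z - snd h * Pt z) / J z * d1 f z + (snd h * Ps z - fst h * Rs z) / J z * d2 f z"
  have der': "(push_test f has_derivative ?L z) (at (\<Psi> z))" if z: "z \<in> Q" for z
  proof (rule has_derivative_transform_within_open[OF _ open_D])
    have "((\<lambda>y. f (inverse_chart y)) has_derivative (\<lambda>h. frechet_derivative f (at (inverse_chart (\<Psi> z)))
        ((fst h * Rt z - snd h * Pt z) / J z, (snd h * Ps z - fst h * Rs z) / J z))) (at (\<Psi> z))"
      by (rule has_derivative_compose[OF has_derivative_inverse_chart[OF z] C1_compact_support_has_derivative[OF f]])
    then show "((\<lambda>y. f (inverse_chart y)) has_derivative ?L z) (at (\<Psi> z))"
      using z by (subst (asm) frechet_derivative_real_pair[OF f]) simp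
  qed (use z in \<open>auto simp: push_test_def\<close>)
  have cd: "continuous_on Q (d1 f)" "continuous_on Q (d2 f)"
    by (rule continuous_on_subset, rule C1_compact_support_continuous_deriv[OF f], simp_all add: Basis_real_pair)+
  show "push_test f \<in> C1_compact_support D"
  proof (rule C1_compact_supportI[OF open_D])
    show "compact (\<Psi> ` K)"
      using K continuous_chart by (intro compact_continuous_image) (auto intro: continuous_on_subset)
    show "\<Psi> ` K \<subseteq> D" using K(2) by auto
    show "(push_test f has_derivative ?L (inverse_chart y)) (at y)" if "y \<in> D" for y
      using that der' by auto
    show "continuous_on D (\<lambda>y. ?L (inverse_chart y) b)" for b
    proof (rule continuous_on_compose2[OF _ continuous_inverse_chart])
      have "\<forall>z\<in>Q. J z \<noteq> 0" using J_positive by force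
      then show "continuous_on Q (\<lambda>z. ?L z b)" by (intro continuous_intros cont cd continuous_J)
    qed auto
    fix y assume y: "y \<notin> \<Psi> ` K"
    show "push_test f y = 0"
    proof (cases "y \<in> D")
      case True
      then obtain z where z: "z \<in> Q" "y = \<Psi> z" by blast
      then have "z \<notin> K" using y by blast
      then show ?thesis using z by (simp add: push_test_def K)
    qed (simp add: push_test_def)
  qed
  show "z \<in> Q \<Longrightarrow> d1 (push_test f) (\<Psi> z) = (Rt z * d1 f z - Rs z * d2 f z) / J z"
    "z \<in> Q \<Longrightarrow> d2 (push_test f) (\<Psi> z) = (Ps z * d2 f z - Pt z * d1 f z) / J z"
    using frechet_derivative_at[OF der'[of z], symmetric] by (simp_all add: diff_divide_distrib)
qed

lemma mult_test:
  assumes f: "f \<in> C1_compact_support Q"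
    and m': "\<forall>z\<in>Q. (m has_derivative (\<lambda>h. fst h * m1 z + snd h * m2 z)) (at z)"
    and c: "continuous_on Q m1" "continuous_on Q m2"
  shows "(\<lambda>z. f z * m z) \<in> C1_compact_support Q"
    and "z \<in> Q \<Longrightarrow> d1 (\<lambda>z. f z * m z) z = f z * m1 z + d1 f z * m z"
    and "z \<in> Q \<Longrightarrow> d2 (\<lambda>z. f z * m z) z = f z * m2 z + d2 f z * m z"
proof -
  have m: "(m has_derivative (\<lambda>h. fst h * m1 z + snd h * m2 z)) (at z)" if "z \<in> Q" for z
    using m' that by blast
  note * = C1_compact_support_mult[OF open_Q f m]
  have b: "continuous_on Q (\<lambda>z. fst b * m1 z + snd b * m2 z)" for b :: "real \<times> real"
    by (intro continuous_intros c)
  show "(\<lambda>z. f z * m z) \<in> C1_compact_support Q" by (rule *(1)[OF _ b])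
  show "z \<in> Q \<Longrightarrow> d1 (\<lambda>z. f z * m z) z = f z * m1 z + d1 f z * m z"
    "z \<in> Q \<Longrightarrow> d2 (\<lambda>z. f z * m z) z = f z * m2 z + d2 f z * m z"
    using *(2)[OF _ b, of z] by simp_all
qed

lemma der_all:
  "\<forall>z\<in>Q. (Ps has_derivative (\<lambda>h. fst h * Pss z + snd h * Pst z)) (at z)"
  "\<forall>z\<in>Q. (Pt has_derivative (\<lambda>h. fst h * Pst z + snd h * Ptt z)) (at z)"
  "\<forall>z\<in>Q. (Rs has_derivative (\<lambda>h. fst h * Rss z + snd h * Rst z)) (at z)"
  "\<forall>z\<in>Q. (Rt has_derivative (\<lambda>h. fst h * Rst z + snd h * Rtt z)) (at z)"
  using der_Ps der_Pt der_Rs der_Rt by blast+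

lemma integral_MQ_cong:
  fixes f g :: "real \<times> real \<Rightarrow> real"
  shows "(\<And>z. z \<in> Q \<Longrightarrow> f z = g z) \<Longrightarrow> (\<integral>z. f z \<partial>MQ) = (\<integral>z. g z \<partial>MQ)"
  by (intro Bochner_Integration.integral_cong) (auto simp: space_restrict_space)

text \<open>The transposed inverse of the Jacobian matrix applied to a gradient in chart
  coordinates, which is how a gradient transforms.\<close>

definition push_gradient :: "(real \<times> real \<Rightarrow> real \<times> real) \<Rightarrow> real \<times> real \<Rightarrow> real \<times> real" where
  "push_gradient g y = (let z = inverse_chart y in
    ((fst (g z) * Rt z - snd (g z) * Rs z) / J z, (snd (g z) * Ps z - fst (g z) * Pt z) / J z))"

lemma measurable_coefficients:
  "Ps \<in> borel_measurable MQ" "Pt \<in> borel_measurable MQ" "Rs \<in> borel_measurable MQ" "Rt \<in> borel_measurable MQ"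
  using cont by (auto intro: measurable_continuous_MQ)

lemma measurable_push_gradient:
  assumes g[measurable]: "g \<in> borel_measurable MQ"
  shows "push_gradient g \<in> borel_measurable MD"
proof -
  note [measurable] = measurable_coefficients measurable_J measurable_inverse_chart
  note [measurable] = borel_measurable_fst_snd[OF g]
  have "(\<lambda>z. ((fst (g z) * Rt z - snd (g z) * Rs z) / J z, (snd (g z) * Ps z - fst (g z) * Pt z) / J z)) \<in> borel_measurable MQ"
    by (rule borel_measurable_Pair) measurable
  from measurable_compose[OF measurable_inverse_chart this] show ?thesis
    unfolding push_gradient_def Let_def .
qed

text \<open>Both transport statements rest on the equality of mixed partial derivatives of the chart (the
  Piola identity), which lets the Jacobian factors be moved under the derivative of the test function.\<close>

lemma weak_gradient_push:
  assumes u: "integrable MQ u" and g: "integrable MQ g"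
    and wg: "has_weak_gradient Q u g"
  shows "has_weak_gradient D (\<lambda>y. u (inverse_chart y)) (push_gradient g)"
  unfolding has_weak_gradient_real_pair[OF borel_D]
proof (intro ballI conjI)
  fix \<phi> assume \<phi>: "\<phi> \<in> C1_compact_support D"
  define \<psi> where "\<psi> = pull_test \<phi>"
  note \<psi> = pull_test[OF \<phi>, folded \<psi>_def]
  have \<psi>z: "\<psi> z = \<phi> (\<Psi> z)" if "z \<in> Q" for z using that by (simp add: \<psi>_def pull_test_def)
  have [measurable]: "u \<in> borel_measurable MQ" "g \<in> borel_measurable MQ" using u g by auto
  have um: "(\<lambda>y. u (inverse_chart y)) \<in> borel_measurable MD"
    by (rule measurable_compose[OF measurable_inverse_chart]) simp
  have pm: "push_gradient g \<in> borel_measurable MD" by (rule measurable_push_gradient) simp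
  note um[measurable] borel_measurable_fst_snd[OF pm, measurable]
  have [measurable]: "\<phi> \<in> borel_measurable MD" "d1 \<phi> \<in> borel_measurable MD" "d2 \<phi> \<in> borel_measurable MD"
    using C1_real_pair[OF \<phi>] by (auto intro!: borel_measurable_restrict_lborelI)
  note m = mult_test[OF \<psi>(1)]
  note T = m[OF der_all(4) cont2(5,6)] m[OF der_all(3) cont2(4,5)] m[OF der_all(2) cont2(2,3)] m[OF der_all(1) cont2(1,2)]
  note W = weak_gradient_test[OF borel_Q u g wg]
  show "(\<integral>y. u (inverse_chart y) * d1 \<phi> y \<partial>MD) = - (\<integral>y. fst (push_gradient g y) * \<phi> y \<partial>MD)"
  proof -
    have "(\<integral>y. u (inverse_chart y) * d1 \<phi> y \<partial>MD) = (\<integral>z. J z * (u (inverse_chart (\<Psi> z)) * d1 \<phi> (\<Psi> z)) \<partial>MQ)"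
      by (rule integral_MD) simp
    \<comment> \<open>J times a derivative of \<phi> in the plane is a combination of derivatives of
      \<psi> with cofactors as coefficients. It becomes a divergence in chart coordinates because
      the terms differentiating the cofactors, \<psi> Rst and - \<psi> Rst, cancel.\<close>
    also have "\<dots> = (\<integral>z. u z * d1 (\<lambda>z. \<psi> z * Rt z) z - u z * d2 (\<lambda>z. \<psi> z * Rs z) z \<partial>MQ)"
    proof (rule integral_MQ_cong)
      fix z assume z: "z \<in> Q"
      show "J z * (u (inverse_chart (\<Psi> z)) * d1 \<phi> (\<Psi> z)) = u z * d1 (\<lambda>z. \<psi> z * Rt z) z - u z * d2 (\<lambda>z. \<psi> z * Rs z) z"
        unfolding T(2)[OF z] T(6)[OF z] \<psi>(2,3)[OF z] inverse_chart[OF z] J_def by (simp add: algebra_simps)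
    qed
    also have "\<dots> = - (\<integral>z. fst (g z) * (\<psi> z * Rt z) \<partial>MQ) + (\<integral>z. snd (g z) * (\<psi> z * Rs z) \<partial>MQ)"
      using W[OF T(1)] W[OF T(4)] by simp
    also have "\<dots> = - (\<integral>z. fst (g z) * (\<psi> z * Rt z) - snd (g z) * (\<psi> z * Rs z) \<partial>MQ)"
      using W[OF T(1)] W[OF T(4)] by simp
    also have "(\<integral>z. fst (g z) * (\<psi> z * Rt z) - snd (g z) * (\<psi> z * Rs z) \<partial>MQ)
        = (\<integral>z. J z * (fst (push_gradient g (\<Psi> z)) * \<phi> (\<Psi> z)) \<partial>MQ)"
    proof (rule integral_MQ_cong)
      fix z assume z: "z \<in> Q"
      have "J z \<noteq> 0" using J_positive[OF z] by simp
      with z show "fst (g z) * (\<psi> z * Rt z) - snd (g z) * (\<psi> z * Rs z) = J z * (fst (push_gradient g (\<Psi> z)) * \<phi> (\<Psi> z))"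
        by (simp add: push_gradient_def \<psi>z field_simps)
    qed
    also have "\<dots> = (\<integral>y. fst (push_gradient g y) * \<phi> y \<partial>MD)"
      by (rule integral_MD[symmetric]) simp
    finally show ?thesis .
  qed
  show "(\<integral>y. u (inverse_chart y) * d2 \<phi> y \<partial>MD) = - (\<integral>y. snd (push_gradient g y) * \<phi> y \<partial>MD)"
  proof -
    have "(\<integral>y. u (inverse_chart y) * d2 \<phi> y \<partial>MD) = (\<integral>z. J z * (u (inverse_chart (\<Psi> z)) * d2 \<phi> (\<Psi> z)) \<partial>MQ)"
      by (rule integral_MD) simp
    also have "\<dots> = (\<integral>z. u z * d2 (\<lambda>z. \<psi> z * Ps z) z - u z * d1 (\<lambda>z. \<psi> z * Pt z) z \<partial>MQ)"
    proof (rule integral_MQ_cong)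
      fix z assume z: "z \<in> Q"
      show "J z * (u (inverse_chart (\<Psi> z)) * d2 \<phi> (\<Psi> z)) = u z * d2 (\<lambda>z. \<psi> z * Ps z) z - u z * d1 (\<lambda>z. \<psi> z * Pt z) z"
        unfolding T(12)[OF z] T(8)[OF z] \<psi>(2,3)[OF z] inverse_chart[OF z] J_def by (simp add: algebra_simps)
    qed
    also have "\<dots> = - (\<integral>z. snd (g z) * (\<psi> z * Ps z) \<partial>MQ) + (\<integral>z. fst (g z) * (\<psi> z * Pt z) \<partial>MQ)"
      using W[OF T(7)] W[OF T(10)] by simp
    also have "\<dots> = - (\<integral>z. snd (g z) * (\<psi> z * Ps z) - fst (g z) * (\<psi> z * Pt z) \<partial>MQ)"
      using W[OF T(7)] W[OF T(10)] by simp
    also have "(\<integral>z. snd (g z) * (\<psi> z * Ps z) - fst (g z) * (\<psi> z * Pt z) \<partial>MQ)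
        = (\<integral>z. J z * (snd (push_gradient g (\<Psi> z)) * \<phi> (\<Psi> z)) \<partial>MQ)"
    proof (rule integral_MQ_cong)
      fix z assume z: "z \<in> Q"
      have "J z \<noteq> 0" using J_positive[OF z] by simp
      with z show "snd (g z) * (\<psi> z * Ps z) - fst (g z) * (\<psi> z * Pt z) = J z * (snd (push_gradient g (\<Psi> z)) * \<phi> (\<Psi> z))"
        by (simp add: push_gradient_def \<psi>z field_simps)
    qed
    also have "\<dots> = (\<integral>y. snd (push_gradient g y) * \<phi> y \<partial>MD)"
      by (rule integral_MD[symmetric]) simp
    finally show ?thesis .
  qed
qed

text \<open>The transposed Jacobian matrix applied to the gradient at the image point: the chain
  rule in weak form.\<close>

definition pull_gradient :: "(real \<times> real \<Rightarrow> real \<times> real) \<Rightarrow> real \<times> real \<Rightarrow> real \<times> real" where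
  "pull_gradient g z = (fst (g (\<Psi> z)) * Ps z + snd (g (\<Psi> z)) * Rs z, fst (g (\<Psi> z)) * Pt z + snd (g (\<Psi> z)) * Rt z)"

definition Js :: "real \<times> real \<Rightarrow> real" where
  "Js z = Pss z * Rt z + Ps z * Rst z - Pst z * Rs z - Pt z * Rss z"
definition Jt :: "real \<times> real \<Rightarrow> real" where
  "Jt z = Pst z * Rt z + Ps z * Rtt z - Ptt z * Rs z - Pt z * Rst z"

lemma der_quotient_J:
  assumes m: "(m has_derivative (\<lambda>h. fst h * m1 z + snd h * m2 z)) (at z)" and z: "z \<in> Q"
  shows "((\<lambda>z. m z / J z) has_derivative
    (\<lambda>h. fst h * ((m1 z * J z - m z * Js z) / (J z)\<^sup>2) + snd h * ((m2 z * J z - m z * Jt z) / (J z)\<^sup>2))) (at z)"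
proof -
  have J0: "J z \<noteq> 0" using J_positive[OF z] by simp
  have dJ: "(J has_derivative (\<lambda>h. fst h * Js z + snd h * Jt z)) (at z)"
    unfolding J_def[abs_def]
    by (rule has_derivative_eq_rhs[OF has_derivative_diff[OF has_derivative_mult[OF der_Ps[OF z] der_Rt[OF z]]
            has_derivative_mult[OF der_Pt[OF z] der_Rs[OF z]]]])
      (simp add: Js_def Jt_def algebra_simps)
  show ?thesis
    by (rule has_derivative_eq_rhs[OF has_derivative_divide'[OF m dJ J0]])
      (rule ext, use J0 in \<open>simp add: field_simps power2_eq_square\<close>)
qed

lemma integrable_pull_MQ:
  fixes f :: "real \<times> real \<Rightarrow> real"
  assumes "integrable MD f" and c: "c > 0" "\<And>z. z \<in> Q \<Longrightarrow> c \<le> J z"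
  shows "integrable MQ (\<lambda>z. f (\<Psi> z))"
proof (rule Bochner_Integration.integrable_bound)
  have f[measurable]: "f \<in> borel_measurable MD" using assms by auto
  note [measurable] = measurable_chart
  show "integrable MQ (\<lambda>z. (1 / c) * (J z * f (\<Psi> z)))" using assms(1) integrable_MD[OF f] by simp
  show "(\<lambda>z. f (\<Psi> z)) \<in> borel_measurable MQ" by measurable
  show "AE z in MQ. norm (f (\<Psi> z)) \<le> norm ((1 / c) * (J z * f (\<Psi> z)))"
  proof (rule AE_I2)
    fix z assume "z \<in> space MQ"
    then have "c \<le> J z" using c by (simp add: space_restrict_space)
    then have "1 \<le> \<bar>J z / c\<bar>" using c by simp
    then have "1 * \<bar>f (\<Psi> z)\<bar> \<le> \<bar>J z / c\<bar> * \<bar>f (\<Psi> z)\<bar>" by (intro mult_right_mono) auto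
    then show "norm (f (\<Psi> z)) \<le> norm ((1 / c) * (J z * f (\<Psi> z)))" by (simp add: abs_mult)
  qed
qed

lemma weak_gradient_pull:
  assumes v: "integrable MD v" and g: "integrable MD g"
    and wg: "has_weak_gradient D v g"
  shows "has_weak_gradient Q (\<lambda>z. v (\<Psi> z)) (pull_gradient g)"
  unfolding has_weak_gradient_real_pair[OF borel_Q]
proof (intro ballI conjI)
  fix \<zeta> assume \<zeta>: "\<zeta> \<in> C1_compact_support Q"
  have [measurable]: "v \<in> borel_measurable MD" "g \<in> borel_measurable MD" using v g by auto
  note W = weak_gradient_test[OF borel_D v g wg]
  have J0: "J z \<noteq> 0" if "z \<in> Q" for z using J_positive[OF that] by simp
  \<comment> \<open>Common to both coordinates: \<open>m\<close>, \<open>n\<close> is one column of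
    the Jacobian matrix, and \<open>dz\<close> the derivative of \<zeta> in the corresponding
    coordinate. The vector field \<zeta> (m, n) / J, pushed to the plane, is the Piola transform of
    \<zeta> times a coordinate vector; J times its divergence is \<open>dz\<close>, so testing its
    two components against \<open>v\<close> and adding gives the claim.\<close>
  have main: "(\<integral>z. v (\<Psi> z) * dz z \<partial>MQ) = - (\<integral>z. (fst (g (\<Psi> z)) * m z + snd (g (\<Psi> z)) * n z) * \<zeta> z \<partial>MQ)"
    if m: "\<forall>z\<in>Q. (m has_derivative (\<lambda>h. fst h * m1 z + snd h * m2 z)) (at z)"
    and n: "\<forall>z\<in>Q. (n has_derivative (\<lambda>h. fst h * n1 z + snd h * n2 z)) (at z)"
    and c: "continuous_on Q m1" "continuous_on Q m2" "continuous_on Q n1" "continuous_on Q n2"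
    and piola: "\<And>z F G. z \<in> Q \<Longrightarrow> F = (\<lambda>z. \<zeta> z * (m z / J z)) \<Longrightarrow> G = (\<lambda>z. \<zeta> z * (n z / J z)) \<Longrightarrow>
      d1 F z = \<zeta> z * ((m1 z * J z - m z * Js z) / (J z)\<^sup>2) + d1 \<zeta> z * (m z / J z) \<Longrightarrow>
      d2 F z = \<zeta> z * ((m2 z * J z - m z * Jt z) / (J z)\<^sup>2) + d2 \<zeta> z * (m z / J z) \<Longrightarrow>
      d1 G z = \<zeta> z * ((n1 z * J z - n z * Js z) / (J z)\<^sup>2) + d1 \<zeta> z * (n z / J z) \<Longrightarrow>
      d2 G z = \<zeta> z * ((n2 z * J z - n z * Jt z) / (J z)\<^sup>2) + d2 \<zeta> z * (n z / J z) \<Longrightarrow>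
      Rt z * d1 F z - Rs z * d2 F z + (Ps z * d2 G z - Pt z * d1 G z) = dz z"
    for m n m1 m2 n1 n2 dz
  proof -
    define F where "F = (\<lambda>z. \<zeta> z * (m z / J z))"
    define G where "G = (\<lambda>z. \<zeta> z * (n z / J z))"
    have J0': "\<forall>z\<in>Q. J z \<noteq> 0" "\<forall>z\<in>Q. (J z)\<^sup>2 \<noteq> 0" using J0 by auto
    have cJ: "continuous_on Q Js" "continuous_on Q Jt"
      unfolding Js_def Jt_def by (intro continuous_intros cont cont2)+
    have cmn: "continuous_on Q m" "continuous_on Q n"
      using m n has_derivative_continuous by (blast intro: continuous_at_imp_continuous_on)+
    have q: "continuous_on Q (\<lambda>z. (a z * J z - b z * j z) / (J z)\<^sup>2)"
      if "continuous_on Q a" "continuous_on Q b" "continuous_on Q j" for a b j :: "real \<times> real \<Rightarrow> real"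
      by (intro continuous_intros that continuous_J J0')
    have dm: "\<forall>z\<in>Q. ((\<lambda>z. m z / J z) has_derivative
      (\<lambda>h. fst h * ((m1 z * J z - m z * Js z) / (J z)\<^sup>2) + snd h * ((m2 z * J z - m z * Jt z) / (J z)\<^sup>2))) (at z)"
      using m by (blast intro: der_quotient_J)
    have dn: "\<forall>z\<in>Q. ((\<lambda>z. n z / J z) has_derivative
      (\<lambda>h. fst h * ((n1 z * J z - n z * Js z) / (J z)\<^sup>2) + snd h * ((n2 z * J z - n z * Jt z) / (J z)\<^sup>2))) (at z)"
      using n by (blast intro: der_quotient_J)
    note F = mult_test[OF \<zeta> dm q[OF c(1) cmn(1) cJ(1)] q[OF c(2) cmn(1) cJ(2)], folded F_def]
    note G = mult_test[OF \<zeta> dn q[OF c(3) cmn(2) cJ(1)] q[OF c(4) cmn(2) cJ(2)], folded G_def]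
    note PF = push_test[OF F(1)] and PG = push_test[OF G(1)]
    have "g \<in> borel_measurable MD" by simp
    note [measurable] = W(7-9)[OF PF(1)] W(7-9)[OF PG(1)] borel_measurable_fst_snd[OF this]
    have "(\<integral>z. v (\<Psi> z) * dz z \<partial>MQ) = (\<integral>z. J z * (v (\<Psi> z) * d1 (push_test F) (\<Psi> z) + v (\<Psi> z) * d2 (push_test G) (\<Psi> z)) \<partial>MQ)"
    proof (rule integral_MQ_cong)
      fix z assume z: "z \<in> Q"
      have "dz z = Rt z * d1 F z - Rs z * d2 F z + (Ps z * d2 G z - Pt z * d1 G z)"
        using piola[OF z F_def G_def F(2,3)[OF z] G(2,3)[OF z]] by simp
      also have "\<dots> = J z * (d1 (push_test F) (\<Psi> z) + d2 (push_test G) (\<Psi> z))"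
        using J0[OF z] unfolding PF(2)[OF z] PG(3)[OF z] by (simp add: field_simps)
      finally show "v (\<Psi> z) * dz z = J z * (v (\<Psi> z) * d1 (push_test F) (\<Psi> z) + v (\<Psi> z) * d2 (push_test G) (\<Psi> z))"
        by (simp add: algebra_simps)
    qed
    also have "\<dots> = (\<integral>y. v y * d1 (push_test F) y + v y * d2 (push_test G) y \<partial>MD)"
      by (rule integral_MD[symmetric]) simp
    also have "\<dots> = - (\<integral>y. fst (g y) * push_test F y + snd (g y) * push_test G y \<partial>MD)"
      using W[OF PF(1)] W[OF PG(1)] by simp
    also have "(\<integral>y. fst (g y) * push_test F y + snd (g y) * push_test G y \<partial>MD) =
        (\<integral>z. J z * (fst (g (\<Psi> z)) * push_test F (\<Psi> z) + snd (g (\<Psi> z)) * push_test G (\<Psi> z)) \<partial>MQ)"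
      by (rule integral_MD) simp
    also have "\<dots> = (\<integral>z. (fst (g (\<Psi> z)) * m z + snd (g (\<Psi> z)) * n z) * \<zeta> z \<partial>MQ)"
      by (rule integral_MQ_cong) (use J0 in \<open>simp add: push_test_def F_def G_def field_simps\<close>)
    finally show ?thesis .
  qed
  show "(\<integral>z. v (\<Psi> z) * d1 \<zeta> z \<partial>MQ) = - (\<integral>z. fst (pull_gradient g z) * \<zeta> z \<partial>MQ)"
    unfolding pull_gradient_def fst_conv
  proof (rule main[OF der_all(1,3) cont2(1,2,4,5)])
    fix z F G
    assume z: "z \<in> Q" and *: "F = (\<lambda>z. \<zeta> z * (Ps z / J z))" "G = (\<lambda>z. \<zeta> z * (Rs z / J z))"
      "d1 F z = \<zeta> z * ((Pss z * J z - Ps z * Js z) / (J z)\<^sup>2) + d1 \<zeta> z * (Ps z / J z)"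
      "d2 F z = \<zeta> z * ((Pst z * J z - Ps z * Jt z) / (J z)\<^sup>2) + d2 \<zeta> z * (Ps z / J z)"
      "d1 G z = \<zeta> z * ((Rss z * J z - Rs z * Js z) / (J z)\<^sup>2) + d1 \<zeta> z * (Rs z / J z)"
      "d2 G z = \<zeta> z * ((Rst z * J z - Rs z * Jt z) / (J z)\<^sup>2) + d2 \<zeta> z * (Rs z / J z)"
    have "d1 F z * (J z)\<^sup>2 = \<zeta> z * (Pss z * J z - Ps z * Js z) + d1 \<zeta> z * Ps z * J z"
        "d2 F z * (J z)\<^sup>2 = \<zeta> z * (Pst z * J z - Ps z * Jt z) + d2 \<zeta> z * Ps z * J z"
        "d1 G z * (J z)\<^sup>2 = \<zeta> z * (Rss z * J z - Rs z * Js z) + d1 \<zeta> z * Rs z * J z"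
        "d2 G z * (J z)\<^sup>2 = \<zeta> z * (Rst z * J z - Rs z * Jt z) + d2 \<zeta> z * Rs z * J z"
        unfolding *(3-6) using J0[OF z] by (simp_all add: field_simps power2_eq_square)
    from piola_identity[OF J_def Js_def Jt_def this J0[OF z]]
    show "Rt z * d1 F z - Rs z * d2 F z + (Ps z * d2 G z - Pt z * d1 G z) = d1 \<zeta> z" .
  qed
  show "(\<integral>z. v (\<Psi> z) * d2 \<zeta> z \<partial>MQ) = - (\<integral>z. snd (pull_gradient g z) * \<zeta> z \<partial>MQ)"
    unfolding pull_gradient_def snd_conv
  proof (rule main[OF der_all(2,4) cont2(2,3,5,6)])
    fix z F G
    assume z: "z \<in> Q" and *: "F = (\<lambda>z. \<zeta> z * (Pt z / J z))" "G = (\<lambda>z. \<zeta> z * (Rt z / J z))"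
      "d1 F z = \<zeta> z * ((Pst z * J z - Pt z * Js z) / (J z)\<^sup>2) + d1 \<zeta> z * (Pt z / J z)"
      "d2 F z = \<zeta> z * ((Ptt z * J z - Pt z * Jt z) / (J z)\<^sup>2) + d2 \<zeta> z * (Pt z / J z)"
      "d1 G z = \<zeta> z * ((Rst z * J z - Rt z * Js z) / (J z)\<^sup>2) + d1 \<zeta> z * (Rt z / J z)"
      "d2 G z = \<zeta> z * ((Rtt z * J z - Rt z * Jt z) / (J z)\<^sup>2) + d2 \<zeta> z * (Rt z / J z)"
    have "d1 F z * (J z)\<^sup>2 = \<zeta> z * (Pst z * J z - Pt z * Js z) + d1 \<zeta> z * Pt z * J z"
        "d2 F z * (J z)\<^sup>2 = \<zeta> z * (Ptt z * J z - Pt z * Jt z) + d2 \<zeta> z * Pt z * J z"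
        "d1 G z * (J z)\<^sup>2 = \<zeta> z * (Rst z * J z - Rt z * Js z) + d1 \<zeta> z * Rt z * J z"
        "d2 G z * (J z)\<^sup>2 = \<zeta> z * (Rtt z * J z - Rt z * Jt z) + d2 \<zeta> z * Rt z * J z"
        unfolding *(3-6) using J0[OF z] by (simp_all add: field_simps power2_eq_square)
    from piola_identity'[OF J_def Js_def Jt_def this J0[OF z]]
    show "Rt z * d1 F z - Rs z * d2 F z + (Ps z * d2 G z - Pt z * d1 G z) = d2 \<zeta> z" .
  qed
qed

end

section \<open>Test functions on intervals and rectangles\<close>

abbreviation dr :: "(real \<Rightarrow> real) \<Rightarrow> real \<Rightarrow> real" where
  "dr \<phi> t \<equiv> frechet_derivative \<phi> (at t) 1"

lemma has_weak_gradient_real: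
  assumes "D \<in> sets borel"
  shows "has_weak_gradient D v g \<longleftrightarrow> (\<forall>\<phi>\<in>C1_compact_support D.
    (\<integral>t. v t * dr \<phi> t \<partial>restrict_space lborel D) = - (\<integral>t. g t * \<phi> t \<partial>restrict_space lborel (D :: real set)))"
  unfolding has_weak_gradient_def by (simp add: integral_restrict_lborel[OF assms])

lemma C1_real:
  fixes \<phi> :: "real \<Rightarrow> real"
  assumes \<phi>: "\<phi> \<in> C1_compact_support D"
  shows "\<phi> \<in> borel_measurable borel" "dr \<phi> \<in> borel_measurable borel"
    "\<exists>C. \<forall>z. \<bar>\<phi> z\<bar> \<le> C" "\<exists>C. \<forall>z. \<bar>dr \<phi> z\<bar> \<le> C" "(\<phi> has_real_derivative dr \<phi> t) (at t)"
    "continuous_on UNIV \<phi>" "continuous_on UNIV (dr \<phi>)"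
proof -
  show "\<phi> \<in> borel_measurable borel" by (rule borel_measurable_C1_compact_support[OF \<phi>])
  show "dr \<phi> \<in> borel_measurable borel" by (rule borel_measurable_C1_compact_support_deriv[OF \<phi>]) simp
  show "\<exists>C. \<forall>z. \<bar>\<phi> z\<bar> \<le> C" using C1_compact_support_bounded[OF \<phi>] by blast
  show "\<exists>C. \<forall>z. \<bar>dr \<phi> z\<bar> \<le> C" using C1_compact_support_deriv_bounded[OF \<phi>, of 1] by auto
  have d: "(\<phi> has_derivative frechet_derivative \<phi> (at t)) (at t)" by (rule C1_compact_support_has_derivative[OF \<phi>])
  have "frechet_derivative \<phi> (at t) = (\<lambda>h. dr \<phi> t * h)"
  proof
    fix h
    have "frechet_derivative \<phi> (at t) (h *\<^sub>R 1) = h *\<^sub>R dr \<phi> t"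
      by (rule linear_scale[OF has_derivative_linear[OF d]])
    then show "frechet_derivative \<phi> (at t) h = dr \<phi> t * h" by simp
  qed
  with d show "(\<phi> has_real_derivative dr \<phi> t) (at t)" by (simp add: has_field_derivative_def)
  show "continuous_on UNIV \<phi>" by (rule C1_compact_support_continuous[OF \<phi>])
  show "continuous_on UNIV (dr \<phi>)" by (rule C1_compact_support_continuous_deriv[OF \<phi>]) simp
qed

lemma C1_realI:
  fixes \<phi> :: "real \<Rightarrow> real"
  assumes D: "open D" and K: "compact K" "K \<subseteq> D"
    and der: "\<And>t. t \<in> D \<Longrightarrow> (\<phi> has_real_derivative \<phi>' t) (at t)"
    and c: "continuous_on D \<phi>'" and zero: "\<And>t. t \<notin> K \<Longrightarrow> \<phi> t = 0"
  shows "\<phi> \<in> C1_compact_support D" "t \<in> D \<Longrightarrow> dr \<phi> t = \<phi>' t"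
proof -
  have d: "(\<phi> has_derivative (\<lambda>h. \<phi>' t * h)) (at t)" if "t \<in> D" for t
    using der[OF that] by (simp add: has_field_derivative_def)
  show "\<phi> \<in> C1_compact_support D"
    by (rule C1_compact_supportI[OF D K d _ zero]) (use c in simp_all)
  show "dr \<phi> t = \<phi>' t" if "t \<in> D"
    using fun_cong[OF frechet_derivative_at[OF d[OF that]], of 1] by simp
qed

lemma C1_compact_support_product:
  assumes I: "open I" and J: "open J" and \<alpha>: "\<alpha> \<in> C1_compact_support I" and \<beta>: "\<beta> \<in> C1_compact_support J"
  shows "(\<lambda>z. \<alpha> (fst z) * \<beta> (snd z)) \<in> C1_compact_support (I \<times> J :: (real \<times> real) set)"
    and "d1 (\<lambda>z. \<alpha> (fst z) * \<beta> (snd z)) (s, t) = dr \<alpha> s * \<beta> t"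
    and "d2 (\<lambda>z. \<alpha> (fst z) * \<beta> (snd z)) (s, t) = \<alpha> s * dr \<beta> t"
proof -
  obtain K where K: "compact K" "K \<subseteq> I" "\<And>x. x \<notin> K \<Longrightarrow> \<alpha> x = 0"
    using C1_compact_support_obtain[OF \<alpha>] by blast
  obtain K' where K': "compact K'" "K' \<subseteq> J" "\<And>x. x \<notin> K' \<Longrightarrow> \<beta> x = 0"
    using C1_compact_support_obtain[OF \<beta>] by blast
  have da: "((\<lambda>z. \<alpha> (fst z)) has_derivative (\<lambda>h. dr \<alpha> (fst z) * fst h)) (at z)" for z :: "real \<times> real"
    using has_derivative_compose[OF has_derivative_fst[OF has_derivative_ident], of \<alpha> "\<lambda>h. dr \<alpha> (fst z) * h" z UNIV] C1_real(5)[OF \<alpha>, of "fst z"]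
    by (simp add: has_field_derivative_def)
  have db: "((\<lambda>z. \<beta> (snd z)) has_derivative (\<lambda>h. dr \<beta> (snd z) * snd h)) (at z)" for z :: "real \<times> real"
    using has_derivative_compose[OF has_derivative_snd[OF has_derivative_ident], of \<beta> "\<lambda>h. dr \<beta> (snd z) * h" z UNIV] C1_real(5)[OF \<beta>, of "snd z"]
    by (simp add: has_field_derivative_def)
  have d: "((\<lambda>z. \<alpha> (fst z) * \<beta> (snd z)) has_derivative
    (\<lambda>h. \<alpha> (fst z) * (dr \<beta> (snd z) * snd h) + dr \<alpha> (fst z) * fst h * \<beta> (snd z))) (at z)" for z :: "real \<times> real"
    by (rule has_derivative_mult[OF da db])
  have c: "continuous_on UNIV (\<lambda>z::real \<times> real. \<alpha> (fst z))" "continuous_on UNIV (\<lambda>z::real \<times> real. dr \<alpha> (fst z))"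
     "continuous_on UNIV (\<lambda>z::real \<times> real. \<beta> (snd z))" "continuous_on UNIV (\<lambda>z::real \<times> real. dr \<beta> (snd z))"
    by (rule continuous_on_compose2[OF C1_real(6)[OF \<alpha>]] continuous_on_compose2[OF C1_real(7)[OF \<alpha>]]
        continuous_on_compose2[OF C1_real(6)[OF \<beta>]] continuous_on_compose2[OF C1_real(7)[OF \<beta>]],
        intro continuous_intros, simp)+
  show "(\<lambda>z. \<alpha> (fst z) * \<beta> (snd z)) \<in> C1_compact_support (I \<times> J)"
  proof (rule C1_compact_supportI[OF _ _ _ d])
    show "open (I \<times> J)" "compact (K \<times> K')" "K \<times> K' \<subseteq> I \<times> J" using I J K K' by (auto intro: open_Times compact_Times)
    show "continuous_on (I \<times> J) (\<lambda>z. \<alpha> (fst z) * (dr \<beta> (snd z) * snd b) + dr \<alpha> (fst z) * fst b * \<beta> (snd z))" for b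
      by (intro continuous_intros c[THEN continuous_on_subset]) auto
    show "\<alpha> (fst z) * \<beta> (snd z) = 0" if "z \<notin> K \<times> K'" for z
      using that K(3)[of "fst z"] K'(3)[of "snd z"] by (cases z) auto
  qed
  show "d1 (\<lambda>z. \<alpha> (fst z) * \<beta> (snd z)) (s, t) = dr \<alpha> s * \<beta> t"
    "d2 (\<lambda>z. \<alpha> (fst z) * \<beta> (snd z)) (s, t) = \<alpha> s * dr \<beta> t"
    using frechet_derivative_at[OF d[of "(s, t)"], symmetric] by simp_all
qed

text \<open>The square of the positive part is C1, though not twice differentiable at 0; for test
  functions of class C1 this smoothing suffices.\<close>

lemma max_0_square_deriv: "((\<lambda>x::real. (max 0 x)\<^sup>2) has_real_derivative 2 * max 0 x) (at x)"
proof -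
  consider "x > 0" | "x < 0" | "x = 0" by linarith
  then show ?thesis
  proof cases
    case 1
    have "((\<lambda>x::real. x\<^sup>2) has_real_derivative 2 * x) (at x)" by (auto intro!: derivative_eq_intros)
    then have "((\<lambda>x::real. (max 0 x)\<^sup>2) has_real_derivative 2 * x) (at x)"
      by (rule DERIV_cong_ev[THEN iffD1, rotated 3])
        (use 1 eventually_nhds_in_open[of "{0<..}" x] in \<open>auto elim!: eventually_mono\<close>)
    then show ?thesis using 1 by simp
  next
    case 2
    have "((\<lambda>x::real. 0) has_real_derivative 0) (at x)" by simp
    then have "((\<lambda>x::real. (max 0 x)\<^sup>2) has_real_derivative 0) (at x)"
      by (rule DERIV_cong_ev[THEN iffD1, rotated 3])
        (use 2 eventually_nhds_in_open[of "{..<0}" x] in \<open>auto elim!: eventually_mono\<close>)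
    then show ?thesis using 2 by simp
  next
    case 3
    have "((\<lambda>h. ((max 0 (x + h))\<^sup>2 - (max 0 x)\<^sup>2) / h) \<longlongrightarrow> 0) (at 0)"
    proof (rule Lim_null_comparison)
      show "\<forall>\<^sub>F h in at 0. norm (((max 0 (x + h))\<^sup>2 - (max 0 x)\<^sup>2) / h) \<le> \<bar>h\<bar>"
      proof (rule always_eventually, rule allI)
        fix h :: real
        show "norm (((max 0 (x + h))\<^sup>2 - (max 0 x)\<^sup>2) / h) \<le> \<bar>h\<bar>"
          using 3 by (cases "h > 0") (auto simp: power2_eq_square max_def)
      qed
      show "((\<lambda>h::real. \<bar>h\<bar>) \<longlongrightarrow> 0) (at 0)" by (rule tendsto_eq_intros refl | simp)+
    qed
    then show ?thesis using 3 by (simp add: DERIV_def)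
  qed
qed

text \<open>The bumps are r / (r + h), where \<open>r\<close> is the squared positive part of a
  quadratic whose zeros lie strictly inside the interval and move to its ends as \<open>h\<close>
  tends to 0. Where the limit of \<open>r\<close> is positive the quotient tends to 1, and it stays
  in [0, 1] throughout.\<close>

lemma exists_bumps:
  fixes a b :: real
  assumes ab: "a < b"
  shows "\<exists>\<eta>. (\<forall>n. \<eta> n \<in> C1_compact_support {a<..<b}) \<and> (\<forall>n t. 0 \<le> \<eta> n t \<and> \<eta> n t \<le> 1) \<and>
    (\<forall>t. (\<lambda>n. \<eta> n t) \<longlonglongrightarrow> indicator {a<..<b} t)"
proof -
  \<comment> \<open>The factor 1/3 keeps \<open>a + h n\<close> below \<open>b - h n\<close>, so
    that outside this smaller interval the factors of \<open>q n t\<close> never have the same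
    strict sign.\<close>
  define h where "h n = (b - a) / 3 * inverse (real (Suc n))" for n
  have h: "0 < h n" "3 * h n \<le> b - a" for n
    using ab by (auto simp: h_def field_simps mult_right_mono)
  have h0: "h \<longlonglongrightarrow> 0"
    using tendsto_mult[OF tendsto_const LIMSEQ_inverse_real_of_nat, of "(b - a) / 3"] by (simp add: h_def[abs_def])
  define q where "q n t = (t - a - h n) * (b - h n - t)" for n t
  define r where "r n t = (max 0 (q n t))\<^sup>2" for n t
  define \<eta> where "\<eta> n t = r n t / (r n t + h n)" for n t
  have r0: "0 \<le> r n t" for n t by (simp add: r_def)
  have out: "r n t = 0" if "t \<notin> {a + h n..b - h n}" for n t
  proof -
    have "q n t \<le> 0"
      using that h[of n] unfolding q_def by (intro mult_le_0_iff[THEN iffD2]) auto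
    then show ?thesis by (simp add: r_def)
  qed
  have dq: "(q n has_real_derivative (b - h n - t) - (t - a - h n)) (at t)" for n t
    unfolding q_def[abs_def] by (auto intro!: derivative_eq_intros)
  define r' where "r' n t = 2 * max 0 (q n t) * ((b - h n - t) - (t - a - h n))" for n t
  have drr: "(r n has_real_derivative r' n t) (at t)" for n t
    unfolding r_def[abs_def] r'_def by (rule DERIV_chain2[OF max_0_square_deriv dq])
  have d\<eta>: "(\<eta> n has_real_derivative r' n t * h n / (r n t + h n)\<^sup>2) (at t)" for n t
  proof -
    have "r n t + h n \<noteq> 0" using r0[of n t] h[of n] by linarith
    then have "((\<lambda>t. r n t / (r n t + h n)) has_real_derivative
      (r' n t * (r n t + h n) - r n t * (r' n t + 0)) / ((r n t + h n) * (r n t + h n))) (at t)"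
      by (intro DERIV_divide DERIV_add drr DERIV_const) auto
    then show ?thesis unfolding \<eta>_def[abs_def] by (simp add: algebra_simps power2_eq_square)
  qed
  have cq: "continuous_on S (q n)" for n S unfolding q_def[abs_def] by (intro continuous_intros)
  have "\<eta> n \<in> C1_compact_support {a<..<b}" for n
  proof (rule C1_realI(1))
    show "{a + h n..b - h n} \<subseteq> {a<..<b}" using h[of n] by auto
    show "(\<eta> n has_real_derivative r' n t * h n / (r n t + h n)\<^sup>2) (at t)" for t by (rule d\<eta>)
    have "r n t + h n \<noteq> 0" for t using r0[of n t] h[of n] by (smt (verit))
    then show "continuous_on {a<..<b} (\<lambda>t. r' n t * h n / (r n t + h n)\<^sup>2)"
      unfolding r'_def r_def by (intro continuous_intros cq) auto
    show "\<eta> n t = 0" if "t \<notin> {a + h n..b - h n}" for t using out[OF that] by (simp add: \<eta>_def)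
  qed auto
  moreover have "0 \<le> \<eta> n t \<and> \<eta> n t \<le> 1" for n t
  proof -
    have "0 < r n t + h n" using r0[of n t] h[of n] by linarith
    then show ?thesis unfolding \<eta>_def using r0[of n t] h[of n] by (simp add: divide_le_eq_1)
  qed
  moreover have "(\<lambda>n. \<eta> n t) \<longlonglongrightarrow> indicator {a<..<b} t" for t
  proof (cases "t \<in> {a<..<b}")
    case True
    define l where "l = (max 0 ((t - a - 0) * (b - 0 - t)))\<^sup>2"
    have l: "l > 0" using True by (simp add: l_def)
    have "(\<lambda>n. r n t) \<longlonglongrightarrow> l" unfolding r_def q_def l_def by (intro tendsto_intros h0)
    then have "(\<lambda>n. \<eta> n t) \<longlonglongrightarrow> l / (l + 0)"
      unfolding \<eta>_def using l by (intro tendsto_divide tendsto_add h0) simp_all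
    then show ?thesis using l True by simp
  next
    case False
    then have "t \<notin> {a + h n..b - h n}" for n using h[of n] by auto
    then show ?thesis using False out by (simp add: \<eta>_def)
  qed
  ultimately show ?thesis by blast
qed

lemma compact_subset_interval:
  fixes K :: "real set"
  assumes "compact K" "K \<subseteq> {c<..<d}" "c < d"
  shows "\<exists>a b. c < a \<and> a \<le> b \<and> b < d \<and> K \<subseteq> {a..b}"
proof (cases "K = {}")
  case True
  then show ?thesis using assms by (intro exI[of _ "(c + d) / 2"]) auto
next
  case False
  obtain a where a: "a \<in> K" "\<And>t. t \<in> K \<Longrightarrow> a \<le> t" using compact_attains_inf[OF assms(1) False] by blast
  obtain b where b: "b \<in> K" "\<And>t. t \<in> K \<Longrightarrow> t \<le> b" using compact_attains_sup[OF assms(1) False] by blast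
  show ?thesis using a b assms by (intro exI[of _ a] exI[of _ b]) auto
qed

text \<open>Vanishing total integral is exactly what makes the primitive vanish to the right of the
  support as well as to the left. Thus every mean-zero test function is the derivative of a test
  function.\<close>

lemma C1_compact_support_primitive:
  assumes f: "f \<in> C1_compact_support {0<..<1::real}" and zero: "(\<integral>t. f t \<partial>lborel) = 0"
  shows "\<exists>\<beta>\<in>C1_compact_support {0<..<1}. \<forall>t\<in>{0<..<1}. dr \<beta> t = f t \<and> \<beta> t = (\<integral>\<tau>. indicator {..<t} \<tau> * f \<tau> \<partial>lborel)"
proof -
  obtain K where K: "compact K" "K \<subseteq> {0<..<1}" "\<And>x. x \<notin> K \<Longrightarrow> f x = 0"
    using C1_compact_support_obtain[OF f] by blast
  obtain a b where ab: "0 < a" "a \<le> b" "b < 1" "K \<subseteq> {a..b}"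
    using compact_subset_interval[OF K(1,2)] by auto
  have out: "f t = 0" if "t \<notin> {a..b}" for t using that ab(4) K(3) by blast
  \<comment> \<open>The lower limit -1, rather than 0, puts [0, 1] into the interior of the interval
    of integration, so all derivatives used below are two-sided.\<close>
  define F where "F t = integral {-1..t} f" for t
  have dF: "(F has_real_derivative f t) (at t)" if "-1 < t" "t < 2" for t
  proof -
    have "(F has_real_derivative f t) (at t within {-1..2})"
      unfolding F_def[abs_def]
      by (rule integral_has_real_derivative) (use C1_real(6)[OF f] that in \<open>auto intro: continuous_on_subset\<close>)
    moreover have "at t within {-1..2} = at t" using that by (intro at_within_interior) auto
    ultimately show ?thesis by simp
  qed
  define \<beta> where "\<beta> t = (\<integral>\<tau>. indicator {..<t} \<tau> * f \<tau> \<partial>lborel)" for t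
  have \<beta>: "\<beta> t = F t - F 0" if "0 \<le> t" "t < 2" for t
  proof -
    have "\<beta> t = (\<integral>\<tau>. indicator {0..t} \<tau> *\<^sub>R f \<tau> \<partial>lborel)"
    proof -
      have "AE \<tau> in lborel. indicator {..<t} \<tau> * f \<tau> = indicator {0..t} \<tau> *\<^sub>R f \<tau>"
        using AE_lborel_singleton[of t]
      proof eventually_elim
        fix \<tau> assume "\<tau> \<noteq> t"
        then show "indicator {..<t} \<tau> * f \<tau> = indicator {0..t} \<tau> *\<^sub>R f \<tau>"
          using out[of \<tau>] ab(1) by (cases "\<tau> < 0") (auto simp: indicator_def)
      qed
      then show ?thesis unfolding \<beta>_def
        using C1_real(1)[OF f] by (intro integral_cong_AE) auto
    qed
    also have "\<dots> = F t - F 0"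
      by (rule integral_FTC_atLeastAtMost[OF that(1)])
        (use dF that C1_real(6)[OF f] in \<open>auto simp: has_real_derivative_iff_has_vector_derivative[symmetric]
          intro: continuous_on_subset has_field_derivative_at_within\<close>)
    finally show ?thesis .
  qed
  have dB: "(\<beta> has_real_derivative f t) (at t)" if t: "t \<in> {0<..<1}" for t
  proof -
    have "((\<lambda>t. F t - F 0) has_real_derivative f t) (at t)"
      using dF[of t] t by (auto intro!: derivative_eq_intros)
    then show ?thesis
      by (rule DERIV_cong_ev[THEN iffD1, rotated 3])
        (use t eventually_nhds_in_open[of "{0<..<1}" t] \<beta> in \<open>auto elim!: eventually_mono\<close>)
  qed
  have z: "\<beta> t = 0" if "t \<notin> {a..b}" for t
  proof (cases "t < a")
    case True
    then have "(\<lambda>\<tau>. indicator {..<t} \<tau> * f \<tau>) = (\<lambda>_. 0)" using out by (auto simp: indicator_def fun_eq_iff)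
    then show ?thesis by (simp add: \<beta>_def)
  next
    case False
    then have "t > b" using that by auto
    then have "(\<lambda>\<tau>. indicator {..<t} \<tau> * f \<tau>) = f" using out by (auto simp: indicator_def fun_eq_iff)
    then show ?thesis using zero by (simp add: \<beta>_def)
  qed
  have *: "open {0<..<1::real}" "compact {a..b}" "{a..b} \<subseteq> {0<..<1}" "continuous_on {0<..<1} f"
    using ab C1_real(6)[OF f] by (auto intro: continuous_on_subset)
  note b = C1_realI[OF *(1-3) dB *(4) z]
  show ?thesis
    by (rule bexI[OF _ b(1)], rule ballI, rule conjI[OF b(2)]) (simp_all add: \<beta>_def)
qed

section \<open>Slicing\<close>

text \<open>The Borel sets over which \<open>f\<close> integrates to zero form a Dynkin system
  containing the intersection-stable boxes, hence all Borel sets. The sets where \<open>f\<close> is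
  nonnegative and where it is nonpositive then finish the argument.\<close>

lemma AE_zero_if_integral_boxes_zero:
  fixes f :: "'a::euclidean_space \<Rightarrow> real"
  assumes f: "integrable lborel f" and box: "\<And>a b. (LINT x:box a b|lborel. f x) = 0"
  shows "AE x in lborel. f x = 0"
proof -
  have si: "set_integrable lborel A f" if "A \<in> sets borel" for A
    using f that unfolding set_integrable_def by (intro integrable_mult_indicator) auto
  \<comment> \<open>The step to complements needs the integral over the whole space, which is not a
    box but an increasing union of boxes.\<close>
  have UN: "(\<integral>x. f x \<partial>lborel) = 0"
  proof -
    let ?B = "\<lambda>n. box (- real n *\<^sub>R One) (real n *\<^sub>R One) :: 'a set"
    have "(\<lambda>n. \<integral>x. indicator (?B n) x *\<^sub>R f x \<partial>lborel) \<longlonglongrightarrow> (\<integral>x. f x \<partial>lborel)"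
    proof (rule integral_dominated_convergence)
      show "integrable lborel (\<lambda>x. \<bar>f x\<bar>)" using f by simp
      show "AE x in lborel. (\<lambda>n. indicator (?B n) x *\<^sub>R f x) \<longlonglongrightarrow> f x"
      proof (rule AE_I2)
        fix x :: 'a
        have "x \<in> (\<Union>n. ?B n)" by (simp add: UN_box_eq_UNIV)
        then obtain m where m: "x \<in> ?B m" by blast
        have "x \<in> ?B n" if "n \<ge> m" for n
          using m that by (auto simp: mem_box intro: order.strict_trans1 order.strict_trans2)
        then have "\<forall>\<^sub>F n in sequentially. indicator (?B n) x *\<^sub>R f x = f x"
          unfolding eventually_sequentially by (intro exI[of _ m]) auto
        then show "(\<lambda>n. indicator (?B n) x *\<^sub>R f x) \<longlonglongrightarrow> f x" by (rule tendsto_eventually)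
      qed
      show "AE x in lborel. norm (indicator (?B n) x *\<^sub>R f x) \<le> \<bar>f x\<bar>" for n
        by (intro AE_I2) (auto simp: indicator_def)
    qed (use f in auto)
    moreover have "(\<integral>x. indicator (?B n) x *\<^sub>R f x \<partial>lborel) = 0" for n
      using box unfolding set_lebesgue_integral_def by blast
    ultimately show ?thesis by (simp add: LIMSEQ_const_iff)
  qed
  have all: "(LINT x:A|lborel. f x) = 0" if "A \<in> sets borel" for A
  proof -
    have "Int_stable (range (\<lambda>(a, b). box a b :: 'a set))"
      by (auto simp: Int_stable_def box_Int_box)
    moreover have "range (\<lambda>(a, b). box a b :: 'a set) \<subseteq> Pow UNIV" by simp
    moreover have "A \<in> sigma_sets UNIV (range (\<lambda>(a, b). box a b :: 'a set))"
      using that by (simp add: borel_eq_box)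
    ultimately show ?thesis
    proof (induction rule: sigma_sets_induct_disjoint)
      case (basic A) then show ?case using box by auto
    next
      case empty then show ?case by (simp add: set_lebesgue_integral_def)
    next
      case (compl A)
      then have A: "A \<in> sets borel" by (simp add: borel_eq_box)
      have "(LINT x:UNIV - A|lborel. f x) = (\<integral>x. f x - indicator A x *\<^sub>R f x \<partial>lborel)"
        unfolding set_lebesgue_integral_def
        by (intro Bochner_Integration.integral_cong) (auto simp: indicator_def)
      also have "\<dots> = 0" using UN compl si[OF A] f unfolding set_lebesgue_integral_def set_integrable_def by simp
      finally show ?case .
    next
      case (union A)
      then have A: "\<And>i. A i \<in> sets borel" by (auto simp: borel_eq_box)
      have "(LINT x:(\<Union>i. A i)|lborel. f x) = (\<Sum>i. (LINT x:A i|lborel. f x))"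
        using A union(1) by (intro lebesgue_integral_countable_add si) (auto simp: disjoint_family_on_def)
      then show ?case using union by simp
    qed
  qed
  have fm[measurable]: "f \<in> borel_measurable borel" using f by auto
  have half: "AE x in lborel. indicator A x * g x = 0"
    if g: "integrable lborel g" "A \<in> sets borel" "(LINT x:A|lborel. g x) = 0" "\<And>x. x \<in> A \<Longrightarrow> 0 \<le> g x" for g :: "'a \<Rightarrow> real" and A
  proof -
    have "integrable lborel (\<lambda>x. indicator A x *\<^sub>R g x)"
      using g by (intro integrable_mult_indicator) auto
    then have "integrable lborel (\<lambda>x. indicator A x * g x)" by (simp only: real_scaleR_def)
    then have "(\<integral>x. indicator A x * g x \<partial>lborel) = 0 \<longleftrightarrow> (AE x in lborel. indicator A x * g x = 0)"
      by (rule integral_nonneg_eq_0_iff_AE) (use g(4) in \<open>auto simp: indicator_def\<close>)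
    then show ?thesis using g by (simp add: set_lebesgue_integral_def)
  qed
  have "AE x in lborel. indicator {x. 0 \<le> f x} x * f x = 0" by (rule half) (use f all in auto)
  moreover have "AE x in lborel. indicator {x. f x \<le> 0} x * (- f x) = 0"
    by (rule half) (use f all in \<open>auto simp: set_integral_uminus si\<close>)
  ultimately show ?thesis by eventually_elim (auto simp: indicator_def split: if_splits)
qed

text \<open>Links the two views of the rectangle: weak gradients and the change of variables refer
  to restricted planar Lebesgue measure, Fubini's theorem to the product of the two interval
  measures.\<close>

lemma restrict_lborel_Times:
  fixes A B :: "real set"
  assumes A: "A \<in> sets borel" and B: "B \<in> sets borel"
  shows "restrict_space lborel (A \<times> B) = restrict_space lborel A \<Otimes>\<^sub>M restrict_space lborel B"
proof (rule pair_measure_eqI[symmetric])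
  let ?A = "restrict_space lborel A" and ?B = "restrict_space lborel B" and ?P = "restrict_space lborel (A \<times> B)"
  show sA: "sigma_finite_measure ?A" and sB: "sigma_finite_measure ?B"
    using A B by (auto intro!: sigma_finite_measure_restrict_space lborel.sigma_finite_measure_axioms)
  have AB: "A \<times> B \<in> sets borel" using A B by (subst borel_prod[symmetric]) auto
  show "sets (?A \<Otimes>\<^sub>M ?B) = sets ?P"
  proof
    show "sets (?A \<Otimes>\<^sub>M ?B) \<subseteq> sets ?P"
      unfolding sets_pair_measure
    proof (rule sets.sigma_sets_subset')
      show "space ?A \<times> space ?B \<in> sets ?P"
        using AB sets.top[of ?P] by (simp add: space_restrict_space)
      show "{a \<times> b |a b. a \<in> sets ?A \<and> b \<in> sets ?B} \<subseteq> sets ?P"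
      proof clarify
        fix a b assume "a \<in> sets ?A" "b \<in> sets ?B"
        then have *: "a \<subseteq> A" "b \<subseteq> B" "a \<in> sets borel" "b \<in> sets borel"
          using A B by (auto simp: sets_restrict_space_iff)
        then have "a \<times> b \<in> sets borel" by (subst borel_prod[symmetric]) auto
        then show "a \<times> b \<in> sets ?P" using * AB by (auto simp: sets_restrict_space_iff)
      qed
    qed
    show "sets ?P \<subseteq> sets (?A \<Otimes>\<^sub>M ?B)"
    proof
      fix S assume "S \<in> sets ?P"
      then have S: "S \<in> sets borel" "S \<subseteq> A \<times> B" using AB by (auto simp: sets_restrict_space_iff)
      have "(\<lambda>z. (fst z, snd z)) \<in> ?A \<Otimes>\<^sub>M ?B \<rightarrow>\<^sub>M borel \<Otimes>\<^sub>M borel"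
        by (intro measurable_Pair measurable_compose[OF measurable_fst] measurable_compose[OF measurable_snd] measurable_restrict_space1) auto
      then have "(\<lambda>z. (fst z, snd z)) -` S \<inter> space (?A \<Otimes>\<^sub>M ?B) \<in> sets (?A \<Otimes>\<^sub>M ?B)"
        using S(1) by (intro measurable_sets) (auto simp: borel_prod)
      moreover have "(\<lambda>z. (fst z, snd z)) -` S \<inter> space (?A \<Otimes>\<^sub>M ?B) = S"
        using S(2) by (auto simp: space_pair_measure space_restrict_space)
      ultimately show "S \<in> sets (?A \<Otimes>\<^sub>M ?B)" by simp
    qed
  qed
  fix a b assume "a \<in> sets ?A" "b \<in> sets ?B"
  then have *: "a \<subseteq> A" "b \<subseteq> B" "a \<in> sets borel" "b \<in> sets borel"
    using A B by (auto simp: sets_restrict_space_iff)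
  have "emeasure lborel (a \<times> b) = emeasure lborel a * emeasure lborel b"
    using * by (subst lborel_prod[symmetric], subst lborel.emeasure_pair_measure_Times) auto
  then show "emeasure ?A a * emeasure ?B b = emeasure ?P (a \<times> b)"
    using * A B AB by (simp add: emeasure_restrict_space Sigma_mono)
qed

lemma C1_compact_support_real_diff:
  fixes f g :: "real \<Rightarrow> real"
  assumes D: "open D" and f: "f \<in> C1_compact_support D" and g: "g \<in> C1_compact_support D"
  shows "(\<lambda>t. f t - c * g t) \<in> C1_compact_support D"
proof -
  obtain K where K: "compact K" "K \<subseteq> D" "\<And>x. x \<notin> K \<Longrightarrow> f x = 0"
    using C1_compact_support_obtain[OF f] by blast
  obtain K' where K': "compact K'" "K' \<subseteq> D" "\<And>x. x \<notin> K' \<Longrightarrow> g x = 0"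
    using C1_compact_support_obtain[OF g] by blast
  show ?thesis
  proof (rule C1_realI(1)[OF D, of "K \<union> K'"])
    show "((\<lambda>t. f t - c * g t) has_real_derivative dr f t - c * dr g t) (at t)" for t
      by (intro DERIV_diff DERIV_cmult C1_real(5)[OF f] C1_real(5)[OF g])
    show "continuous_on D (\<lambda>t. dr f t - c * dr g t)"
      by (intro continuous_intros C1_real(7)[OF f, THEN continuous_on_subset] C1_real(7)[OF g, THEN continuous_on_subset]) auto
  qed (use K K' in auto)
qed

locale slicing =
  fixes L :: real
  assumes L: "L > 0"
begin

abbreviation "MI \<equiv> restrict_space lborel {0<..<L}"
abbreviation "M1 \<equiv> restrict_space lborel {0<..<1::real}"
abbreviation "Q \<equiv> {0<..<L} \<times> {0<..<1::real}"
abbreviation "MQ \<equiv> restrict_space lborel Q"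

lemma MQ_eq: "MQ = MI \<Otimes>\<^sub>M M1"
  by (rule restrict_lborel_Times) auto

lemma open_Q: "open Q" by (intro open_Times) auto

lemma finite_MI: "finite_measure MI"
  using L by (intro finite_measureI) (simp add: emeasure_restrict_space space_restrict_space)
lemma finite_M1: "finite_measure M1"
  by (intro finite_measureI) (simp add: emeasure_restrict_space space_restrict_space)

sublocale MI: finite_measure MI by (rule finite_MI)
sublocale M1: finite_measure M1 by (rule finite_M1)
sublocale pair_sigma_finite MI M1 ..

lemma measure_M1: "measure M1 (space M1) = 1"
  by (simp add: measure_restrict_space space_restrict_space)

lemma finite_MQ: "finite_measure MQ"
  unfolding MQ_eq
proof (rule finite_measureI)
  have "emeasure (MI \<Otimes>\<^sub>M M1) (space MI \<times> space M1) = emeasure MI (space MI) * emeasure M1 (space M1)"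
    by (rule M1.emeasure_pair_measure_Times[OF sets.top sets.top])
  then show "emeasure (MI \<Otimes>\<^sub>M M1) (space (MI \<Otimes>\<^sub>M M1)) \<noteq> \<infinity>"
    by (simp add: space_pair_measure ennreal_mult_eq_top_iff)
qed

lemma Fubini_MQ:
  fixes f :: "real \<times> real \<Rightarrow> real"
  assumes "integrable MQ f"
  shows "AE s in MI. integrable M1 (\<lambda>t. f (s, t))" "integrable MI (\<lambda>s. \<integral>t. f (s, t) \<partial>M1)"
    "(\<integral>z. f z \<partial>MQ) = (\<integral>s. (\<integral>t. f (s, t) \<partial>M1) \<partial>MI)"
  using AE_integrable_fst'[of f] integrable_fst'[of f] integral_fst'[of f] assms unfolding MQ_eq by simp_all

lemma measurable_fst_MQ: "fst \<in> measurable MQ MI" and measurable_snd_MQ: "snd \<in> measurable MQ M1"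
  unfolding MQ_eq by simp_all

lemma measurable_slice: "f \<in> borel_measurable MQ \<Longrightarrow> s \<in> {0<..<L} \<Longrightarrow> (\<lambda>t. f (s, t)) \<in> borel_measurable M1"
  for f :: "real \<times> real \<Rightarrow> real"
  unfolding MQ_eq by (rule measurable_Pair2) (auto simp: space_restrict_space)

lemma measurable_average:
  fixes f :: "real \<times> real \<Rightarrow> real"
  assumes f[measurable]: "f \<in> borel_measurable MQ"
  shows "(\<lambda>s. \<integral>t. f (s, t) \<partial>M1) \<in> borel_measurable MI"
  using assms unfolding MQ_eq by measurable

lemma integrable_fst_MQ:
  fixes f :: "real \<Rightarrow> real"
  assumes f: "integrable MI f"
  shows "integrable MQ (\<lambda>z. f (fst z))" "(\<integral>z. f (fst z) \<partial>MQ) = (\<integral>s. f s \<partial>MI)"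
proof -
  have [measurable]: "f \<in> borel_measurable MI" using f by simp
  show *: "integrable MQ (\<lambda>z. f (fst z))"
    unfolding MQ_eq
    by (rule Fubini_integrable) (use f measure_M1 in \<open>auto simp del: integral_norm_eq_0_iff\<close>)
  show "(\<integral>z. f (fst z) \<partial>MQ) = (\<integral>s. f s \<partial>MI)"
    using Fubini_MQ(3)[OF *] measure_M1 by simp
qed

lemma AE_MQ_I:
  assumes "AE s in MI. AE t in M1. P (s, t)" "{z \<in> space MQ. P z} \<in> sets MQ"
  shows "AE z in MQ. P z"
  using AE_pair_measure[of P] assms unfolding MQ_eq by simp

lemma AE_MQ_D: "AE z in MQ. P z \<Longrightarrow> AE s in MI. AE t in M1. P (s, t)"
  unfolding MQ_eq by (rule AE_pair)

lemma bounded_test_MQ: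
  fixes f g :: "real \<Rightarrow> real"
  assumes "f \<in> borel_measurable borel" "g \<in> borel_measurable borel" "\<exists>C. \<forall>x. \<bar>f x\<bar> \<le> C" "\<exists>C. \<forall>x. \<bar>g x\<bar> \<le> C"
  shows "(\<lambda>z. f (fst z) * g (snd z)) \<in> borel_measurable MQ" "\<exists>C. \<forall>z::real \<times> real. \<bar>f (fst z) * g (snd z)\<bar> \<le> C"
proof -
  have [measurable]: "fst \<in> borel_measurable MQ" "snd \<in> borel_measurable MQ"
    by (intro borel_measurable_restrict_lborelI borel_measurable_continuous_onI continuous_intros)+
  show "(\<lambda>z. f (fst z) * g (snd z)) \<in> borel_measurable MQ" using assms(1,2) by measurable
  obtain C C' where "\<And>x. \<bar>f x\<bar> \<le> C" "\<And>x. \<bar>g x\<bar> \<le> C'" using assms by blast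
  then have "\<bar>f (fst z) * g (snd z)\<bar> \<le> C * C'" for z :: "real \<times> real"
    unfolding abs_mult by (intro mult_mono) (auto intro: order_trans[OF abs_ge_zero])
  then show "\<exists>C. \<forall>z::real \<times> real. \<bar>f (fst z) * g (snd z)\<bar> \<le> C" by blast
qed

lemma integrable_test_MQ:
  fixes f g :: "real \<Rightarrow> real"
  assumes "integrable MQ u" "f \<in> borel_measurable borel" "g \<in> borel_measurable borel"
    "\<exists>C. \<forall>x. \<bar>f x\<bar> \<le> C" "\<exists>C. \<forall>x. \<bar>g x\<bar> \<le> C"
  shows "integrable MQ (\<lambda>z. u z * (f (fst z) * g (snd z)))"
  by (rule integrable_mult_bounded[OF assms(1) bounded_test_MQ[OF assms(2-5)]])

text \<open>The fundamental lemma of the calculus of variations for product test functions. Products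
  of one-dimensional bumps converge boundedly to indicators of rectangles, so \<open>W\<close>
  integrates to zero over the part of every box inside \<open>Q\<close>.\<close>

lemma zero_if_product_tests_zero:
  fixes W :: "real \<times> real \<Rightarrow> real"
  assumes W: "integrable MQ W"
    and t: "\<And>\<alpha> \<beta>. \<alpha> \<in> C1_compact_support {0<..<L} \<Longrightarrow> \<beta> \<in> C1_compact_support {0<..<1} \<Longrightarrow>
      (\<integral>z. W z * (\<alpha> (fst z) * \<beta> (snd z)) \<partial>MQ) = 0"
  shows "AE z in MQ. W z = 0"
proof -
  have Qb: "Q \<in> sets borel" using open_Q by simp
  have W0: "integrable lborel (\<lambda>z. indicator Q z *\<^sub>R W z)"
    using W Qb by (simp add: integrable_restrict_space)
  have "AE z in lborel. indicator Q z *\<^sub>R W z = 0"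
  proof (rule AE_zero_if_integral_boxes_zero[OF W0])
    fix l u :: "real \<times> real"
    \<comment> \<open>Clipping the box to the rectangle makes the bumps inside it admissible test
      functions; an empty intersection is treated separately, as bumps need a proper
      interval.\<close>
    let ?a = "max (fst l) 0" and ?b = "min (fst u) L" and ?c = "max (snd l) 0" and ?d = "min (snd u) 1"
    have "(LINT z:box l u|lborel. indicator Q z *\<^sub>R W z) = (\<integral>z. indicator Q z *\<^sub>R (W z * (indicator {?a<..<?b} (fst z) * indicator {?c<..<?d} (snd z))) \<partial>lborel)"
      unfolding set_lebesgue_integral_def
      by (rule Bochner_Integration.integral_cong) (auto simp: indicator_def mem_box Basis_real_pair inner_prod_def split: prod.splits)
    also have "\<dots> = (\<integral>z. W z * (indicator {?a<..<?b} (fst z) * indicator {?c<..<?d} (snd z)) \<partial>MQ)"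
      using Qb by (simp add: integral_restrict_space)
    also have "\<dots> = 0"
    proof (cases "?a < ?b \<and> ?c < ?d")
      case True
      obtain \<alpha> where \<alpha>: "\<And>n. \<alpha> n \<in> C1_compact_support {?a<..<?b}" "\<And>n t. 0 \<le> \<alpha> n t \<and> \<alpha> n t \<le> 1"
        "\<And>t. (\<lambda>n. \<alpha> n t) \<longlonglongrightarrow> indicator {?a<..<?b} t"
        using exists_bumps True by meson
      obtain \<beta> where \<beta>: "\<And>n. \<beta> n \<in> C1_compact_support {?c<..<?d}" "\<And>n t. 0 \<le> \<beta> n t \<and> \<beta> n t \<le> 1"
        "\<And>t. (\<lambda>n. \<beta> n t) \<longlonglongrightarrow> indicator {?c<..<?d} t"
        using exists_bumps True by meson
      have "(\<lambda>n. \<integral>z. W z * (\<alpha> n (fst z) * \<beta> n (snd z)) \<partial>MQ) \<longlonglongrightarrow>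
        (\<integral>z. W z * (indicator {?a<..<?b} (fst z) * indicator {?c<..<?d} (snd z)) \<partial>MQ)"
      proof (rule integral_dominated_convergence)
        show "integrable MQ (\<lambda>z. \<bar>W z\<bar>)" using W by simp
        show "AE z in MQ. (\<lambda>n. W z * (\<alpha> n (fst z) * \<beta> n (snd z))) \<longlonglongrightarrow> W z * (indicator {?a<..<?b} (fst z) * indicator {?c<..<?d} (snd z))"
          by (intro AE_I2 tendsto_intros \<alpha>(3) \<beta>(3))
        show "AE z in MQ. norm (W z * (\<alpha> n (fst z) * \<beta> n (snd z))) \<le> \<bar>W z\<bar>" for n
          using \<alpha>(2)[of n] \<beta>(2)[of n] by (intro AE_I2) (auto simp: abs_mult intro!: mult_left_le mult_le_one)
        have "(\<lambda>z. W z * (indicator {?a<..<?b} (fst z) * indicator {?c<..<?d} (snd z))) \<in> borel_measurable MQ"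
          by (rule borel_measurable_integrable[OF integrable_test_MQ[OF W]]) (auto simp: indicator_def intro!: exI[of _ 1])
        then show "(\<lambda>z. W z * (indicator {?a<..<?b} (fst z) * indicator {?c<..<?d} (snd z))) \<in> borel_measurable MQ" .
        show "(\<lambda>z. W z * (\<alpha> n (fst z) * \<beta> n (snd z))) \<in> borel_measurable MQ" for n
          by (rule borel_measurable_integrable[OF integrable_test_MQ[OF W C1_real(1)[OF \<alpha>(1)] C1_real(1)[OF \<beta>(1)] C1_real(3)[OF \<alpha>(1)] C1_real(3)[OF \<beta>(1)]]])
      qed
      moreover have "(\<integral>z. W z * (\<alpha> n (fst z) * \<beta> n (snd z)) \<partial>MQ) = 0" for n
        by (rule t) (rule C1_compact_support_mono[OF \<alpha>(1)] C1_compact_support_mono[OF \<beta>(1)], auto)+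
      ultimately show ?thesis by (simp add: LIMSEQ_const_iff)
    next
      case False
      then have "{?a<..<?b} = {} \<or> {?c<..<?d} = {}" by auto
      then show ?thesis by auto
    qed
    finally show "(LINT z:box l u|lborel. indicator Q z *\<^sub>R W z) = 0" .
  qed
  then have "AE z in lborel. z \<in> Q \<longrightarrow> W z = 0" by eventually_elim auto
  then show ?thesis using Qb by (subst AE_restrict_space_iff) auto
qed

text \<open>Test with \<alpha> (s) \<beta> (t) and let \<beta> increase its plateau to fill the
  fibre. The hypothesis involves only derivatives in s, so the derivative of \<beta>, which blows up
  near the ends of the fibre, never appears.\<close>

lemma average_weak_derivative:
  assumes u: "integrable MQ u" and h: "integrable MQ h"
    and weak: "\<And>\<zeta>. \<zeta> \<in> C1_compact_support Q \<Longrightarrow> (\<integral>z. u z * d1 \<zeta> z \<partial>MQ) = - (\<integral>z. h z * \<zeta> z \<partial>MQ)"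
  shows "has_weak_gradient {0<..<L} (\<lambda>s. \<integral>t. u (s, t) \<partial>M1) (\<lambda>s. \<integral>t. h (s, t) \<partial>M1)"
proof -
  obtain \<beta> where \<beta>: "\<And>n. \<beta> n \<in> C1_compact_support {0<..<1::real}" "\<And>n t. 0 \<le> \<beta> n t \<and> \<beta> n t \<le> 1"
    "\<And>t. (\<lambda>n. \<beta> n t) \<longlonglongrightarrow> indicator {0<..<1} t"
    using exists_bumps[of 0 1] by auto
  have lim: "(\<lambda>n. \<integral>z. w z * (f (fst z) * \<beta> n (snd z)) \<partial>MQ) \<longlonglongrightarrow> (\<integral>z. w z * (f (fst z) * 1) \<partial>MQ)"
    if w: "integrable MQ w" and f: "f \<in> borel_measurable borel" "\<exists>C. \<forall>x. \<bar>f x\<bar> \<le> C"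
    for w :: "real \<times> real \<Rightarrow> real" and f :: "real \<Rightarrow> real"
  proof (rule integral_dominated_convergence)
    have i: "integrable MQ (\<lambda>z. w z * (f (fst z) * 1))"
      by (rule integrable_test_MQ[OF w f(1) _ f(2)]) auto
    show "integrable MQ (\<lambda>z. \<bar>w z * (f (fst z) * 1)\<bar>)" using i by simp
    show "(\<lambda>z. w z * (f (fst z) * 1)) \<in> borel_measurable MQ" using i by simp
    show "(\<lambda>z. w z * (f (fst z) * \<beta> n (snd z))) \<in> borel_measurable MQ" for n
      by (rule borel_measurable_integrable[OF integrable_test_MQ[OF w f(1) C1_real(1)[OF \<beta>(1)] f(2) C1_real(3)[OF \<beta>(1)]]])
    show "AE z in MQ. norm (w z * (f (fst z) * \<beta> n (snd z))) \<le> \<bar>w z * (f (fst z) * 1)\<bar>" for n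
      using \<beta>(2)[of n] by (intro AE_I2) (auto simp: abs_mult intro!: mult_left_mono mult_left_le)
    show "AE z in MQ. (\<lambda>n. w z * (f (fst z) * \<beta> n (snd z))) \<longlonglongrightarrow> w z * (f (fst z) * 1)"
    proof (rule AE_I2)
      fix z assume "z \<in> space MQ"
      then have "snd z \<in> {0<..<1}" by (auto simp: space_restrict_space)
      then have "(\<lambda>n. \<beta> n (snd z)) \<longlonglongrightarrow> 1" using \<beta>(3)[of "snd z"] by simp
      then show "(\<lambda>n. w z * (f (fst z) * \<beta> n (snd z))) \<longlonglongrightarrow> w z * (f (fst z) * 1)"
        by (intro tendsto_intros)
    qed
  qed
  have fub: "(\<integral>z. w z * (f (fst z) * 1) \<partial>MQ) = (\<integral>s. (\<integral>t. w (s, t) \<partial>M1) * f s \<partial>MI)"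
    if w: "integrable MQ w" and f: "f \<in> borel_measurable borel" "\<exists>C. \<forall>x. \<bar>f x\<bar> \<le> C"
    for w :: "real \<times> real \<Rightarrow> real" and f :: "real \<Rightarrow> real"
  proof -
    have "integrable MQ (\<lambda>z. w z * (f (fst z) * 1))"
      by (rule integrable_test_MQ[OF w f(1) _ f(2)]) auto
    from Fubini_MQ(3)[OF this] show ?thesis by simp
  qed
  show ?thesis
    unfolding has_weak_gradient_real[OF borel_open[OF open_greaterThanLessThan]]
  proof
    fix \<alpha> assume \<alpha>: "\<alpha> \<in> C1_compact_support {0<..<L}"
    note P = C1_compact_support_product[OF open_greaterThanLessThan open_greaterThanLessThan \<alpha> \<beta>(1)]
    have "(\<integral>z. u z * (dr \<alpha> (fst z) * \<beta> n (snd z)) \<partial>MQ) = - (\<integral>z. h z * (\<alpha> (fst z) * \<beta> n (snd z)) \<partial>MQ)" for n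
    proof -
      have "(\<integral>z. u z * (dr \<alpha> (fst z) * \<beta> n (snd z)) \<partial>MQ) = (\<integral>z. u z * d1 (\<lambda>z. \<alpha> (fst z) * \<beta> n (snd z)) z \<partial>MQ)"
        by (intro Bochner_Integration.integral_cong refl) (metis P(2) prod.collapse)
      then show ?thesis using weak[OF P(1)] by simp
    qed
    then have "(\<lambda>n. \<integral>z. u z * (dr \<alpha> (fst z) * \<beta> n (snd z)) \<partial>MQ) \<longlonglongrightarrow> - (\<integral>z. h z * (\<alpha> (fst z) * 1) \<partial>MQ)"
      using tendsto_minus[OF lim[OF h C1_real(1)[OF \<alpha>] C1_real(3)[OF \<alpha>]]] by simp
    from LIMSEQ_unique[OF this lim[OF u C1_real(2)[OF \<alpha>] C1_real(4)[OF \<alpha>]]]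
    show "(\<integral>s. (\<integral>t. u (s, t) \<partial>M1) * dr \<alpha> s \<partial>MI) = - (\<integral>s. (\<integral>t. h (s, t) \<partial>M1) * \<alpha> s \<partial>MI)"
      using fub[OF u C1_real(2)[OF \<alpha>] C1_real(4)[OF \<alpha>]] fub[OF h C1_real(1)[OF \<alpha>] C1_real(3)[OF \<alpha>]] by simp
  qed
qed

text \<open>Fubini's theorem on the triangle \<tau> < t. It exchanges the primitive of the test
  function for the tail integral of \<open>g\<close>, an integration by parts that differentiates
  neither.\<close>

lemma integral_mult_primitive:
  fixes g f :: "real \<Rightarrow> real"
  assumes g: "integrable M1 g" and f[measurable]: "f \<in> borel_measurable borel" and C: "\<exists>C. \<forall>x. \<bar>f x\<bar> \<le> C"
  shows "(\<integral>t. g t * (\<integral>\<tau>. indicator {..<t} \<tau> * f \<tau> \<partial>M1) \<partial>M1) = (\<integral>\<tau>. f \<tau> * (\<integral>t. indicator {\<tau><..} t * g t \<partial>M1) \<partial>M1)"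
proof -
  interpret P: pair_sigma_finite M1 M1 ..
  obtain C where C: "\<And>x. \<bar>f x\<bar> \<le> C" using C by blast
  have [measurable]: "(\<lambda>x. x) \<in> borel_measurable M1" by (intro measurable_restrict_space1) simp
  have [measurable]: "f \<in> borel_measurable M1" "g \<in> borel_measurable M1"
    using g by (auto intro: borel_measurable_restrict_lborelI)
  have [measurable]: "fst \<in> borel_measurable (M1 \<Otimes>\<^sub>M M1)" "snd \<in> borel_measurable (M1 \<Otimes>\<^sub>M M1)"
    by (rule measurable_compose[OF measurable_fst, of "\<lambda>x. x"], simp)
      (rule measurable_compose[OF measurable_snd, of "\<lambda>x. x"], simp)
  have int: "integrable (M1 \<Otimes>\<^sub>M M1) (\<lambda>z. if fst z < snd z then f (fst z) * g (snd z) else 0)"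
  proof (rule Bochner_Integration.integrable_bound)
    show "integrable (M1 \<Otimes>\<^sub>M M1) (\<lambda>z. C * g (snd z))"
    proof (rule P.Fubini_integrable)
      show "AE x in M1. integrable M1 (\<lambda>y. C * g (snd (x, y)))" using g by simp
      show "integrable M1 (\<lambda>x. \<integral>y. norm (C * g (snd (x, y))) \<partial>M1)" by simp
    qed simp
    show "AE z in M1 \<Otimes>\<^sub>M M1. norm (if fst z < snd z then f (fst z) * g (snd z) else 0) \<le> norm (C * g (snd z))"
    proof (rule AE_I2)
      fix z :: "real \<times> real"
      have "\<bar>f (fst z)\<bar> \<le> \<bar>C\<bar>" using C[of "fst z"] by linarith
      then show "norm (if fst z < snd z then f (fst z) * g (snd z) else 0) \<le> norm (C * g (snd z))"
        by (auto simp: abs_mult intro: mult_right_mono)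
    qed
  qed measurable
  have "(\<integral>t. g t * (\<integral>\<tau>. indicator {..<t} \<tau> * f \<tau> \<partial>M1) \<partial>M1) = (\<integral>t. (\<integral>\<tau>. (if \<tau> < t then f \<tau> * g t else 0) \<partial>M1) \<partial>M1)"
    by (intro Bochner_Integration.integral_cong refl, subst integral_mult_right_zero[symmetric],
        intro Bochner_Integration.integral_cong refl) (auto simp: indicator_def)
  also have "\<dots> = (\<integral>\<tau>. (\<integral>t. (if \<tau> < t then f \<tau> * g t else 0) \<partial>M1) \<partial>M1)"
    by (rule P.Fubini_integral) (use int in \<open>simp add: case_prod_unfold if_distrib cong: if_cong\<close>)
  also have "\<dots> = (\<integral>\<tau>. f \<tau> * (\<integral>t. indicator {\<tau><..} t * g t \<partial>M1) \<partial>M1)"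
    by (intro Bochner_Integration.integral_cong refl, subst integral_mult_right_zero[symmetric],
        intro Bochner_Integration.integral_cong refl) (auto simp: indicator_def)
  finally show ?thesis .
qed

text \<open>Adding to \<open>u\<close> the tail integrals \<open>H\<close> of \<open>h\<close> along the fibres cancels the weak fibre derivative, so
  the sum depends on the first coordinate only.\<close>

lemma slice_oscillation:
  assumes u: "integrable MQ u" and h: "integrable MQ h"
    and weak: "\<And>\<zeta>. \<zeta> \<in> C1_compact_support Q \<Longrightarrow> (\<integral>z. u z * d2 \<zeta> z \<partial>MQ) = - (\<integral>z. h z * \<zeta> z \<partial>MQ)"
  shows "AE z in MQ. \<bar>u z - (\<integral>t. u (fst z, t) \<partial>M1)\<bar> \<le> (\<integral>t. \<bar>h (fst z, t)\<bar> \<partial>M1)"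
proof -
  have um[measurable]: "u \<in> borel_measurable MQ" and hm[measurable]: "h \<in> borel_measurable MQ" using u h by auto
  define H where "H z = (\<integral>t. indicator {snd z<..} t * h (fst z, t) \<partial>M1)" for z
  define hb where "hb s = (\<integral>t. \<bar>h (s, t)\<bar> \<partial>M1)" for s
  have id1: "(\<lambda>x. x) \<in> borel_measurable M1" by (intro measurable_restrict_space1) simp
  have Hm[measurable]: "H \<in> borel_measurable MQ"
  proof -
    have 1: "(\<lambda>x. snd (fst x)) \<in> borel_measurable (MQ \<Otimes>\<^sub>M M1)" "(\<lambda>x. snd x) \<in> borel_measurable (MQ \<Otimes>\<^sub>M M1)"
      by (rule measurable_compose[OF measurable_compose[OF measurable_fst measurable_snd_MQ] id1])
        (rule measurable_compose[OF measurable_snd id1])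
    have "(\<lambda>x. (fst (fst x), snd x)) \<in> measurable (MQ \<Otimes>\<^sub>M M1) (MI \<Otimes>\<^sub>M M1)"
      by (intro measurable_Pair measurable_compose[OF measurable_fst measurable_fst_MQ] measurable_snd)
    from measurable_compose[OF this hm[unfolded MQ_eq]]
    have 2: "(\<lambda>x. h (fst (fst x), snd x)) \<in> borel_measurable (MQ \<Otimes>\<^sub>M M1)" by simp
    have "(\<lambda>x. if snd (fst x) < snd x then h (fst (fst x), snd x) else 0) \<in> borel_measurable (MQ \<Otimes>\<^sub>M M1)"
      using 1 2 by measurable
    then have "(\<lambda>z. \<integral>t. (if snd z < t then h (fst z, t) else 0) \<partial>M1) \<in> borel_measurable MQ"
      by (intro M1.borel_measurable_lebesgue_integral) (simp add: case_prod_unfold)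
    also have "(\<lambda>z. \<integral>t. (if snd z < t then h (fst z, t) else 0) \<partial>M1) = H"
      unfolding H_def by (intro ext Bochner_Integration.integral_cong refl) (auto simp: indicator_def)
    finally show ?thesis .
  qed
  have hbi: "integrable MI hb"
    unfolding hb_def using Fubini_MQ(2)[of "\<lambda>z. \<bar>h z\<bar>"] h by simp
  have hbm[measurable]: "(\<lambda>z. hb (fst z)) \<in> borel_measurable MQ"
    using integrable_fst_MQ(1)[OF hbi] by simp
  have good: "AE s in MI. s \<in> {0<..<L} \<and> integrable M1 (\<lambda>t. u (s, t)) \<and> integrable M1 (\<lambda>t. h (s, t))"
    using Fubini_MQ(1)[OF u] Fubini_MQ(1)[OF h] AE_space[of MI] by eventually_elim (simp add: space_restrict_space)
  have tail: "integrable M1 (\<lambda>t. indicator {\<tau><..} t * h (s, t))" if "integrable M1 (\<lambda>t. h (s, t))" for s \<tau>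
    using integrable_mult_bounded[OF that, of "indicator {\<tau><..}"]
    by (simp add: mult.commute borel_measurable_restrict_lborelI indicator_def[abs_def] exI[of _ 1] cong: if_cong)
  have Hle: "\<bar>H (s, t)\<bar> \<le> hb s" if "integrable M1 (\<lambda>t. h (s, t))" for s t
  proof -
    have "\<bar>H (s, t)\<bar> \<le> (\<integral>\<tau>. \<bar>indicator {t<..} \<tau> * h (s, \<tau>)\<bar> \<partial>M1)"
      unfolding H_def fst_conv snd_conv by (rule integral_abs_bound)
    also have "\<dots> \<le> hb s"
      unfolding hb_def using tail[OF that] that
      by (intro integral_mono) (auto simp: indicator_def)
    finally show ?thesis .
  qed
  have Hdiff: "\<bar>H (s, t) - H (s, \<tau>)\<bar> \<le> hb s" if i: "integrable M1 (\<lambda>t. h (s, t))" for s t \<tau>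
  proof -
    have "H (s, t) - H (s, \<tau>) = (\<integral>r. indicator {t<..} r * h (s, r) - indicator {\<tau><..} r * h (s, r) \<partial>M1)"
      unfolding H_def fst_conv snd_conv using tail[OF i] by simp
    also have "\<bar>\<dots>\<bar> \<le> (\<integral>r. \<bar>indicator {t<..} r * h (s, r) - indicator {\<tau><..} r * h (s, r)\<bar> \<partial>M1)"
      by (rule integral_abs_bound)
    also have "\<dots> \<le> hb s"
      unfolding hb_def using tail[OF i] i
      by (intro integral_mono) (auto simp: indicator_def)
    finally show ?thesis .
  qed
  have Hi: "integrable MQ H"
  proof (rule Bochner_Integration.integrable_bound[OF integrable_fst_MQ(1)[OF hbi]])
    show "AE z in MQ. norm (H z) \<le> norm (hb (fst z))"
    proof (rule AE_MQ_I)
      show "AE s in MI. AE t in M1. norm (H (s, t)) \<le> norm (hb (fst (s, t)))"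
        using good
      proof eventually_elim
        case (elim s)
        then show ?case using Hle[of s] by (intro AE_I2) (auto intro: order_trans[OF _ abs_ge_self])
      qed
    qed measurable
  qed simp
  define G where "G z = u z + H z" for z
  have Gi: "integrable MQ G" unfolding G_def using u Hi by simp
  \<comment> \<open>A mean-zero \<open>f\<close> has a compactly supported primitive \<beta>.
    Testing \<open>u\<close> with the product of \<alpha> and \<beta> gives minus the integral of
    \<open>h\<close> against it, and exchanging the primitive for the tail makes this minus the
    integral of \<open>H\<close> against \<alpha> f.\<close>
  have key: "(\<integral>z. G z * (\<alpha> (fst z) * f (snd z)) \<partial>MQ) = 0"
    if \<alpha>: "\<alpha> \<in> C1_compact_support {0<..<L}" and f: "f \<in> C1_compact_support {0<..<1}" and f0: "(\<integral>t. f t \<partial>lborel) = 0" for \<alpha> f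
  proof -
    obtain \<beta> where \<beta>: "\<beta> \<in> C1_compact_support {0<..<1}" "\<And>t. t \<in> {0<..<1} \<Longrightarrow> dr \<beta> t = f t"
      "\<And>t. t \<in> {0<..<1} \<Longrightarrow> \<beta> t = (\<integral>\<tau>. indicator {..<t} \<tau> * f \<tau> \<partial>lborel)"
      using C1_compact_support_primitive[OF f f0] by blast
    obtain K where K: "K \<subseteq> {0<..<1}" "\<And>x. x \<notin> K \<Longrightarrow> f x = 0"
      using C1_compact_support_obtain[OF f] by blast
    have f_out: "f x = 0" if "x \<notin> {0<..<1}" for x using K that by blast
    have \<beta>3: "\<beta> t = (\<integral>\<tau>. indicator {..<t} \<tau> * f \<tau> \<partial>M1)" if "t \<in> {0<..<1}" for t
    proof -
      have "(\<integral>\<tau>. indicator {..<t} \<tau> * f \<tau> \<partial>M1) = (\<integral>\<tau>. indicator {0<..<1} \<tau> *\<^sub>R (indicator {..<t} \<tau> * f \<tau>) \<partial>lborel)"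
        by (rule integral_restrict_space) simp
      also have "\<dots> = \<beta> t" unfolding \<beta>(3)[OF that]
      proof (intro Bochner_Integration.integral_cong refl)
        fix x show "indicator {0<..<1} x *\<^sub>R (indicator {..<t} x * f x) = indicator {..<t} x * f x"
          using f_out[of x] by (cases "x \<in> {0<..<1}") auto
      qed
      finally show ?thesis by simp
    qed
    note P = C1_compact_support_product[OF open_greaterThanLessThan open_greaterThanLessThan \<alpha> \<beta>(1)]
    note A = C1_real[OF \<alpha>] and B = C1_real[OF \<beta>(1)] and F = C1_real[OF f]
    have "(\<integral>z. u z * (\<alpha> (fst z) * f (snd z)) \<partial>MQ) = (\<integral>z. u z * d2 (\<lambda>z. \<alpha> (fst z) * \<beta> (snd z)) z \<partial>MQ)"
    proof (intro Bochner_Integration.integral_cong refl)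
      fix z assume "z \<in> space MQ"
      then have "snd z \<in> {0<..<1}" by (auto simp: space_restrict_space)
      then show "u z * (\<alpha> (fst z) * f (snd z)) = u z * d2 (\<lambda>z. \<alpha> (fst z) * \<beta> (snd z)) z"
        using P(3)[of "fst z" "snd z"] \<beta>(2)[of "snd z"] by simp
    qed
    also have "\<dots> = - (\<integral>z. h z * (\<alpha> (fst z) * \<beta> (snd z)) \<partial>MQ)" by (rule weak[OF P(1)])
    also have "(\<integral>z. h z * (\<alpha> (fst z) * \<beta> (snd z)) \<partial>MQ) = (\<integral>s. (\<integral>t. h (s, t) * (\<alpha> s * \<beta> t) \<partial>M1) \<partial>MI)"
      using Fubini_MQ(3)[OF integrable_test_MQ[OF h A(1) B(1) A(3) B(3)]] by simp
    also have "\<dots> = (\<integral>s. (\<integral>t. H (s, t) * (\<alpha> s * f t) \<partial>M1) \<partial>MI)"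
    proof (rule integral_cong_AE)
      show "AE s in MI. (\<integral>t. h (s, t) * (\<alpha> s * \<beta> t) \<partial>M1) = (\<integral>t. H (s, t) * (\<alpha> s * f t) \<partial>M1)"
        using good
      proof eventually_elim
        case (elim s)
        have "(\<integral>t. h (s, t) * (\<alpha> s * \<beta> t) \<partial>M1) = (\<integral>t. \<alpha> s * (h (s, t) * (\<integral>\<tau>. indicator {..<t} \<tau> * f \<tau> \<partial>M1)) \<partial>M1)"
          by (intro Bochner_Integration.integral_cong refl) (simp add: \<beta>3 space_restrict_space)
        also have "\<dots> = \<alpha> s * (\<integral>\<tau>. f \<tau> * (\<integral>t. indicator {\<tau><..} t * h (s, t) \<partial>M1) \<partial>M1)"
          using integral_mult_primitive[OF _ F(1) F(3), of "\<lambda>t. h (s, t)"] elim by simp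
        also have "\<dots> = (\<integral>t. \<alpha> s * (f t * H (s, t)) \<partial>M1)" unfolding H_def fst_conv snd_conv by simp
        also have "\<dots> = (\<integral>t. H (s, t) * (\<alpha> s * f t) \<partial>M1)"
          by (intro Bochner_Integration.integral_cong refl) simp
        finally show ?case .
      qed
      show "(\<lambda>s. \<integral>t. h (s, t) * (\<alpha> s * \<beta> t) \<partial>M1) \<in> borel_measurable MI"
        using measurable_average[OF borel_measurable_integrable[OF integrable_test_MQ[OF h A(1) B(1) A(3) B(3)]]] by simp
      show "(\<lambda>s. \<integral>t. H (s, t) * (\<alpha> s * f t) \<partial>M1) \<in> borel_measurable MI"
        using measurable_average[OF borel_measurable_integrable[OF integrable_test_MQ[OF Hi A(1) F(1) A(3) F(3)]]] by simp
    qed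
    also have "\<dots> = (\<integral>z. H z * (\<alpha> (fst z) * f (snd z)) \<partial>MQ)"
      using Fubini_MQ(3)[OF integrable_test_MQ[OF Hi A(1) F(1) A(3) F(3)]] by simp
    finally show ?thesis
      unfolding G_def using integrable_test_MQ[OF Hi A(1) F(1) A(3) F(3)] integrable_test_MQ[OF u A(1) F(1) A(3) F(3)]
      by (simp add: distrib_right)
  qed
  \<comment> \<open>A fixed test function of nonzero mean: subtracting a multiple of it makes an
    arbitrary test function mean-zero, as \<open>key\<close> requires.\<close>
  obtain \<eta> where \<eta>: "\<eta> \<in> C1_compact_support {0<..<1::real}" and \<eta>pos: "(\<integral>t. \<eta> t \<partial>lborel) > 0"
  proof -
    obtain \<beta> where \<beta>: "\<And>n. \<beta> n \<in> C1_compact_support {0<..<1::real}" "\<And>n t. 0 \<le> \<beta> n t \<and> \<beta> n t \<le> 1"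
      "\<And>t. (\<lambda>n. \<beta> n t) \<longlonglongrightarrow> indicator {0<..<1} t"
      using exists_bumps[of 0 1] by auto
    have "(\<lambda>n. \<integral>t. \<beta> n t \<partial>lborel) \<longlonglongrightarrow> (\<integral>t. indicator {0<..<1::real} t \<partial>lborel)"
    proof (rule integral_dominated_convergence)
      show "integrable lborel (indicator {0<..<1::real} :: real \<Rightarrow> real)" by simp
      show "AE t in lborel. norm (\<beta> n t) \<le> indicator {0<..<1} t" for n
      proof (rule AE_I2)
        fix t
        obtain K where K: "K \<subseteq> {0<..<1}" "\<And>x. x \<notin> K \<Longrightarrow> \<beta> n x = 0"
          using C1_compact_support_obtain[OF \<beta>(1)] by blast
        have "\<beta> n t = 0" if "t \<notin> {0<..<1}" using K that by blast
        then show "norm (\<beta> n t) \<le> indicator {0<..<1} t"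
          using \<beta>(2)[of n t] by (cases "t \<in> {0<..<1}") auto
      qed
      show "\<beta> n \<in> borel_measurable lborel" for n using C1_real(1)[OF \<beta>(1)] by simp
    qed (use \<beta>(3) in auto)
    then have "(\<lambda>n. \<integral>t. \<beta> n t \<partial>lborel) \<longlonglongrightarrow> 1" by simp
    then have "\<forall>\<^sub>F n in sequentially. (\<integral>t. \<beta> n t \<partial>lborel) > 0" by (rule order_tendstoD) simp
    then obtain n where "(\<integral>t. \<beta> n t \<partial>lborel) > 0" by (auto simp: eventually_sequentially)
    then show ?thesis using that \<beta>(1) by blast
  qed
  note E = C1_real[OF \<eta>]
  define e where "e = (\<integral>t. \<eta> t \<partial>lborel)"
  have M1_lborel: "(\<integral>t. f t \<partial>M1) = (\<integral>t. f t \<partial>lborel)" and int_lborel: "integrable lborel f" if fC: "f \<in> C1_compact_support {0<..<1}" for f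
  proof -
    obtain K where K: "K \<subseteq> {0<..<1}" "\<And>x. x \<notin> K \<Longrightarrow> f x = 0"
      using C1_compact_support_obtain[OF fC] by blast
    have *: "(\<lambda>t. indicator {0<..<1} t *\<^sub>R f t) = f"
    proof
      fix t show "indicator {0<..<1} t *\<^sub>R f t = f t"
        using K(1) K(2)[of t] by (cases "t \<in> {0<..<1}"; cases "t \<in> K") auto
    qed
    have "(\<integral>t. f t \<partial>M1) = (\<integral>t. indicator {0<..<1} t *\<^sub>R f t \<partial>lborel)" by (rule integral_restrict_space) simp
    then show "(\<integral>t. f t \<partial>M1) = (\<integral>t. f t \<partial>lborel)" by (simp only: *)
    have "integrable M1 f"
      using integrable_mult_bounded[of M1 "\<lambda>_. 1" f] C1_real(1,3)[OF fC] by (simp add: borel_measurable_restrict_lborelI)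
    then have "integrable lborel (\<lambda>t. indicator {0<..<1} t *\<^sub>R f t)" by (subst (asm) integrable_restrict_space) auto
    then show "integrable lborel f" by (simp only: *)
  qed
  \<comment> \<open>Once \<open>G\<close> is constant on a fibre, this weighted fibre mean has to be
    its value. Proving that \<open>G\<close> equals \<open>c\<close> is the du Bois-Reymond argument
    with s as a parameter.\<close>
  define c where "c s = (\<integral>\<tau>. G (s, \<tau>) * \<eta> \<tau> \<partial>M1) / e" for s
  have ci: "integrable MI c"
  proof -
    have "integrable MQ (\<lambda>z. G z * (1 * \<eta> (snd z)))"
      by (rule integrable_test_MQ[OF Gi _ E(1) _ E(3), of "\<lambda>_. 1"]) auto
    from Fubini_MQ(2)[OF this] show ?thesis unfolding c_def by simp
  qed
  have W: "AE z in MQ. G z - c (fst z) = 0"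
  proof (rule zero_if_product_tests_zero)
    show "integrable MQ (\<lambda>z. G z - c (fst z))" using Gi integrable_fst_MQ(1)[OF ci] by simp
    fix \<alpha> f :: "real \<Rightarrow> real" assume \<alpha>: "\<alpha> \<in> C1_compact_support {0<..<L}" and f: "f \<in> C1_compact_support {0<..<1}"
    note A = C1_real[OF \<alpha>] and F = C1_real[OF f]
    define k where "k = (\<integral>t. f t \<partial>lborel) / e"
    have fk: "(\<lambda>t. f t - k * \<eta> t) \<in> C1_compact_support {0<..<1}"
      by (rule C1_compact_support_real_diff[OF _ f \<eta>]) simp
    have "(\<integral>t. f t - k * \<eta> t \<partial>lborel) = 0"
      using int_lborel[OF f] int_lborel[OF \<eta>] \<eta>pos by (simp add: k_def e_def)
    from key[OF \<alpha> fk this]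
    have "(\<integral>z. G z * (\<alpha> (fst z) * f (snd z)) - k * (G z * (\<alpha> (fst z) * \<eta> (snd z))) \<partial>MQ) = 0"
      by (simp add: algebra_simps)
    then have 1: "(\<integral>z. G z * (\<alpha> (fst z) * f (snd z)) \<partial>MQ) = k * (\<integral>z. G z * (\<alpha> (fst z) * \<eta> (snd z)) \<partial>MQ)"
      using integrable_test_MQ[OF Gi A(1) F(1) A(3) F(3)] integrable_test_MQ[OF Gi A(1) E(1) A(3) E(3)] by simp
    note cf = integrable_test_MQ[OF integrable_fst_MQ(1)[OF ci] A(1) F(1) A(3) F(3)]
    have "(\<integral>z. c (fst z) * (\<alpha> (fst z) * f (snd z)) \<partial>MQ) = (\<integral>s. c s * \<alpha> s * (\<integral>t. f t \<partial>M1) \<partial>MI)"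
      using Fubini_MQ(3)[OF cf] by (simp add: mult.assoc[symmetric])
    also have "\<dots> = (\<integral>s. k * (\<integral>\<tau>. G (s, \<tau>) * (\<alpha> s * \<eta> \<tau>) \<partial>M1) \<partial>MI)"
    proof (intro Bochner_Integration.integral_cong refl)
      fix s
      have "(\<integral>\<tau>. G (s, \<tau>) * (\<alpha> s * \<eta> \<tau>) \<partial>M1) = \<alpha> s * (\<integral>\<tau>. G (s, \<tau>) * \<eta> \<tau> \<partial>M1)"
        by (subst integral_mult_right_zero[symmetric]) (simp add: algebra_simps)
      then show "c s * \<alpha> s * (\<integral>t. f t \<partial>M1) = k * (\<integral>\<tau>. G (s, \<tau>) * (\<alpha> s * \<eta> \<tau>) \<partial>M1)"
        by (simp add: c_def k_def M1_lborel[OF f])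
    qed
    also have "\<dots> = k * (\<integral>z. G z * (\<alpha> (fst z) * \<eta> (snd z)) \<partial>MQ)"
      using Fubini_MQ(3)[OF integrable_test_MQ[OF Gi A(1) E(1) A(3) E(3)]] by simp
    finally have 2: "(\<integral>z. c (fst z) * (\<alpha> (fst z) * f (snd z)) \<partial>MQ) = k * (\<integral>z. G z * (\<alpha> (fst z) * \<eta> (snd z)) \<partial>MQ)" .
    show "(\<integral>z. (G z - c (fst z)) * (\<alpha> (fst z) * f (snd z)) \<partial>MQ) = 0"
      using 1 2 cf integrable_test_MQ[OF Gi A(1) F(1) A(3) F(3)] by (simp add: left_diff_distrib)
  qed
  show ?thesis
  proof (rule AE_MQ_I)
    show "AE s in MI. AE t in M1. \<bar>u (s, t) - (\<integral>r. u (fst (s, t), r) \<partial>M1)\<bar> \<le> (\<integral>r. \<bar>h (fst (s, t), r)\<bar> \<partial>M1)"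
      using AE_MQ_D[OF W] good
    proof eventually_elim
      case (elim s)
      then have s: "s \<in> {0<..<L}" and ui: "integrable M1 (\<lambda>t. u (s, t))" and hi: "integrable M1 (\<lambda>t. h (s, t))"
        and eq: "AE t in M1. u (s, t) = c s - H (s, t)" by (auto simp: G_def algebra_simps elim!: eventually_mono)
      have Hsm[measurable]: "(\<lambda>t. H (s, t)) \<in> borel_measurable M1" by (rule measurable_slice[OF Hm s])
      have Hsi: "integrable M1 (\<lambda>t. H (s, t))"
        by (rule M1.integrable_const_bound[of _ "hb s"]) (use Hle[OF hi] in auto)
      have usm[measurable]: "(\<lambda>t. u (s, t)) \<in> borel_measurable M1" using ui by simp
      have ub: "(\<integral>r. u (s, r) \<partial>M1) = c s - (\<integral>r. H (s, r) \<partial>M1)"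
      proof -
        have "(\<integral>r. u (s, r) \<partial>M1) = (\<integral>r. c s - H (s, r) \<partial>M1)" using eq by (intro integral_cong_AE) auto
        then show ?thesis using Hsi measure_M1 by simp
      qed
      show ?case using eq
      proof eventually_elim
        case (elim t)
        \<comment> \<open>The unknown constant \<open>c s\<close> cancels between \<open>u\<close>
          and its average. What remains is an average of differences of tail integrals, each at most
          the integral of |h| over the fibre.\<close>
        have "u (s, t) - (\<integral>r. u (s, r) \<partial>M1) = (\<integral>r. H (s, r) - H (s, t) \<partial>M1)"
          using elim ub Hsi measure_M1 by simp
        also have "\<bar>\<dots>\<bar> \<le> (\<integral>r. \<bar>H (s, r) - H (s, t)\<bar> \<partial>M1)" by (rule integral_abs_bound)
        also have "\<dots> \<le> (\<integral>r. hb s \<partial>M1)"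
          using Hsi by (intro integral_mono Hdiff[OF hi]) auto
        finally show ?case using measure_M1 by (simp add: hb_def)
      qed
    qed
    have [measurable]: "(\<lambda>z. \<integral>t. u (fst z, t) \<partial>M1) \<in> borel_measurable MQ"
      by (rule measurable_compose[OF measurable_fst_MQ measurable_average[OF um]])
    show "{z \<in> space MQ. \<bar>u z - (\<integral>t. u (fst z, t) \<partial>M1)\<bar> \<le> (\<integral>t. \<bar>h (fst z, t)\<bar> \<partial>M1)} \<in> sets MQ"
      using hbm unfolding hb_def by measurable
  qed
qed

end

section \<open>The two eigenvalue comparisons\<close>

lemma C1_compact_support_slice:
  assumes \<zeta>: "\<zeta> \<in> C1_compact_support (I \<times> J :: (real \<times> real) set)" and I: "open I" and J: "open J"
  shows "(\<lambda>s. \<zeta> (s, t)) \<in> C1_compact_support I" "dr (\<lambda>s. \<zeta> (s, t)) s = d1 \<zeta> (s, t)"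
    "(\<lambda>t. \<zeta> (s, t)) \<in> C1_compact_support J" "dr (\<lambda>t. \<zeta> (s, t)) t = d2 \<zeta> (s, t)"
proof -
  obtain K where K: "compact K" "K \<subseteq> I \<times> J" "\<And>x. x \<notin> K \<Longrightarrow> \<zeta> x = 0"
    using C1_compact_support_obtain[OF \<zeta>] by blast
  have d: "(\<zeta> has_derivative (\<lambda>h. fst h * d1 \<zeta> z + snd h * d2 \<zeta> z)) (at z)" for z
    using C1_compact_support_has_derivative[OF \<zeta>, of z]
    by (subst (asm) frechet_derivative_real_pair[OF \<zeta>, abs_def])
  have a: "((\<lambda>s. \<zeta> (s, t)) has_real_derivative d1 \<zeta> (s, t)) (at s)" for s t
  proof -
    have "((\<lambda>s. (s, t)) has_derivative (\<lambda>h. (h, 0))) (at s)" by (auto intro!: derivative_eq_intros)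
    from has_derivative_compose[OF this d] show ?thesis
      by (simp add: has_field_derivative_def mult.commute[of _ "d1 \<zeta> (s, t)"])
  qed
  have b: "((\<lambda>t. \<zeta> (s, t)) has_real_derivative d2 \<zeta> (s, t)) (at t)" for s t
  proof -
    have "((\<lambda>t. (s, t)) has_derivative (\<lambda>h. (0, h))) (at t)" by (auto intro!: derivative_eq_intros)
    from has_derivative_compose[OF this d] show ?thesis
      by (simp add: has_field_derivative_def mult.commute[of _ "d2 \<zeta> (s, t)"])
  qed
  have B: "(1, 0) \<in> (Basis :: (real \<times> real) set)" "(0, 1) \<in> (Basis :: (real \<times> real) set)"
    by (simp_all add: Basis_real_pair)
  have c: "continuous_on S (\<lambda>s. d1 \<zeta> (s, t))" "continuous_on S (\<lambda>t. d2 \<zeta> (s, t))" for S s t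
    by (rule continuous_on_compose2[OF C1_compact_support_continuous_deriv[OF \<zeta> B(1)]]
        continuous_on_compose2[OF C1_compact_support_continuous_deriv[OF \<zeta> B(2)]], intro continuous_intros, simp)+
  have cK: "compact (fst ` K)" "compact (snd ` K)"
    using K(1) by (auto intro!: compact_continuous_image continuous_intros)
  have sK: "fst ` K \<subseteq> I" "snd ` K \<subseteq> J" using K(2) by auto
  have z1: "\<zeta> (s, t) = 0" if "s \<notin> fst ` K" for s t
  proof (rule K(3))
    show "(s, t) \<notin> K" using that by force
  qed
  have z2: "\<zeta> (s, t) = 0" if "t \<notin> snd ` K" for s t
  proof (rule K(3))
    show "(s, t) \<notin> K" using that by force
  qed
  show "(\<lambda>s. \<zeta> (s, t)) \<in> C1_compact_support I" by (rule C1_realI(1)[OF I cK(1) sK(1) a c(1) z1])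
  show "(\<lambda>t. \<zeta> (s, t)) \<in> C1_compact_support J" by (rule C1_realI(1)[OF J cK(2) sK(2) b c(2) z2])
  show "dr (\<lambda>s. \<zeta> (s, t)) s = d1 \<zeta> (s, t)"
    using fun_cong[OF frechet_derivative_at[OF a[of t s, unfolded has_field_derivative_def], symmetric], of 1] by simp
  show "dr (\<lambda>t. \<zeta> (s, t)) t = d2 \<zeta> (s, t)"
    using fun_cong[OF frechet_derivative_at[OF b[of s t, unfolded has_field_derivative_def], symmetric], of 1] by simp
qed

context slicing
begin

lemma integral_MQ_snd:
  fixes f :: "real \<times> real \<Rightarrow> real"
  assumes "integrable MQ f"
  shows "(\<integral>z. f z \<partial>MQ) = (\<integral>t. (\<integral>s. f (s, t) \<partial>MI) \<partial>M1)"
  using integral_snd[of "\<lambda>s t. f (s, t)"] assms unfolding MQ_eq by simp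

text \<open>For fixed t a test function on the rectangle restricts to a test function in s, which
  gives the first component by Fubini; for fixed s its derivative in t integrates to zero, which
  gives the second.\<close>

lemma weak_gradient_fst:
  assumes v: "integrable MI v" and g: "integrable MI g" and wg: "has_weak_gradient {0<..<L} v g"
  shows "has_weak_gradient Q (\<lambda>z. v (fst z)) (\<lambda>z. (g (fst z), 0))"
  unfolding has_weak_gradient_real_pair[OF borel_open[OF open_Q]]
proof (intro ballI conjI)
  fix \<zeta> assume \<zeta>: "\<zeta> \<in> C1_compact_support Q"
  note S = C1_compact_support_slice[OF \<zeta> open_greaterThanLessThan open_greaterThanLessThan]
  note C = C1_real_pair[OF \<zeta>]
  note R = C(1-3)[THEN borel_measurable_restrict_lborelI]
  note vQ = integrable_fst_MQ(1)[OF v] and gQ = integrable_fst_MQ(1)[OF g]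
  note i1 = integrable_mult_bounded[OF vQ R(2) C(5)]
  note i2 = integrable_mult_bounded[OF vQ R(3) C(6)]
  note i3 = integrable_mult_bounded[OF gQ R(1) C(4)]
  have "(\<integral>z. v (fst z) * d1 \<zeta> z \<partial>MQ) = (\<integral>t. (\<integral>s. v s * dr (\<lambda>s. \<zeta> (s, t)) s \<partial>MI) \<partial>M1)"
    using integral_MQ_snd[OF i1] by (simp add: S)
  also have "\<dots> = (\<integral>t. - (\<integral>s. g s * \<zeta> (s, t) \<partial>MI) \<partial>M1)"
    using wg S(1) unfolding has_weak_gradient_real[OF borel_open[OF open_greaterThanLessThan]] by simp
  also have "\<dots> = - (\<integral>z. g (fst z) * \<zeta> z \<partial>MQ)" using integral_MQ_snd[OF i3] by simp
  finally show "(\<integral>z. v (fst z) * d1 \<zeta> z \<partial>MQ) = - (\<integral>z. fst (g (fst z), 0) * \<zeta> z \<partial>MQ)" by simp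
  have "(\<integral>t. d2 \<zeta> (s, t) \<partial>M1) = 0" for s
  proof -
    obtain K where K: "K \<subseteq> {0<..<1}" "\<And>x. x \<notin> K \<Longrightarrow> frechet_derivative (\<lambda>t. \<zeta> (s, t)) (at x) = (\<lambda>_. 0)"
      using C1_compact_support_obtain[OF S(3)[of s]] by blast
    have "(\<integral>t. dr (\<lambda>t. \<zeta> (s, t)) t \<partial>M1) = (\<integral>t. indicator {0<..<1} t *\<^sub>R dr (\<lambda>t. \<zeta> (s, t)) t \<partial>lborel)"
      by (rule integral_restrict_space) simp
    also have "(\<lambda>t. indicator {0<..<1} t *\<^sub>R dr (\<lambda>t. \<zeta> (s, t)) t) = dr (\<lambda>t. \<zeta> (s, t))"
    proof
      fix t show "indicator {0<..<1} t *\<^sub>R dr (\<lambda>t. \<zeta> (s, t)) t = dr (\<lambda>t. \<zeta> (s, t)) t"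
        using K(1) K(2)[of t] by (cases "t \<in> {0<..<1}"; cases "t \<in> K") auto
    qed
    also have "(\<integral>t. dr (\<lambda>t. \<zeta> (s, t)) t \<partial>lborel) = 0"
      by (rule integral_derivative_C1_compact_support[OF S(3)]) simp
    finally show ?thesis by (simp only: S(4))
  qed
  then show "(\<integral>z. v (fst z) * d2 \<zeta> z \<partial>MQ) = - (\<integral>z. snd (g (fst z), 0) * \<zeta> z \<partial>MQ)"
    using Fubini_MQ(3)[OF i2] by simp
qed

text \<open>The identity is the nonconstant Sobolev function that, after centring, shows both infima
  to be taken over nonempty sets.\<close>

lemma weak_derivative_ident: "has_weak_gradient {0<..<L} (\<lambda>s. s) (\<lambda>_. 1)"
  unfolding has_weak_gradient_real[OF borel_open[OF open_greaterThanLessThan]]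
proof
  fix \<phi> assume \<phi>: "\<phi> \<in> C1_compact_support {0<..<L}"
  note C = C1_real[OF \<phi>]
  obtain K where K: "compact K" "K \<subseteq> {0<..<L}" "\<And>x. x \<notin> K \<Longrightarrow> \<phi> x = 0"
    "\<And>x. x \<notin> K \<Longrightarrow> frechet_derivative \<phi> (at x) = (\<lambda>_. 0)"
    using C1_compact_support_obtain[OF \<phi>] by blast
  have d: "((\<lambda>s. s * \<phi> s) has_real_derivative \<phi> s + s * dr \<phi> s) (at s)" for s
    by (rule DERIV_cong[OF DERIV_mult[OF DERIV_ident C(5)]]) simp
  have c: "continuous_on {0<..<L} (\<lambda>s. \<phi> s + s * dr \<phi> s)"
    by (intro continuous_intros continuous_on_subset[OF C(6)] continuous_on_subset[OF C(7)]) auto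
  have z: "s * \<phi> s = 0" if "s \<notin> K" for s using K(3)[OF that] by simp
  note T = C1_realI[OF open_greaterThanLessThan K(1,2) d c z]
  have out: "dr (\<lambda>s. s * \<phi> s) s = 0" if "s \<notin> {0<..<L}" for s
  proof -
    obtain K' where "K' \<subseteq> {0<..<L}" "\<And>x. x \<notin> K' \<Longrightarrow> frechet_derivative (\<lambda>s. s * \<phi> s) (at x) = (\<lambda>_. 0)"
      using C1_compact_support_obtain[OF T(1)] by blast
    then have "frechet_derivative (\<lambda>s. s * \<phi> s) (at s) = (\<lambda>_. 0)" using that by blast
    then show ?thesis by simp
  qed
  have id: "integrable MI (\<lambda>s. s)"
  proof (rule MI.integrable_const_bound[of _ L])
    show "AE s in MI. norm s \<le> L" by (intro AE_I2) (auto simp: space_restrict_space)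
  qed (intro measurable_restrict_space1, simp)
  have i: "integrable MI (\<lambda>s. s * dr \<phi> s)" "integrable MI (\<lambda>s. 1 * \<phi> s)"
    by (rule integrable_mult_bounded[OF id borel_measurable_restrict_lborelI[OF C(2)] C(4)])
      (rule integrable_mult_bounded[OF _ borel_measurable_restrict_lborelI[OF C(1)] C(3)], simp)
  have "(\<integral>s. 1 * \<phi> s + s * dr \<phi> s \<partial>MI) = (\<integral>s. dr (\<lambda>s. s * \<phi> s) s \<partial>MI)"
    by (intro Bochner_Integration.integral_cong refl) (simp add: T space_restrict_space)
  also have "\<dots> = (\<integral>s. indicator {0<..<L} s *\<^sub>R dr (\<lambda>s. s * \<phi> s) s \<partial>lborel)"
    by (rule integral_restrict_space) simp
  also have "(\<lambda>s. indicator {0<..<L} s *\<^sub>R dr (\<lambda>s. s * \<phi> s) s) = dr (\<lambda>s. s * \<phi> s)"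
  proof
    fix s show "indicator {0<..<L} s *\<^sub>R dr (\<lambda>s. s * \<phi> s) s = dr (\<lambda>s. s * \<phi> s) s"
      using out[of s] by (cases "s \<in> {0<..<L}") auto
  qed
  also have "(\<integral>s. dr (\<lambda>s. s * \<phi> s) s \<partial>lborel) = 0"
    using integral_derivative_C1_compact_support[OF T(1), of 1] by simp
  finally have "(\<integral>s. 1 * \<phi> s \<partial>MI) + (\<integral>s. s * dr \<phi> s \<partial>MI) = 0"
    by (subst (asm) Bochner_Integration.integral_add[OF i(2,1)])
  then show "(\<integral>s. s * dr \<phi> s \<partial>MI) = - (\<integral>s. 1 * \<phi> s \<partial>MI)" by linarith
qed

lemma average_Lp:
  fixes f :: "real \<times> real \<Rightarrow> real"
  assumes p: "p > 1" and f[measurable]: "f \<in> borel_measurable MQ" and i: "integrable MQ (\<lambda>z. \<bar>f z\<bar> powr p)"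
  shows "AE s in MI. \<bar>\<integral>t. f (s, t) \<partial>M1\<bar> powr p \<le> (\<integral>t. \<bar>f (s, t)\<bar> powr p \<partial>M1)"
    and "integrable MI (\<lambda>s. \<bar>\<integral>t. f (s, t) \<partial>M1\<bar> powr p)"
proof -
  show *: "AE s in MI. \<bar>\<integral>t. f (s, t) \<partial>M1\<bar> powr p \<le> (\<integral>t. \<bar>f (s, t)\<bar> powr p \<partial>M1)"
    using Fubini_MQ(1)[OF i] AE_space[of MI]
  proof eventually_elim
    case (elim s)
    show ?case
      by (rule M1.jensen_powr[OF _ elim(1) p measure_M1])
        (rule measurable_slice[OF f], use elim(2) in \<open>simp add: space_restrict_space\<close>)
  qed
  have [measurable]: "(\<lambda>s. \<integral>t. f (s, t) \<partial>M1) \<in> borel_measurable MI" by (rule measurable_average[OF f])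
  show "integrable MI (\<lambda>s. \<bar>\<integral>t. f (s, t) \<partial>M1\<bar> powr p)"
  proof (rule Bochner_Integration.integrable_bound[OF Fubini_MQ(2)[OF i]])
    show "AE s in MI. norm (\<bar>\<integral>t. f (s, t) \<partial>M1\<bar> powr p) \<le> norm (\<integral>t. \<bar>f (s, t)\<bar> powr p \<partial>M1)"
      using * by eventually_elim (auto intro: order_trans[OF _ abs_ge_self])
  qed simp
qed

end

section \<open>Comparison of the two quotients through a chart of a thin strip\<close>

text \<open>All that the comparison uses of the geometry: at thickness \<open>e\<close> the Jacobian
  is e \<delta> up to factors 1 - \<kappa> and 1 + \<kappa>, a fibre is run through with speed
  exactly e \<delta>, and the speed along the curve is at most 1 + \<kappa>. The lower bound
  \<open>\<delta>0\<close> only secures integrability after pulling back and enters no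
  estimate.\<close>

locale thin_chart =
  S: slicing L + C: planar_C2_chart "{0<..<L} \<times> {0<..<1}" \<Psi> Ps Pt Rs Rt Pss Pst Ptt Rss Rst Rtt +
  W0: weighted_domain "{0<..<L}" \<delta> \<Delta> p
  for L :: real and \<Psi> :: "real \<times> real \<Rightarrow> real \<times> real" and Ps Pt Rs Rt Pss Pst Ptt Rss Rst Rtt :: "real \<times> real \<Rightarrow> real"
    and \<delta> :: "real \<Rightarrow> real" and \<Delta> p :: real +
  fixes e \<kappa> \<delta>0 :: real
  assumes e: "0 < e" and \<kappa>: "0 \<le> \<kappa>" "\<kappa> < 1"
    and \<delta>0: "0 < \<delta>0" and \<delta>_ge: "\<And>s. s \<in> {0<..<L} \<Longrightarrow> \<delta>0 \<le> \<delta> s"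
    and J_ge: "\<And>z. z \<in> {0<..<L} \<times> {0<..<1} \<Longrightarrow> e * (1 - \<kappa>) * \<delta> (fst z) \<le> C.J z"
    and J_le: "\<And>z. z \<in> {0<..<L} \<times> {0<..<1} \<Longrightarrow> C.J z \<le> e * (1 + \<kappa>) * \<delta> (fst z)"
    and t_speed: "\<And>z. z \<in> {0<..<L} \<times> {0<..<1} \<Longrightarrow> (Pt z)\<^sup>2 + (Rt z)\<^sup>2 = (e * \<delta> (fst z))\<^sup>2"
    and s_speed: "\<And>z. z \<in> {0<..<L} \<times> {0<..<1} \<Longrightarrow> (Ps z)\<^sup>2 + (Rs z)\<^sup>2 \<le> (1 + \<kappa>)\<^sup>2"
begin

lemma p: "p > 1" by (rule W0.p)

lemma space_MQ: "z \<in> space S.MQ \<Longrightarrow> z \<in> S.Q" "z \<in> space S.MQ \<Longrightarrow> fst z \<in> {0<..<L}"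
  by (auto simp: space_restrict_space)

lemma \<delta>_pos: "s \<in> {0<..<L} \<Longrightarrow> 0 < \<delta> s" and \<delta>_le: "s \<in> {0<..<L} \<Longrightarrow> \<delta> s \<le> \<Delta>"
  using W0.w_pos W0.w_le by auto

lemma \<Delta>_pos: "0 < \<Delta>"
  using \<delta>_pos[of "L/2"] \<delta>_le[of "L/2"] S.L by simp

sublocale WD: weighted_domain C.D "\<lambda>_. 1" 1 p
proof
  show "1 < p" by (rule p)
  show "open C.D" by (rule C.open_D)
  show "C.D \<noteq> {}" using S.L by auto
  show "emeasure lborel C.D < \<infinity>" by (rule C.fin)
qed auto

lemma integral_N0: "f \<in> borel_measurable S.MI \<Longrightarrow> (\<integral>s. f s \<partial>W0.N) = (\<integral>s. f s * \<delta> s \<partial>S.MI)" for f :: "real \<Rightarrow> real"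
  by (simp only: W0.integral_N integral_restrict_lborel[OF W0.borel_D])

lemma integral_ND: "f \<in> borel_measurable C.MD \<Longrightarrow> (\<integral>y. f y \<partial>WD.N) = (\<integral>z. C.J z * f (\<Psi> z) \<partial>S.MQ)"
  for f :: "real \<times> real \<Rightarrow> real"
  using WD.integral_N[of f] C.integral_MD[of f] by (simp add: integral_restrict_lborel[OF C.borel_D])

lemma measurable_\<delta>: "(\<lambda>z. \<delta> (fst z)) \<in> borel_measurable S.MQ"
  by (rule measurable_compose[OF S.measurable_fst_MQ W0.w_meas])

lemma integrable_\<delta>:
  fixes f :: "real \<times> real \<Rightarrow> real"
  assumes f: "integrable S.MQ f"
  shows "integrable S.MQ (\<lambda>z. f z * \<delta> (fst z))"
proof (rule Bochner_Integration.integrable_bound)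
  show "integrable S.MQ (\<lambda>z. \<Delta> * f z)" using f by simp
  show "(\<lambda>z. f z * \<delta> (fst z)) \<in> borel_measurable S.MQ"
    using f measurable_\<delta> by (intro borel_measurable_times) auto
  show "AE z in S.MQ. norm (f z * \<delta> (fst z)) \<le> norm (\<Delta> * f z)"
  proof (rule AE_I2)
    fix z assume "z \<in> space S.MQ"
    then have "\<bar>\<delta> (fst z)\<bar> \<le> \<bar>\<Delta>\<bar>" using \<delta>_pos[of "fst z"] \<delta>_le[of "fst z"] space_MQ by auto
    then show "norm (f z * \<delta> (fst z)) \<le> norm (\<Delta> * f z)"
      by (simp add: abs_mult mult.commute[of "\<bar>f z\<bar>"] mult_right_mono)
  qed
qed

lemma integrable_J:
  fixes f :: "real \<times> real \<Rightarrow> real"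
  assumes f: "integrable S.MQ f"
  shows "integrable S.MQ (\<lambda>z. C.J z * f z)"
proof (rule Bochner_Integration.integrable_bound)
  show "integrable S.MQ (\<lambda>z. e * (1 + \<kappa>) * (f z * \<delta> (fst z)))" using integrable_\<delta>[OF f] by simp
  show "(\<lambda>z. C.J z * f z) \<in> borel_measurable S.MQ"
    using f C.measurable_J by (intro borel_measurable_times) auto
  show "AE z in S.MQ. norm (C.J z * f z) \<le> norm (e * (1 + \<kappa>) * (f z * \<delta> (fst z)))"
  proof (rule AE_I2)
    fix z assume z: "z \<in> space S.MQ"
    have "\<bar>C.J z\<bar> * \<bar>f z\<bar> \<le> (e * (1 + \<kappa>) * \<delta> (fst z)) * \<bar>f z\<bar>"
      using J_le[OF space_MQ(1)[OF z]] C.J_positive[OF space_MQ(1)[OF z]] by (intro mult_right_mono) auto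
    also have "\<dots> = \<bar>e * (1 + \<kappa>) * (f z * \<delta> (fst z))\<bar>"
      using e \<kappa> \<delta>_pos[OF space_MQ(2)[OF z]] by (simp add: abs_mult)
    finally show "norm (C.J z * f z) \<le> norm (e * (1 + \<kappa>) * (f z * \<delta> (fst z)))" by (simp add: abs_mult)
  qed
qed

lemma integrable_pull:
  fixes f :: "real \<times> real \<Rightarrow> real"
  assumes f: "integrable C.MD f"
  shows "integrable S.MQ (\<lambda>z. f (\<Psi> z))"
proof (rule C.integrable_pull_MQ[OF f])
  show "0 < e * (1 - \<kappa>) * \<delta>0" using e \<kappa> \<delta>0 by simp
  fix z assume z: "z \<in> S.Q"
  have "e * (1 - \<kappa>) * \<delta>0 \<le> e * (1 - \<kappa>) * \<delta> (fst z)"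
    using e \<kappa> \<delta>_ge[of "fst z"] z by (intro mult_left_mono) auto
  then show "e * (1 - \<kappa>) * \<delta>0 \<le> C.J z" using J_ge[OF z] by linarith
qed

lemma integral_ND_ge:
  fixes f :: "real \<times> real \<Rightarrow> real"
  assumes f: "f \<in> borel_measurable C.MD" "integrable S.MQ (\<lambda>z. f (\<Psi> z))" "\<And>z. z \<in> S.Q \<Longrightarrow> 0 \<le> f (\<Psi> z)"
  shows "e * (1 - \<kappa>) * (\<integral>z. f (\<Psi> z) * \<delta> (fst z) \<partial>S.MQ) \<le> (\<integral>y. f y \<partial>WD.N)"
proof -
  have "e * (1 - \<kappa>) * (\<integral>z. f (\<Psi> z) * \<delta> (fst z) \<partial>S.MQ) = (\<integral>z. e * (1 - \<kappa>) * (f (\<Psi> z) * \<delta> (fst z)) \<partial>S.MQ)"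
    by simp
  also have "\<dots> \<le> (\<integral>z. C.J z * f (\<Psi> z) \<partial>S.MQ)"
  proof (rule integral_mono)
    fix z assume z: "z \<in> space S.MQ"
    have "e * (1 - \<kappa>) * \<delta> (fst z) * f (\<Psi> z) \<le> C.J z * f (\<Psi> z)"
      using J_ge f(3) space_MQ[OF z] by (intro mult_right_mono) auto
    then show "e * (1 - \<kappa>) * (f (\<Psi> z) * \<delta> (fst z)) \<le> C.J z * f (\<Psi> z)" by (simp add: algebra_simps)
  qed (use integrable_\<delta>[OF f(2)] integrable_J[OF f(2)] in auto)
  finally show ?thesis using integral_ND[OF f(1)] by simp
qed

lemma integral_ND_le:
  fixes f :: "real \<times> real \<Rightarrow> real"
  assumes f: "f \<in> borel_measurable C.MD" "integrable S.MQ (\<lambda>z. f (\<Psi> z))" "\<And>z. z \<in> S.Q \<Longrightarrow> 0 \<le> f (\<Psi> z)"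
  shows "(\<integral>y. f y \<partial>WD.N) \<le> e * (1 + \<kappa>) * (\<integral>z. f (\<Psi> z) * \<delta> (fst z) \<partial>S.MQ)"
proof -
  have "(\<integral>z. C.J z * f (\<Psi> z) \<partial>S.MQ) \<le> (\<integral>z. e * (1 + \<kappa>) * (f (\<Psi> z) * \<delta> (fst z)) \<partial>S.MQ)"
  proof (rule integral_mono)
    fix z assume z: "z \<in> space S.MQ"
    have "C.J z * f (\<Psi> z) \<le> e * (1 + \<kappa>) * \<delta> (fst z) * f (\<Psi> z)"
      using J_le f(3) space_MQ[OF z] by (intro mult_right_mono) auto
    then show "C.J z * f (\<Psi> z) \<le> e * (1 + \<kappa>) * (f (\<Psi> z) * \<delta> (fst z))" by (simp add: algebra_simps)
  qed (use integrable_\<delta>[OF f(2)] integrable_J[OF f(2)] in auto)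
  then show ?thesis using integral_ND[OF f(1)] by simp
qed

lemma integrable_of_powr:
  assumes "finite_measure M" "f \<in> borel_measurable M" "integrable M (\<lambda>x. \<bar>f x\<bar> powr p)"
  shows "integrable M (f :: 'a \<Rightarrow> real)"
proof -
  have "integrable M (\<lambda>x. \<bar>f x\<bar> powr 1)"
    by (rule finite_measure.integrable_powr_smaller[OF assms]) (use p in auto)
  then show ?thesis using assms(2) by (simp add: integrable_abs_iff)
qed

text \<open>In the second claim \<open>c\<close> is arbitrary: optimality of the constant 0 on the
  interval bounds the norm of \<open>v\<close> by that of \<open>v - c\<close>, so the centring
  constant of the strip can be inserted afterwards. In the third, 1 + \<kappa> comes from the
  Jacobian and the negative power of 1 - \<kappa> from the gradient.\<close>

lemma lift_competitor:
  assumes vg: "W0.competitor v g"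
  defines "V \<equiv> \<lambda>y. v (fst (C.inverse_chart y))" and "G \<equiv> C.push_gradient (\<lambda>z. (g (fst z), 0))"
  shows "W1p_with_gradient p C.D V G"
    and "e * (1 - \<kappa>) * (\<integral>s. \<bar>v s\<bar> powr p \<partial>W0.N) \<le> (\<integral>y. \<bar>V y - c\<bar> powr p \<partial>WD.N)"
    and "(\<integral>y. norm (G y) powr p \<partial>WD.N) \<le> e * (1 + \<kappa>) * (1 - \<kappa>) powr (- p) * (\<integral>s. norm (g s) powr p \<partial>W0.N)"
proof -
  have W: "W1p_with_gradient p {0<..<L} v g" using vg by (simp add: W0.competitor_def)
  note m = W0.W1p_measurable[OF W]
  have g_abs: "integrable S.MI (\<lambda>s. \<bar>g s\<bar> powr p)" using m(4) by simp
  have vi: "integrable S.MI v" and gi: "integrable S.MI g"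
    by (rule integrable_of_powr[OF S.finite_MI m(1,3)], rule integrable_of_powr[OF S.finite_MI m(2) g_abs])
  have wg: "has_weak_gradient {0<..<L} v g" using W by (simp add: W1p_with_gradient_def)
  have gQ: "integrable S.MQ (\<lambda>z. (g (fst z), 0::real))"
    using integrable_scaleR_left[of "(1::real, 0::real)", OF S.integrable_fst_MQ(1)[OF gi]] by simp
  have VG: "has_weak_gradient C.D V G"
    unfolding V_def G_def
    by (rule C.weak_gradient_push[OF S.integrable_fst_MQ(1)[OF vi] gQ S.weak_gradient_fst[OF vi gi wg]])
  have Vm[measurable]: "V \<in> borel_measurable C.MD"
    unfolding V_def
    by (rule measurable_compose[OF C.measurable_inverse_chart measurable_compose[OF S.measurable_fst_MQ m(1)]])
  have Gm[measurable]: "G \<in> borel_measurable C.MD"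
    unfolding G_def by (rule C.measurable_push_gradient) (rule borel_measurable_integrable[OF gQ])
  have V\<Psi>: "V (\<Psi> z) = v (fst z)" if "z \<in> S.Q" for z using that by (simp add: V_def)
  \<comment> \<open>With no fibre component the pushed gradient involves only the column
    \<open>Pt\<close>, \<open>Rt\<close>, whose length is exactly e \<delta>. Its norm is therefore
    |g| e \<delta> / J, and the lower bound for J cancels e \<delta>.\<close>
  have G\<Psi>: "norm (G (\<Psi> z)) \<le> \<bar>g (fst z)\<bar> / (1 - \<kappa>)" if z: "z \<in> S.Q" for z
  proof -
    have J: "0 < C.J z" by (rule C.J_positive[OF z])
    have d: "0 < \<delta> (fst z)" using z by (intro \<delta>_pos) auto
    have "G (\<Psi> z) = (g (fst z) * Rt z / C.J z, - (g (fst z) * Pt z) / C.J z)"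
      using z by (simp add: G_def C.push_gradient_def)
    then have "norm (G (\<Psi> z)) = sqrt ((g (fst z) * Rt z / C.J z)\<^sup>2 + (g (fst z) * Pt z / C.J z)\<^sup>2)"
      by (simp add: norm_prod_def power_divide)
    also have "(g (fst z) * Rt z / C.J z)\<^sup>2 + (g (fst z) * Pt z / C.J z)\<^sup>2 = (g (fst z) / C.J z)\<^sup>2 * ((Pt z)\<^sup>2 + (Rt z)\<^sup>2)"
      by (simp add: power_mult_distrib power_divide algebra_simps add_divide_distrib)
    also have "\<dots> = (g (fst z) / C.J z * (e * \<delta> (fst z)))\<^sup>2"
      unfolding t_speed[OF z] by (simp only: power_mult_distrib)
    also have "sqrt \<dots> = \<bar>g (fst z)\<bar> * (e * \<delta> (fst z) / C.J z)"
      using J e d by (simp add: abs_mult)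
    also have "\<dots> \<le> \<bar>g (fst z)\<bar> * (1 / (1 - \<kappa>))"
    proof (rule mult_left_mono)
      show "e * \<delta> (fst z) / C.J z \<le> 1 / (1 - \<kappa>)"
        using J_ge[OF z] J \<kappa> by (simp add: field_simps)
    qed simp
    finally show ?thesis by simp
  qed
  have Gp: "norm (G (\<Psi> z)) powr p \<le> (1 - \<kappa>) powr (- p) * \<bar>g (fst z)\<bar> powr p" if z: "z \<in> S.Q" for z
  proof -
    have "norm (G (\<Psi> z)) powr p \<le> (\<bar>g (fst z)\<bar> / (1 - \<kappa>)) powr p"
      using G\<Psi>[OF z] p by (intro powr_mono2) auto
    also have "\<dots> = (1 - \<kappa>) powr (- p) * \<bar>g (fst z)\<bar> powr p"
      using \<kappa> by (simp add: powr_divide powr_minus_divide)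
    finally show ?thesis .
  qed
  have vpQ: "integrable S.MQ (\<lambda>z. \<bar>v (fst z) - c\<bar> powr p)" for c
    by (rule S.integrable_fst_MQ(1)[OF S.MI.integrable_powr_diff]) (use m p in auto)
  have gpQ: "integrable S.MQ (\<lambda>z. \<bar>g (fst z)\<bar> powr p)"
    by (rule S.integrable_fst_MQ(1)[OF g_abs])
  have Vpull: "integrable S.MQ (\<lambda>z. \<bar>V (\<Psi> z) - c\<bar> powr p)" for c
  proof -
    have "integrable S.MQ (\<lambda>z. \<bar>V (\<Psi> z) - c\<bar> powr p) \<longleftrightarrow> integrable S.MQ (\<lambda>z. \<bar>v (fst z) - c\<bar> powr p)"
      by (intro Bochner_Integration.integrable_cong refl) (simp add: V\<Psi>[OF space_MQ(1)])
    then show ?thesis using vpQ by simp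
  qed
  have Gpull: "integrable S.MQ (\<lambda>z. norm (G (\<Psi> z)) powr p)"
  proof (rule Bochner_Integration.integrable_bound)
    show "integrable S.MQ (\<lambda>z. (1 - \<kappa>) powr (- p) * \<bar>g (fst z)\<bar> powr p)" using gpQ by simp
    note [measurable] = C.measurable_chart
    show "(\<lambda>z. norm (G (\<Psi> z)) powr p) \<in> borel_measurable S.MQ" by measurable
    show "AE z in S.MQ. norm (norm (G (\<Psi> z)) powr p) \<le> norm ((1 - \<kappa>) powr (- p) * \<bar>g (fst z)\<bar> powr p)"
      using Gp space_MQ by (intro AE_I2) auto
  qed
  have Vi: "integrable C.MD (\<lambda>y. \<bar>V y\<bar> powr p)"
    using integrable_J[OF Vpull[of 0]] by (subst C.integrable_MD) auto
  have Gi: "integrable C.MD (\<lambda>y. norm (G y) powr p)"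
    using integrable_J[OF Gpull] by (subst C.integrable_MD) auto
  show "W1p_with_gradient p C.D V G"
    unfolding W1p_with_gradient_def Lp_on_iff[OF C.borel_D] using Vm Gm Vi Gi VG by simp
  have "(\<integral>s. \<bar>v s\<bar> powr p \<partial>W0.N) \<le> (\<integral>s. \<bar>v s - c\<bar> powr p \<partial>W0.N)" by (rule W0.competitor_le_diff_const[OF vg])
  also have "\<dots> = (\<integral>s. \<bar>v s - c\<bar> powr p * \<delta> s \<partial>S.MI)" using m(1) by (intro integral_N0) auto
  also have "\<dots> = (\<integral>z. \<bar>v (fst z) - c\<bar> powr p * \<delta> (fst z) \<partial>S.MQ)"
  proof (rule S.integrable_fst_MQ(2)[symmetric])
    have "integrable S.MI (\<lambda>s. \<integral>t. \<bar>v (fst (s, t)) - c\<bar> powr p * \<delta> (fst (s, t)) \<partial>S.M1)"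
      by (rule S.Fubini_MQ(2)[OF integrable_\<delta>[OF vpQ]])
    then show "integrable S.MI (\<lambda>s. \<bar>v s - c\<bar> powr p * \<delta> s)" using S.measure_M1 by simp
  qed
  also have "\<dots> = (\<integral>z. \<bar>V (\<Psi> z) - c\<bar> powr p * \<delta> (fst z) \<partial>S.MQ)"
    by (intro Bochner_Integration.integral_cong refl) (use V\<Psi> space_MQ in auto)
  finally have "e * (1 - \<kappa>) * (\<integral>s. \<bar>v s\<bar> powr p \<partial>W0.N) \<le> e * (1 - \<kappa>) * (\<integral>z. \<bar>V (\<Psi> z) - c\<bar> powr p * \<delta> (fst z) \<partial>S.MQ)"
    using e \<kappa> by (intro mult_left_mono) auto
  also have "\<dots> \<le> (\<integral>y. \<bar>V y - c\<bar> powr p \<partial>WD.N)"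
    by (rule integral_ND_ge) (use Vpull in auto)
  finally show "e * (1 - \<kappa>) * (\<integral>s. \<bar>v s\<bar> powr p \<partial>W0.N) \<le> (\<integral>y. \<bar>V y - c\<bar> powr p \<partial>WD.N)" .
  have "(\<integral>y. norm (G y) powr p \<partial>WD.N) \<le> e * (1 + \<kappa>) * (\<integral>z. norm (G (\<Psi> z)) powr p * \<delta> (fst z) \<partial>S.MQ)"
    by (rule integral_ND_le) (use Gpull in auto)
  also have "\<dots> \<le> e * (1 + \<kappa>) * (\<integral>z. (1 - \<kappa>) powr (- p) * (\<bar>g (fst z)\<bar> powr p * \<delta> (fst z)) \<partial>S.MQ)"
  proof (intro mult_left_mono integral_mono)
    fix z assume z: "z \<in> space S.MQ"
    have "norm (G (\<Psi> z)) powr p * \<delta> (fst z) \<le> ((1 - \<kappa>) powr (- p) * \<bar>g (fst z)\<bar> powr p) * \<delta> (fst z)"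
      using Gp[OF space_MQ(1)[OF z]] \<delta>_pos[OF space_MQ(2)[OF z]] by (intro mult_right_mono) auto
    then show "norm (G (\<Psi> z)) powr p * \<delta> (fst z) \<le> (1 - \<kappa>) powr (- p) * (\<bar>g (fst z)\<bar> powr p * \<delta> (fst z))"
      by (simp add: mult.assoc)
  qed (use integrable_\<delta>[OF Gpull] integrable_\<delta>[OF gpQ] e \<kappa> in auto)
  also have "\<dots> = e * (1 + \<kappa>) * (1 - \<kappa>) powr (- p) * (\<integral>z. \<bar>g (fst z)\<bar> powr p * \<delta> (fst z) \<partial>S.MQ)" by simp
  also have "(\<integral>z. \<bar>g (fst z)\<bar> powr p * \<delta> (fst z) \<partial>S.MQ) = (\<integral>s. \<bar>g s\<bar> powr p * \<delta> s \<partial>S.MI)"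
  proof (rule S.integrable_fst_MQ(2))
    have "integrable S.MI (\<lambda>s. \<integral>t. \<bar>g (fst (s, t))\<bar> powr p * \<delta> (fst (s, t)) \<partial>S.M1)"
      by (rule S.Fubini_MQ(2)[OF integrable_\<delta>[OF gpQ]])
    then show "integrable S.MI (\<lambda>s. \<bar>g s\<bar> powr p * \<delta> s)" using S.measure_M1 by simp
  qed
  also have "\<dots> = (\<integral>s. norm (g s) powr p \<partial>W0.N)" using integral_N0[of "\<lambda>s. norm (g s) powr p"] m(2) by simp
  finally show "(\<integral>y. norm (G y) powr p \<partial>WD.N) \<le> e * (1 + \<kappa>) * (1 - \<kappa>) powr (- p) * (\<integral>s. norm (g s) powr p \<partial>W0.N)" .
qed

lemma exists_competitor_interval: "\<exists>v g. W0.competitor v g"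
proof -
  have m: "(\<lambda>s. s) \<in> borel_measurable S.MI" by (intro measurable_restrict_space1) simp
  have "integrable S.MI (\<lambda>s. \<bar>s\<bar> powr p)"
  proof (rule S.MI.integrable_const_bound[of _ "L powr p"])
    show "AE s in S.MI. norm (\<bar>s\<bar> powr p) \<le> L powr p"
      using p by (intro AE_I2) (auto simp: space_restrict_space intro!: powr_mono2)
  qed (use m in measurable)
  then have W: "W1p_with_gradient p {0<..<L} (\<lambda>s. s) (\<lambda>_. 1)"
    unfolding W1p_with_gradient_def Lp_on_iff[OF W0.borel_D] using m S.weak_derivative_ident by simp
  have "\<not> (AE s in lborel. s \<in> {0<..<L} \<longrightarrow> s = c)" for c
  proof
    assume "AE s in lborel. s \<in> {0<..<L} \<longrightarrow> s = c"
    then have "AE s in lborel. s \<notin> {0<..<L}" using AE_lborel_singleton[of c] by eventually_elim auto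
    then have "emeasure lborel {0<..<L} = 0" by (subst (asm) AE_iff_null_sets[symmetric]) auto
    then show False using S.L by simp
  qed
  from W0.exists_competitor[OF W this] show ?thesis by blast
qed

text \<open>The lower bound in \<open>lift_competitor\<close> holds for every \<open>c\<close>, so a
  lifted competitor is not almost everywhere constant and can be centred in the strip.\<close>

lemma exists_competitor_strip: "\<exists>v g. WD.competitor v g"
proof -
  obtain v g where vg: "W0.competitor v g" using exists_competitor_interval by blast
  note L = lift_competitor[OF vg]
  have "\<not> (AE y in lborel. y \<in> C.D \<longrightarrow> v (fst (C.inverse_chart y)) = c)" for c
  proof -
    have "0 < e * (1 - \<kappa>) * (\<integral>s. \<bar>v s\<bar> powr p \<partial>W0.N)" using e \<kappa> vg by (simp add: W0.competitor_def)
    also have "\<dots> \<le> (\<integral>y. \<bar>v (fst (C.inverse_chart y)) - c\<bar> powr p \<partial>WD.N)" by (rule L(2))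
    finally show ?thesis using WD.integral_N_pos_iff[OF WD.W1p_diff_const[OF L(1)], of c] by simp
  qed
  from WD.exists_competitor[OF L(1) this] show ?thesis by blast
qed

text \<open>The thickness \<open>e\<close> cancels between the two sides. Of the exponent p + 1, one
  power of 1 - \<kappa> comes from the Jacobian in the denominator and p powers from the gradient; 1
  + \<kappa> comes from the Jacobian in the numerator.\<close>

lemma mu1_strip_le:
  "(1 - \<kappa>) powr (p + 1) / (1 + \<kappa>) * weighted_neumann_mu1 p C.D (\<lambda>_. 1) \<le> weighted_neumann_mu1 p {0<..<L} \<delta>"
    (is "?a * ?m \<le> _")
proof -
  have m0: "0 \<le> ?m" using exists_competitor_strip WD.mu1_nonneg by blast
  obtain v0 g0 where "W0.competitor v0 g0" using exists_competitor_interval by blast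
  then show ?thesis
  proof (rule W0.mu1_ge)
    fix v g assume vg: "W0.competitor v g"
    note L = lift_competitor[OF vg]
    let ?X = "\<integral>s. \<bar>v s\<bar> powr p \<partial>W0.N" and ?Y = "\<integral>s. norm (g s) powr p \<partial>W0.N"
    obtain c where c: "?m * (\<integral>y. \<bar>v (fst (C.inverse_chart y)) - c\<bar> powr p \<partial>WD.N)
      \<le> (\<integral>y. norm (C.push_gradient (\<lambda>z. (g (fst z), 0)) y) powr p \<partial>WD.N)"
      using WD.mu1_le_centered[OF L(1)] by blast
    have "?m * (e * (1 - \<kappa>) * ?X) \<le> ?m * (\<integral>y. \<bar>v (fst (C.inverse_chart y)) - c\<bar> powr p \<partial>WD.N)"
      by (rule mult_left_mono[OF L(2) m0])
    also note c
    also note L(3)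
    finally have *: "e * (?m * (1 - \<kappa>) * ?X) \<le> e * ((1 + \<kappa>) * (1 - \<kappa>) powr (- p) * ?Y)" by (simp add: algebra_simps)
    then have "?m * (1 - \<kappa>) * ?X \<le> (1 + \<kappa>) * (1 - \<kappa>) powr (- p) * ?Y" using e by simp
    then have "(1 - \<kappa>) powr p * (?m * (1 - \<kappa>) * ?X) \<le> (1 - \<kappa>) powr p * ((1 + \<kappa>) * (1 - \<kappa>) powr (- p) * ?Y)"
      by (rule mult_left_mono) simp
    also have "\<dots> = (1 + \<kappa>) * ?Y" using \<kappa> by (simp add: powr_minus)
    also have "(1 - \<kappa>) powr p * (?m * (1 - \<kappa>) * ?X) = (1 - \<kappa>) powr (p + 1) * (?m * ?X)"
      using \<kappa> by (simp add: powr_add)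
    finally show "?a * ?m * ?X \<le> ?Y" using \<kappa> by (simp add: field_simps)
  qed
qed

lemma mu1_interval_nonneg: "0 \<le> weighted_neumann_mu1 p {0<..<L} \<delta>"
  using exists_competitor_interval W0.mu1_nonneg by blast

text \<open>The weight is constant along fibres, so Jensen's inequality on each fibre can be
  multiplied by it before integrating in s.\<close>

lemma integral_average_le:
  fixes f :: "real \<times> real \<Rightarrow> real"
  assumes f: "f \<in> borel_measurable S.MQ" and i: "integrable S.MQ (\<lambda>z. \<bar>f z\<bar> powr p)"
  shows "integrable S.MI (\<lambda>s. \<bar>\<integral>t. f (s, t) \<partial>S.M1\<bar> powr p * \<delta> s)"
    and "(\<integral>s. \<bar>\<integral>t. f (s, t) \<partial>S.M1\<bar> powr p * \<delta> s \<partial>S.MI) \<le> (\<integral>z. \<bar>f z\<bar> powr p * \<delta> (fst z) \<partial>S.MQ)"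
proof -
  note A = S.average_Lp[OF p f i]
  show I: "integrable S.MI (\<lambda>s. \<bar>\<integral>t. f (s, t) \<partial>S.M1\<bar> powr p * \<delta> s)"
    using S.Fubini_MQ(2)[OF integrable_\<delta>[OF S.integrable_fst_MQ(1)[OF A(2)]]] S.measure_M1 by simp
  have I2: "integrable S.MI (\<lambda>s. (\<integral>t. \<bar>f (s, t)\<bar> powr p \<partial>S.M1) * \<delta> s)"
    using S.Fubini_MQ(2)[OF integrable_\<delta>[OF i]] by simp
  have "(\<integral>s. \<bar>\<integral>t. f (s, t) \<partial>S.M1\<bar> powr p * \<delta> s \<partial>S.MI) \<le> (\<integral>s. (\<integral>t. \<bar>f (s, t)\<bar> powr p \<partial>S.M1) * \<delta> s \<partial>S.MI)"
  proof (rule integral_mono_AE[OF I I2])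
    show "AE s in S.MI. \<bar>\<integral>t. f (s, t) \<partial>S.M1\<bar> powr p * \<delta> s \<le> (\<integral>t. \<bar>f (s, t)\<bar> powr p \<partial>S.M1) * \<delta> s"
      using A(1) AE_space[of S.MI]
    proof eventually_elim
      case (elim s)
      then have "0 \<le> \<delta> s" using \<delta>_pos[of s] by (simp add: space_restrict_space)
      with elim(1) show ?case by (rule mult_right_mono)
    qed
  qed
  also have "\<dots> = (\<integral>z. \<bar>f z\<bar> powr p * \<delta> (fst z) \<partial>S.MQ)"
    using S.Fubini_MQ(3)[OF integrable_\<delta>[OF i]] by simp
  finally show "(\<integral>s. \<bar>\<integral>t. f (s, t) \<partial>S.M1\<bar> powr p * \<delta> s \<partial>S.MI) \<le> (\<integral>z. \<bar>f z\<bar> powr p * \<delta> (fst z) \<partial>S.MQ)" .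
qed

text \<open>The parameter \<open>l\<close> weighs the fibre averages of a competitor against its oscillation along the fibres,
  which is of order \<open>e\<close>; the choice $l = \sqrt{e}$ makes both factors harmless.\<close>

lemma mu1_interval_le:
  fixes l :: real
  assumes l: "0 < l" "l < 1"
  defines "m \<equiv> weighted_neumann_mu1 p {0<..<L} \<delta>"
  defines "B \<equiv> (1 + \<kappa>) / (1 - \<kappa>) * ((1 - l) powr (1 - p) * (1 + \<kappa>) powr p + m * (l powr (1 - p) * (e * \<Delta>) powr p))"
  shows "m / B \<le> weighted_neumann_mu1 p C.D (\<lambda>_. 1)"
proof -
  have m0: "0 \<le> m" unfolding m_def by (rule mu1_interval_nonneg)
  have Bpos: "0 < B"
    unfolding B_def using l \<kappa> m0 by (intro mult_pos_pos add_pos_nonneg divide_pos_pos mult_nonneg_nonneg) auto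
  obtain v0 g0 where "WD.competitor v0 g0" using exists_competitor_strip by blast
  then show ?thesis
  proof (rule WD.mu1_ge)
    fix v g assume vg: "WD.competitor v g"
    let ?X = "\<integral>y. \<bar>v y\<bar> powr p \<partial>WD.N" and ?Y = "\<integral>y. norm (g y) powr p \<partial>WD.N"
    have W: "W1p_with_gradient p C.D v g" using vg by (simp add: WD.competitor_def)
    note vm = WD.W1p_measurable(1)[OF W] and gm = WD.W1p_measurable(2)[OF W]
      and vp = WD.W1p_measurable(3)[OF W] and gp = WD.W1p_measurable(4)[OF W]
    have vi: "integrable C.MD v" by (rule integrable_of_powr[OF WD.MD.finite_measure_axioms vm vp])
    have ngm: "(\<lambda>y. norm (g y)) \<in> borel_measurable C.MD" using gm by simp
    have ngi: "integrable C.MD (\<lambda>y. norm (g y))"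
      by (rule integrable_of_powr[OF WD.MD.finite_measure_axioms ngm]) (use gp in simp)
    then have gi: "integrable C.MD g" using gm by (simp add: integrable_norm_iff)
    have wg: "has_weak_gradient C.D v g" using W by (simp add: W1p_with_gradient_def)
    define u where "u z = v (\<Psi> z)" for z
    define h1 where "h1 z = fst (C.pull_gradient g z)" for z
    define h2 where "h2 z = snd (C.pull_gradient g z)" for z
    define G where "G z = norm (g (\<Psi> z))" for z
    have um: "u \<in> borel_measurable S.MQ" unfolding u_def by (rule measurable_compose[OF C.measurable_chart vm])
    have ui: "integrable S.MQ u" unfolding u_def by (rule integrable_pull[OF vi])
    have up: "integrable S.MQ (\<lambda>z. \<bar>u z\<bar> powr p)" unfolding u_def by (rule integrable_pull[OF vp])
    have Gi: "integrable S.MQ G" unfolding G_def by (rule integrable_pull[OF ngi])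
    have Gp: "integrable S.MQ (\<lambda>z. G z powr p)" unfolding G_def by (rule integrable_pull[OF gp])
    have g\<Psi>: "(\<lambda>z. g (\<Psi> z)) \<in> borel_measurable S.MQ" by (rule measurable_compose[OF C.measurable_chart gm])
    have h1m: "h1 \<in> borel_measurable S.MQ" and h2m: "h2 \<in> borel_measurable S.MQ"
      unfolding h1_def h2_def C.pull_gradient_def fst_conv snd_conv
      by (intro borel_measurable_add borel_measurable_times borel_measurable_fst_snd[OF g\<Psi>] C.measurable_coefficients)+
    \<comment> \<open>Cauchy-Schwarz against a column of the Jacobian matrix: each component of the
      pulled-back gradient is at most |g| times the length of its column.\<close>
    have cs: "\<bar>fst w * a + snd w * b\<bar> \<le> norm w * sqrt (a\<^sup>2 + b\<^sup>2)" for w :: "real \<times> real" and a b :: real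
      using Cauchy_Schwarz_ineq2[of w "(a, b)"] by (simp add: inner_prod_def norm_prod_def)
    have h1_le: "\<bar>h1 z\<bar> \<le> (1 + \<kappa>) * G z" if z: "z \<in> S.Q" for z
    proof -
      have "\<bar>h1 z\<bar> \<le> G z * sqrt ((Ps z)\<^sup>2 + (Rs z)\<^sup>2)"
        unfolding h1_def C.pull_gradient_def fst_conv G_def by (rule cs)
      also have "\<dots> \<le> G z * (1 + \<kappa>)"
        using s_speed[OF z] \<kappa> by (intro mult_left_mono real_le_lsqrt) (auto simp: G_def)
      finally show ?thesis by (simp add: mult.commute)
    qed
    \<comment> \<open>The source of smallness: the fibre coordinate has unit range while the fibre
      itself has length e \<delta>, so this derivative carries a factor \<open>e\<close>.\<close>
    have h2_le: "\<bar>h2 z\<bar> \<le> e * \<Delta> * G z" if z: "z \<in> S.Q" for z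
    proof -
      have d: "0 < \<delta> (fst z)" "\<delta> (fst z) \<le> \<Delta>" using \<delta>_pos[of "fst z"] \<delta>_le[of "fst z"] z by auto
      have "\<bar>h2 z\<bar> \<le> G z * sqrt ((Pt z)\<^sup>2 + (Rt z)\<^sup>2)"
        unfolding h2_def C.pull_gradient_def snd_conv G_def by (rule cs)
      also have "\<dots> = G z * (e * \<delta> (fst z))" unfolding t_speed[OF z] using e d by simp
      also have "\<dots> \<le> G z * (e * \<Delta>)" using e d by (intro mult_left_mono) (auto simp: G_def)
      finally show ?thesis by (simp add: mult.commute)
    qed
    have dominated: "integrable S.MQ f" "integrable S.MQ (\<lambda>z. \<bar>f z\<bar> powr p)"
        "(\<integral>z. \<bar>f z\<bar> powr p * \<delta> (fst z) \<partial>S.MQ) \<le> k powr p * (\<integral>z. G z powr p * \<delta> (fst z) \<partial>S.MQ)"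
      if fm: "f \<in> borel_measurable S.MQ" and k: "0 \<le> k" and f: "\<And>z. z \<in> S.Q \<Longrightarrow> \<bar>f z\<bar> \<le> k * G z"
      for f :: "real \<times> real \<Rightarrow> real" and k
    proof -
      have fp: "\<bar>f z\<bar> powr p \<le> k powr p * G z powr p" if "z \<in> S.Q" for z
      proof -
        have "\<bar>f z\<bar> powr p \<le> (k * G z) powr p" using f[OF that] p by (intro powr_mono2) auto
        then show ?thesis using k by (simp add: powr_mult G_def)
      qed
      show "integrable S.MQ f"
      proof (rule Bochner_Integration.integrable_bound)
        show "integrable S.MQ (\<lambda>z. k * G z)" using Gi by simp
        show "AE z in S.MQ. norm (f z) \<le> norm (k * G z)"
          using f space_MQ by (intro AE_I2) (auto intro: order_trans[OF _ abs_ge_self])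
      qed (rule fm)
      show i: "integrable S.MQ (\<lambda>z. \<bar>f z\<bar> powr p)"
      proof (rule Bochner_Integration.integrable_bound)
        show "integrable S.MQ (\<lambda>z. k powr p * G z powr p)" using Gp by simp
        show "AE z in S.MQ. norm (\<bar>f z\<bar> powr p) \<le> norm (k powr p * G z powr p)"
          using fp space_MQ by (intro AE_I2) (auto intro: order_trans[OF _ abs_ge_self])
      qed (use fm in measurable)
      have "(\<integral>z. \<bar>f z\<bar> powr p * \<delta> (fst z) \<partial>S.MQ) \<le> (\<integral>z. k powr p * (G z powr p * \<delta> (fst z)) \<partial>S.MQ)"
      proof (rule integral_mono)
        fix z assume z: "z \<in> space S.MQ"
        have "\<bar>f z\<bar> powr p * \<delta> (fst z) \<le> (k powr p * G z powr p) * \<delta> (fst z)"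
          using fp[OF space_MQ(1)[OF z]] \<delta>_pos[OF space_MQ(2)[OF z]] by (intro mult_right_mono) auto
        then show "\<bar>f z\<bar> powr p * \<delta> (fst z) \<le> k powr p * (G z powr p * \<delta> (fst z))" by (simp only: mult.assoc)
      qed (use integrable_\<delta>[OF i] integrable_\<delta>[OF Gp] in auto)
      then show "(\<integral>z. \<bar>f z\<bar> powr p * \<delta> (fst z) \<partial>S.MQ) \<le> k powr p * (\<integral>z. G z powr p * \<delta> (fst z) \<partial>S.MQ)" by simp
    qed
    have k1: "0 \<le> 1 + \<kappa>" and k2: "0 \<le> e * \<Delta>" using \<kappa> e \<Delta>_pos by auto
    note D1 = dominated[OF h1m k1 h1_le] and D2 = dominated[OF h2m k2 h2_le]
    define E where "E = (\<integral>z. G z powr p * \<delta> (fst z) \<partial>S.MQ)"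
    define ub where "ub s = (\<integral>t. u (s, t) \<partial>S.M1)" for s
    define hb where "hb s = (\<integral>t. h1 (s, t) \<partial>S.M1)" for s
    have weak: "(\<integral>z. u z * d1 \<zeta> z \<partial>S.MQ) = - (\<integral>z. h1 z * \<zeta> z \<partial>S.MQ)"
        "(\<integral>z. u z * d2 \<zeta> z \<partial>S.MQ) = - (\<integral>z. h2 z * \<zeta> z \<partial>S.MQ)" if "\<zeta> \<in> C1_compact_support S.Q" for \<zeta>
      using C.weak_gradient_pull[OF vi gi wg] that unfolding has_weak_gradient_real_pair[OF C.borel_Q] u_def h1_def h2_def
      by blast+
    have ubm: "ub \<in> borel_measurable S.MI" and hbm: "hb \<in> borel_measurable S.MI"
      unfolding ub_def hb_def by (rule S.measurable_average[OF um], rule S.measurable_average[OF h1m])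
    have ubp: "integrable S.MI (\<lambda>s. \<bar>ub s\<bar> powr p)" and hbp: "integrable S.MI (\<lambda>s. \<bar>hb s\<bar> powr p)"
      unfolding ub_def hb_def by (rule S.average_Lp(2)[OF p um up], rule S.average_Lp(2)[OF p h1m D1(2)])
    have "has_weak_gradient {0<..<L} ub hb"
      unfolding ub_def hb_def by (rule S.average_weak_derivative[OF ui D1(1) weak(1)])
    then have W1: "W1p_with_gradient p {0<..<L} ub hb"
      unfolding W1p_with_gradient_def Lp_on_iff[OF W0.borel_D] using ubm hbm ubp hbp by simp
    \<comment> \<open>This is the centring constant of the fibre averages on the interval.
      Optimality of 0 for \<open>v\<close> in the strip allows the same constant to be subtracted
      from \<open>v\<close> below.\<close>
    obtain c where c: "m * (\<integral>s. \<bar>ub s - c\<bar> powr p \<partial>W0.N) \<le> (\<integral>s. norm (hb s) powr p \<partial>W0.N)"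
      using W0.mu1_le_centered[OF W1] unfolding m_def by blast
    define Z where "Z = (\<integral>s. \<bar>ub s - c\<bar> powr p \<partial>W0.N)"
    have ucQ: "integrable S.MQ (\<lambda>z. \<bar>ub (fst z) - c\<bar> powr p)"
      by (rule S.integrable_fst_MQ(1)[OF S.MI.integrable_powr_diff]) (use ubm ubp p in auto)
    have Z: "(\<integral>z. \<bar>ub (fst z) - c\<bar> powr p * \<delta> (fst z) \<partial>S.MQ) = Z"
    proof -
      have "integrable S.MI (\<lambda>s. \<integral>t. \<bar>ub (fst (s, t)) - c\<bar> powr p * \<delta> (fst (s, t)) \<partial>S.M1)"
        by (rule S.Fubini_MQ(2)[OF integrable_\<delta>[OF ucQ]])
      then have "integrable S.MI (\<lambda>s. \<bar>ub s - c\<bar> powr p * \<delta> s)" using S.measure_M1 by simp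
      from S.integrable_fst_MQ(2)[OF this] show ?thesis
        unfolding Z_def using ubm by (simp add: integral_N0)
    qed
    have mZ: "m * Z \<le> (1 + \<kappa>) powr p * E"
    proof -
      have "m * Z \<le> (\<integral>s. \<bar>hb s\<bar> powr p * \<delta> s \<partial>S.MI)"
        using c hbm unfolding Z_def by (simp add: integral_N0)
      also have "\<dots> \<le> (\<integral>z. \<bar>h1 z\<bar> powr p * \<delta> (fst z) \<partial>S.MQ)"
        unfolding hb_def by (rule integral_average_le(2)[OF h1m D1(2)])
      also have "\<dots> \<le> (1 + \<kappa>) powr p * E" unfolding E_def by (rule D1(3))
      finally show ?thesis .
    qed
    have uubi: "integrable S.MQ (\<lambda>z. \<bar>u z - ub (fst z)\<bar> powr p)"
    proof -
      interpret MQ: finite_measure S.MQ by (rule S.finite_MQ)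
      show ?thesis
        by (rule MQ.integrable_powr_diff[OF um measurable_compose[OF S.measurable_fst_MQ ubm] up S.integrable_fst_MQ(1)[OF ubp] p])
    qed
    have osc: "(\<integral>z. \<bar>u z - ub (fst z)\<bar> powr p * \<delta> (fst z) \<partial>S.MQ) \<le> (e * \<Delta>) powr p * E"
    proof -
      have ah2: "(\<lambda>z. \<bar>h2 z\<bar>) \<in> borel_measurable S.MQ" "integrable S.MQ (\<lambda>z. \<bar>\<bar>h2 z\<bar>\<bar> powr p)"
        using h2m D2(2) by simp_all
      define A where "A s = (\<integral>t. \<bar>h2 (s, t)\<bar> \<partial>S.M1)" for s
      note avg = integral_average_le[OF ah2, folded A_def]
      have iA: "integrable S.MQ (\<lambda>z. \<bar>A (fst z)\<bar> powr p * \<delta> (fst z))"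
        by (rule S.integrable_fst_MQ(1)[OF avg(1)])
      have so: "AE z in S.MQ. \<bar>u z - (\<integral>t. u (fst z, t) \<partial>S.M1)\<bar> \<le> (\<integral>t. \<bar>h2 (fst z, t)\<bar> \<partial>S.M1)"
        by (rule S.slice_oscillation[OF ui D2(1) weak(2)])
      have "(\<integral>z. \<bar>u z - ub (fst z)\<bar> powr p * \<delta> (fst z) \<partial>S.MQ) \<le> (\<integral>z. \<bar>A (fst z)\<bar> powr p * \<delta> (fst z) \<partial>S.MQ)"
      proof (rule integral_mono_AE[OF integrable_\<delta>[OF uubi] iA])
        show "AE z in S.MQ. \<bar>u z - ub (fst z)\<bar> powr p * \<delta> (fst z) \<le> \<bar>A (fst z)\<bar> powr p * \<delta> (fst z)"
          using so AE_space[of S.MQ]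
        proof eventually_elim
          case (elim z)
          then have "\<bar>u z - ub (fst z)\<bar> \<le> \<bar>A (fst z)\<bar>" by (simp add: ub_def A_def)
          then have "\<bar>u z - ub (fst z)\<bar> powr p \<le> \<bar>A (fst z)\<bar> powr p" using p by (intro powr_mono2) auto
          then show ?case using \<delta>_pos[OF space_MQ(2)[OF elim(2)]] by (intro mult_right_mono) auto
        qed
      qed
      also have "\<dots> = (\<integral>s. \<bar>A s\<bar> powr p * \<delta> s \<partial>S.MI)" by (rule S.integrable_fst_MQ(2)[OF avg(1)])
      also have "\<dots> \<le> (\<integral>z. \<bar>h2 z\<bar> powr p * \<delta> (fst z) \<partial>S.MQ)" using avg(2) by simp
      also have "\<dots> \<le> (e * \<Delta>) powr p * E" unfolding E_def by (rule D2(3))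
      finally show ?thesis .
    qed
    have uc: "integrable S.MQ (\<lambda>z. \<bar>u z - c\<bar> powr p)"
    proof -
      interpret MQ: finite_measure S.MQ by (rule S.finite_MQ)
      show ?thesis by (rule MQ.integrable_powr_diff[OF um _ up _ p]) (use p in auto)
    qed
    \<comment> \<open>Split u - c into the centred average \<open>ub - c\<close> and the oscillation
      \<open>u - ub\<close>, the latter with weight \<open>l\<close>.\<close>
    have X: "?X \<le> e * (1 + \<kappa>) * ((1 - l) powr (1 - p) * Z + l powr (1 - p) * ((e * \<Delta>) powr p * E))"
    proof -
      have "?X \<le> (\<integral>y. \<bar>v y - c\<bar> powr p \<partial>WD.N)" by (rule WD.competitor_le_diff_const[OF vg])
      also have "\<dots> \<le> e * (1 + \<kappa>) * (\<integral>z. \<bar>v (\<Psi> z) - c\<bar> powr p * \<delta> (fst z) \<partial>S.MQ)"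
        by (rule integral_ND_le) (use vm uc in \<open>auto simp: u_def\<close>)
      also have "(\<integral>z. \<bar>v (\<Psi> z) - c\<bar> powr p * \<delta> (fst z) \<partial>S.MQ) \<le>
        (\<integral>z. (1 - l) powr (1 - p) * (\<bar>ub (fst z) - c\<bar> powr p * \<delta> (fst z)) +
          l powr (1 - p) * (\<bar>u z - ub (fst z)\<bar> powr p * \<delta> (fst z)) \<partial>S.MQ)"
      proof (rule integral_mono)
        show "integrable S.MQ (\<lambda>z. \<bar>v (\<Psi> z) - c\<bar> powr p * \<delta> (fst z))"
          using integrable_\<delta>[OF uc] by (simp add: u_def)
        fix z assume z: "z \<in> space S.MQ"
        have "\<bar>(ub (fst z) - c) + (u z - ub (fst z))\<bar> powr p \<le>
          (1 - l) powr (1 - p) * \<bar>ub (fst z) - c\<bar> powr p + l powr (1 - p) * \<bar>u z - ub (fst z)\<bar> powr p"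
          by (rule powr_abs_convex[OF p l])
        then have "\<bar>v (\<Psi> z) - c\<bar> powr p * \<delta> (fst z) \<le>
          ((1 - l) powr (1 - p) * \<bar>ub (fst z) - c\<bar> powr p + l powr (1 - p) * \<bar>u z - ub (fst z)\<bar> powr p) * \<delta> (fst z)"
          using \<delta>_pos[OF space_MQ(2)[OF z]] by (intro mult_right_mono) (auto simp: u_def)
        then show "\<bar>v (\<Psi> z) - c\<bar> powr p * \<delta> (fst z) \<le> (1 - l) powr (1 - p) * (\<bar>ub (fst z) - c\<bar> powr p * \<delta> (fst z)) +
          l powr (1 - p) * (\<bar>u z - ub (fst z)\<bar> powr p * \<delta> (fst z))"
          by (simp add: algebra_simps)
      qed (use integrable_\<delta>[OF ucQ] integrable_\<delta>[OF uubi] in auto)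
      also have "\<dots> = (1 - l) powr (1 - p) * Z + l powr (1 - p) * (\<integral>z. \<bar>u z - ub (fst z)\<bar> powr p * \<delta> (fst z) \<partial>S.MQ)"
        unfolding Z[symmetric] using integrable_\<delta>[OF ucQ] integrable_\<delta>[OF uubi] by simp
      also have "\<dots> \<le> (1 - l) powr (1 - p) * Z + l powr (1 - p) * ((e * \<Delta>) powr p * E)"
        using osc by (intro add_left_mono mult_left_mono) auto
      finally show ?thesis using e \<kappa> by (simp add: mult_left_mono)
    qed
    have Y: "e * (1 - \<kappa>) * E \<le> ?Y"
      unfolding E_def G_def by (rule integral_ND_ge) (use ngm Gp in \<open>auto simp: G_def\<close>)
    define R where "R = (1 - l) powr (1 - p) * (1 + \<kappa>) powr p + m * (l powr (1 - p) * (e * \<Delta>) powr p)"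
    have R0: "0 \<le> R" unfolding R_def using m0 by (intro add_nonneg_nonneg mult_nonneg_nonneg) auto
    \<comment> \<open>\<open>E\<close> is the energy in chart coordinates. The product
      \<open>m * Z\<close> is estimated as a unit, never divided by \<open>m\<close>, so a vanishing
      \<open>m\<close> needs no separate treatment.\<close>
    have "m * ?X \<le> m * (e * (1 + \<kappa>) * ((1 - l) powr (1 - p) * Z + l powr (1 - p) * ((e * \<Delta>) powr p * E)))"
      by (rule mult_left_mono[OF X m0])
    also have "\<dots> = e * (1 + \<kappa>) * ((1 - l) powr (1 - p) * (m * Z) + m * (l powr (1 - p) * (e * \<Delta>) powr p) * E)"
      by (simp add: algebra_simps)
    also have "\<dots> \<le> e * (1 + \<kappa>) * ((1 - l) powr (1 - p) * ((1 + \<kappa>) powr p * E) + m * (l powr (1 - p) * (e * \<Delta>) powr p) * E)"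
      using mZ e \<kappa> by (intro mult_left_mono add_right_mono) auto
    also have "\<dots> = (1 + \<kappa>) / (1 - \<kappa>) * R * (e * (1 - \<kappa>) * E)"
      using \<kappa> by (simp add: R_def field_simps)
    also have "\<dots> \<le> (1 + \<kappa>) / (1 - \<kappa>) * R * ?Y"
      using Y R0 \<kappa> by (intro mult_left_mono mult_nonneg_nonneg divide_nonneg_nonneg) auto
    finally have "m * ?X \<le> B * ?Y" by (simp add: B_def R_def)
    then show "m / B * ?X \<le> ?Y" using Bpos by (simp add: field_simps)
  qed
qed

end

section \<open>The strip along the curve\<close>

lemma smooth_on_ivl_differentiable: "smooth_on_ivl L f \<Longrightarrow> f differentiable_on {0..L}"
  unfolding smooth_on_ivl_def by (metis funpow_0)

lemma smooth_on_ivl_deriv: "smooth_on_ivl L f \<Longrightarrow> smooth_on_ivl L (ivl_deriv L f)"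
  unfolding smooth_on_ivl_def by (metis comp_apply funpow_Suc_right)

lemma smooth_on_ivl_continuous: "smooth_on_ivl L f \<Longrightarrow> continuous_on {0..L} f"
  by (intro differentiable_imp_continuous_on smooth_on_ivl_differentiable)

lemma smooth_on_ivl_has_derivative:
  assumes "smooth_on_ivl L f" "s \<in> {0<..<L}"
  shows "(f has_real_derivative ivl_deriv L f s) (at s)"
proof -
  have "f differentiable (at s within {0..L})"
    using smooth_on_ivl_differentiable[OF assms(1)] assms(2) by (auto simp: differentiable_on_def)
  then have "(f has_vector_derivative ivl_deriv L f s) (at s within {0..L})"
    unfolding ivl_deriv_def by (simp add: vector_derivative_works)
  moreover have "at s within {0..L} = at s" using assms(2) by (intro at_within_interior) auto
  ultimately show ?thesis by (simp add: has_real_derivative_iff_has_vector_derivative)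
qed

lemma has_derivative_compose_fst:
  fixes z :: "real \<times> real"
  assumes "(f has_real_derivative f') (at (fst z))"
  shows "((\<lambda>z. f (fst z)) has_derivative (\<lambda>h. fst h * f')) (at z)"
  using has_derivative_compose[OF has_derivative_fst[OF has_derivative_ident] assms[unfolded has_field_derivative_def]]
  by (simp add: mult.commute)

lemma continuous_on_bounded_ivl:
  fixes f :: "real \<Rightarrow> real"
  assumes "continuous_on {0..L} f"
  shows "\<exists>C. \<forall>s\<in>{0..L}. \<bar>f s\<bar> \<le> C"
proof -
  have "bounded (f ` {0..L})" using assms by (intro compact_imp_bounded compact_continuous_image) auto
  then show ?thesis by (auto simp: bounded_iff)
qed

text \<open>A unit vector perturbed by at most k/2 in each coordinate; expanding gives 1 + 2k +
  k^2/2. The halves are the reason for the factor 2 in \<kappa> = 2 C e.\<close>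

lemma unit_perturbation:
  fixes a b k u v :: real
  assumes u: "u\<^sup>2 + v\<^sup>2 = 1" and a: "\<bar>a\<bar> \<le> k / 2" and b: "\<bar>b\<bar> \<le> k / 2" and k: "0 \<le> k"
  shows "(u + a)\<^sup>2 + (v - b)\<^sup>2 \<le> (1 + k)\<^sup>2"
proof -
  have "u\<^sup>2 \<le> 1" "v\<^sup>2 \<le> 1" using u zero_le_power2[of u] zero_le_power2[of v] by linarith+
  then have "\<bar>u\<bar> \<le> 1" "\<bar>v\<bar> \<le> 1" by (simp_all add: abs_square_le_1)
  then have "\<bar>u\<bar> * \<bar>a\<bar> \<le> 1 * (k / 2)" and "\<bar>v\<bar> * \<bar>b\<bar> \<le> 1 * (k / 2)"
    using a b by (simp_all only: mult_mono abs_ge_zero zero_le_one)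
  then have ua: "u * a \<le> k / 2" and vb: "- (v * b) \<le> k / 2"
    by (auto simp: abs_mult[symmetric])
  have a2: "a\<^sup>2 \<le> (k / 2)\<^sup>2" and b2: "b\<^sup>2 \<le> (k / 2)\<^sup>2"
    using a b k by (simp_all add: abs_le_square_iff[symmetric])
  have "(u + a)\<^sup>2 + (v - b)\<^sup>2 = (u\<^sup>2 + v\<^sup>2) + 2 * (u * a) + 2 * (- (v * b)) + a\<^sup>2 + b\<^sup>2"
    by (simp add: power2_sum power2_diff)
  also have "\<dots> \<le> 1 + 2 * (k / 2) + 2 * (k / 2) + (k / 2)\<^sup>2 + (k / 2)\<^sup>2"
    using u ua vb a2 b2 by linarith
  also have "\<dots> = 1 + 2 * k + k\<^sup>2 / 2" by (simp add: power_divide)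
  also have "\<dots> \<le> (1 + k)\<^sup>2" by (simp add: power2_sum)
  finally show ?thesis .
qed

locale strip =
  fixes L p :: real and x y \<delta> :: "real \<Rightarrow> real"
  assumes L: "L > 0" and p: "p > 1"
    and smooth_x: "smooth_on_ivl L x" and smooth_y: "smooth_on_ivl L y"
    and arc_length: "\<And>s. s \<in> {0..L} \<Longrightarrow> (ivl_deriv L x s)\<^sup>2 + (ivl_deriv L y s)\<^sup>2 = 1"
    and smooth_\<delta>: "smooth_on_ivl L \<delta>"
    and \<delta>_pos: "\<And>s. s \<in> {0..L} \<Longrightarrow> \<delta> s > 0"
    and injective: "inj_on (normal_map L x y) (closure (subgraph_domain L \<delta>))"
    and jacobian_pos: "\<And>s r. (s, r) \<in> closure (subgraph_domain L \<delta>) \<Longrightarrow> 1 + r * signed_curvature L x y s > 0"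
begin

abbreviation "x1 \<equiv> ivl_deriv L x"
abbreviation "x2 \<equiv> ivl_deriv L x1"
abbreviation "x3 \<equiv> ivl_deriv L x2"
abbreviation "y1 \<equiv> ivl_deriv L y"
abbreviation "y2 \<equiv> ivl_deriv L y1"
abbreviation "y3 \<equiv> ivl_deriv L y2"
abbreviation "\<delta>1 \<equiv> ivl_deriv L \<delta>"
abbreviation "\<delta>2 \<equiv> ivl_deriv L \<delta>1"
abbreviation "curv \<equiv> signed_curvature L x y"
abbreviation "Q \<equiv> {0<..<L} \<times> {0<..<1::real}"

lemmas smooths = smooth_x smooth_x[THEN smooth_on_ivl_deriv] smooth_x[THEN smooth_on_ivl_deriv, THEN smooth_on_ivl_deriv]
  smooth_x[THEN smooth_on_ivl_deriv, THEN smooth_on_ivl_deriv, THEN smooth_on_ivl_deriv]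
  smooth_y smooth_y[THEN smooth_on_ivl_deriv] smooth_y[THEN smooth_on_ivl_deriv, THEN smooth_on_ivl_deriv]
  smooth_y[THEN smooth_on_ivl_deriv, THEN smooth_on_ivl_deriv, THEN smooth_on_ivl_deriv]
  smooth_\<delta> smooth_\<delta>[THEN smooth_on_ivl_deriv] smooth_\<delta>[THEN smooth_on_ivl_deriv, THEN smooth_on_ivl_deriv]

lemmas continuous_ivl = smooths[THEN smooth_on_ivl_continuous]

lemma continuous_Q: "continuous_on {0..L} f \<Longrightarrow> continuous_on Q (\<lambda>z. f (fst z))" for f :: "real \<Rightarrow> real"
  by (rule continuous_on_compose2[of "{0..L}"]) (auto intro: continuous_intros)

lemmas continuous_Q' = continuous_ivl[THEN continuous_Q]

lemma derivatives_Q: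
  assumes "z \<in> Q"
  shows "((\<lambda>z. x (fst z)) has_derivative (\<lambda>h. fst h * x1 (fst z))) (at z)"
    "((\<lambda>z. x1 (fst z)) has_derivative (\<lambda>h. fst h * x2 (fst z))) (at z)"
    "((\<lambda>z. x2 (fst z)) has_derivative (\<lambda>h. fst h * x3 (fst z))) (at z)"
    "((\<lambda>z. y (fst z)) has_derivative (\<lambda>h. fst h * y1 (fst z))) (at z)"
    "((\<lambda>z. y1 (fst z)) has_derivative (\<lambda>h. fst h * y2 (fst z))) (at z)"
    "((\<lambda>z. y2 (fst z)) has_derivative (\<lambda>h. fst h * y3 (fst z))) (at z)"
    "((\<lambda>z. \<delta> (fst z)) has_derivative (\<lambda>h. fst h * \<delta>1 (fst z))) (at z)"
    "((\<lambda>z. \<delta>1 (fst z)) has_derivative (\<lambda>h. fst h * \<delta>2 (fst z))) (at z)"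
  using assms by (auto intro!: has_derivative_compose_fst smooth_on_ivl_has_derivative smooths)

text \<open>The fibre coordinate runs from the outer boundary to the curve, so that the chart preserves
  orientation.\<close>

definition chart :: "real \<Rightarrow> real \<times> real \<Rightarrow> real \<times> real" where
  "chart e z = (x (fst z) + e * (1 - snd z) * \<delta> (fst z) * y1 (fst z), y (fst z) - e * (1 - snd z) * \<delta> (fst z) * x1 (fst z))"

definition chart_Ps where "chart_Ps e z = x1 (fst z) + e * (1 - snd z) * (\<delta>1 (fst z) * y1 (fst z) + \<delta> (fst z) * y2 (fst z))" for z :: "real \<times> real"
definition chart_Pt where "chart_Pt e z = - e * \<delta> (fst z) * y1 (fst z)" for z :: "real \<times> real"
definition chart_Rs where "chart_Rs e z = y1 (fst z) - e * (1 - snd z) * (\<delta>1 (fst z) * x1 (fst z) + \<delta> (fst z) * x2 (fst z))" for z :: "real \<times> real"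
definition chart_Rt where "chart_Rt e z = e * \<delta> (fst z) * x1 (fst z)" for z :: "real \<times> real"
definition chart_Pss where "chart_Pss e z = x2 (fst z) + e * (1 - snd z) * (\<delta>2 (fst z) * y1 (fst z) + 2 * \<delta>1 (fst z) * y2 (fst z) + \<delta> (fst z) * y3 (fst z))" for z :: "real \<times> real"
definition chart_Pst where "chart_Pst e z = - e * (\<delta>1 (fst z) * y1 (fst z) + \<delta> (fst z) * y2 (fst z))" for z :: "real \<times> real"
definition chart_Rss where "chart_Rss e z = y2 (fst z) - e * (1 - snd z) * (\<delta>2 (fst z) * x1 (fst z) + 2 * \<delta>1 (fst z) * x2 (fst z) + \<delta> (fst z) * x3 (fst z))" for z :: "real \<times> real"
definition chart_Rst where "chart_Rst e z = e * (\<delta>1 (fst z) * x1 (fst z) + \<delta> (fst z) * x2 (fst z))" for z :: "real \<times> real"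

lemmas chart_defs = chart_Ps_def chart_Pt_def chart_Rs_def chart_Rt_def chart_Pss_def chart_Pst_def chart_Rss_def chart_Rst_def

lemma chart_normal_map: "chart e z = normal_map L x y (fst z, e * (1 - snd z) * \<delta> (fst z))"
  by (simp add: chart_def normal_map_def)

lemma chart_image:
  assumes e: "0 < e"
  shows "chart e ` Q = thin_strip L x y \<delta> e"
proof -
  have "(\<lambda>z. (fst z, e * (1 - snd z) * \<delta> (fst z))) ` Q = subgraph_domain L (\<lambda>s. e * \<delta> s)"
  proof (intro equalityI subsetI)
    fix w assume "w \<in> (\<lambda>z. (fst z, e * (1 - snd z) * \<delta> (fst z))) ` Q"
    then obtain s t where st: "0 < s" "s < L" "0 < t" "t < 1" "w = (s, e * (1 - t) * \<delta> s)" by auto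
    then have "0 < e * \<delta> s" using e \<delta>_pos[of s] by simp
    then have "0 < (1 - t) * (e * \<delta> s)" "(1 - t) * (e * \<delta> s) < 1 * (e * \<delta> s)"
      using st by (simp, intro mult_strict_right_mono) auto
    then show "w \<in> subgraph_domain L (\<lambda>s. e * \<delta> s)" using st by (simp add: subgraph_domain_def mult_ac)
  next
    fix w assume "w \<in> subgraph_domain L (\<lambda>s. e * \<delta> s)"
    then obtain s r where sr: "0 < s" "s < L" "0 < r" "r < e * \<delta> s" "w = (s, r)" by (auto simp: subgraph_domain_def)
    have d: "0 < e * \<delta> s" using e \<delta>_pos[of s] sr by simp
    show "w \<in> (\<lambda>z. (fst z, e * (1 - snd z) * \<delta> (fst z))) ` Q"
      by (rule image_eqI[of _ _ "(s, 1 - r / (e * \<delta> s))"]) (use sr d in \<open>auto simp: field_simps\<close>)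
  qed
  moreover have "chart e ` Q = normal_map L x y ` ((\<lambda>z. (fst z, e * (1 - snd z) * \<delta> (fst z))) ` Q)"
    unfolding image_image by (rule image_cong[OF refl chart_normal_map])
  ultimately show ?thesis unfolding thin_strip_def by simp
qed

text \<open>For thickness at most 1 the normal coordinates stay inside the original domain, so
  injectivity and positivity of the Jacobian are inherited by every thin strip.\<close>

lemma in_closure_subgraph:
  assumes "0 < e" "e \<le> 1" "z \<in> Q"
  shows "(fst z, e * (1 - snd z) * \<delta> (fst z)) \<in> closure (subgraph_domain L \<delta>)"
proof -
  have d: "0 < \<delta> (fst z)" using assms \<delta>_pos[of "fst z"] by auto
  have t: "0 < 1 - snd z" "1 - snd z < 1" using assms by auto
  have "e * (1 - snd z) \<le> 1 * (1 - snd z)" using assms t by (intro mult_right_mono) auto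
  also have "\<dots> < 1" using t(2) by simp
  finally have "e * (1 - snd z) < 1" .
  moreover have "0 < e * (1 - snd z)" using assms(1) t(1) by (rule mult_pos_pos)
  ultimately have "0 < e * (1 - snd z) * \<delta> (fst z)" "e * (1 - snd z) * \<delta> (fst z) < 1 * \<delta> (fst z)"
    using d by (simp_all only: mult_pos_pos mult_strict_right_mono)
  then have "(fst z, e * (1 - snd z) * \<delta> (fst z)) \<in> subgraph_domain L \<delta>"
    using assms by (auto simp: subgraph_domain_def)
  then show ?thesis by (rule subsetD[OF closure_subset])
qed

text \<open>The terms with the derivative of \<delta> cancel, since shearing along the fibres does
  not change area; parametrization by arc length turns the sum of squares into 1.\<close>

lemma jacobian_eq:
  assumes "z \<in> Q"
  shows "chart_Ps e z * chart_Rt e z - chart_Pt e z * chart_Rs e z =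
    e * \<delta> (fst z) * (1 + e * (1 - snd z) * \<delta> (fst z) * curv (fst z))"
proof -
  have "chart_Ps e z * chart_Rt e z - chart_Pt e z * chart_Rs e z =
    e * \<delta> (fst z) * ((x1 (fst z))\<^sup>2 + (y1 (fst z))\<^sup>2 + e * (1 - snd z) * \<delta> (fst z) * curv (fst z))"
    by (simp add: chart_defs signed_curvature_def power2_eq_square algebra_simps)
  then show ?thesis using arc_length[of "fst z"] assms by auto
qed

text \<open>The chart is affine along fibres, so both pure second derivatives in t are zero. The
  image has finite measure because it lies in the continuous image of a compact rectangle.\<close>

lemma C2_chart:
  assumes e: "0 < e" "e \<le> 1"
  shows "planar_C2_chart Q (chart e) (chart_Ps e) (chart_Pt e) (chart_Rs e) (chart_Rt e)
    (chart_Pss e) (chart_Pst e) (\<lambda>_. 0) (chart_Rss e) (chart_Rst e) (\<lambda>_. 0)"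
proof
  show oQ: "open Q" by (intro open_Times) auto
  show inj: "inj_on (chart e) Q"
  proof (rule inj_onI)
    fix z w assume zw: "z \<in> Q" "w \<in> Q" "chart e z = chart e w"
    then have eq: "(fst z, e * (1 - snd z) * \<delta> (fst z)) = (fst w, e * (1 - snd w) * \<delta> (fst w))"
      using inj_onD[OF injective, OF _ in_closure_subgraph[OF e] in_closure_subgraph[OF e]]
      by (metis chart_normal_map)
    moreover have "\<delta> (fst w) > 0" using zw \<delta>_pos[of "fst w"] by auto
    ultimately show "z = w" using e by (auto simp: prod_eq_iff)
  qed
  fix z assume z: "z \<in> Q"
  note d = derivatives_Q[OF z]
  show der: "(chart e has_derivative (\<lambda>h. (fst h * chart_Ps e z + snd h * chart_Pt e z, fst h * chart_Rs e z + snd h * chart_Rt e z))) (at z)"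
    unfolding chart_def[abs_def]
    by (rule has_derivative_eq_rhs, (rule derivative_intros d)+) (simp add: fun_eq_iff chart_defs algebra_simps)
  show "(chart_Ps e has_derivative (\<lambda>h. fst h * chart_Pss e z + snd h * chart_Pst e z)) (at z)"
    unfolding chart_Ps_def[abs_def]
    by (rule has_derivative_eq_rhs, (rule derivative_intros d)+) (simp add: fun_eq_iff chart_defs algebra_simps)
  show "(chart_Pt e has_derivative (\<lambda>h. fst h * chart_Pst e z + snd h * 0)) (at z)"
    unfolding chart_Pt_def[abs_def]
    by (rule has_derivative_eq_rhs, (rule derivative_intros d)+) (simp add: fun_eq_iff chart_defs algebra_simps)
  show "(chart_Rs e has_derivative (\<lambda>h. fst h * chart_Rss e z + snd h * chart_Rst e z)) (at z)"
    unfolding chart_Rs_def[abs_def]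
    by (rule has_derivative_eq_rhs, (rule derivative_intros d)+) (simp add: fun_eq_iff chart_defs algebra_simps)
  show "(chart_Rt e has_derivative (\<lambda>h. fst h * chart_Rst e z + snd h * 0)) (at z)"
    unfolding chart_Rt_def[abs_def]
    by (rule has_derivative_eq_rhs, (rule derivative_intros d)+) (simp add: fun_eq_iff chart_defs algebra_simps)
  show "0 < chart_Ps e z * chart_Rt e z - chart_Pt e z * chart_Rs e z"
    unfolding jacobian_eq[OF z]
  proof (intro mult_pos_pos e)
    show "0 < \<delta> (fst z)" using z \<delta>_pos[of "fst z"] by auto
    show "0 < 1 + e * (1 - snd z) * \<delta> (fst z) * curv (fst z)"
      using jacobian_pos[OF in_closure_subgraph[OF e z]] by simp
  qed
next
  show c: "continuous_on Q (chart_Ps e)" "continuous_on Q (chart_Pt e)" "continuous_on Q (chart_Rs e)" "continuous_on Q (chart_Rt e)"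
    "continuous_on Q (chart_Pss e)" "continuous_on Q (chart_Pst e)" "continuous_on Q (chart_Rss e)" "continuous_on Q (chart_Rst e)"
    unfolding chart_defs by (intro continuous_intros continuous_Q')+
  have "chart e ` Q \<subseteq> (\<lambda>z. (x (fst z) + e * (1 - snd z) * \<delta> (fst z) * y1 (fst z), y (fst z) - e * (1 - snd z) * \<delta> (fst z) * x1 (fst z))) ` ({0..L} \<times> {0..1})"
    by (auto simp: chart_def)
  moreover have "compact ((\<lambda>z. (x (fst z) + e * (1 - snd z) * \<delta> (fst z) * y1 (fst z), y (fst z) - e * (1 - snd z) * \<delta> (fst z) * x1 (fst z))) ` ({0..L} \<times> {0..1}))"
  proof (rule compact_continuous_image)
    have "continuous_on ({0..L} \<times> {0..1::real}) (\<lambda>z. f (fst z))" if "continuous_on {0..L} f" for f :: "real \<Rightarrow> real"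
      using that by (rule continuous_on_compose2) (auto intro: continuous_intros)
    note * = continuous_ivl[THEN this]
    show "continuous_on ({0..L} \<times> {0..1}) (\<lambda>z. (x (fst z) + e * (1 - snd z) * \<delta> (fst z) * y1 (fst z), y (fst z) - e * (1 - snd z) * \<delta> (fst z) * x1 (fst z)))"
      by (intro continuous_intros *)
  qed (auto intro: compact_Times)
  ultimately have "bounded (chart e ` Q)" using bounded_subset compact_imp_bounded by blast
  then show "emeasure lborel (chart e ` Q) < \<infinity>" by (rule emeasure_bounded_finite)
qed (auto intro: continuous_intros)

lemma exists_bounds:
  "\<exists>C c. 0 < C \<and> 0 < c \<and> (\<forall>s\<in>{0..L}. c \<le> \<delta> s \<and> \<delta> s \<le> C \<and> \<bar>\<delta> s * curv s\<bar> \<le> C \<and>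
    \<bar>\<delta>1 s * y1 s + \<delta> s * y2 s\<bar> \<le> C \<and> \<bar>\<delta>1 s * x1 s + \<delta> s * x2 s\<bar> \<le> C)"
proof -
  have c1: "continuous_on {0..L} (\<lambda>s. \<delta> s * curv s)"
    unfolding signed_curvature_def by (intro continuous_intros continuous_ivl)
  have c2: "continuous_on {0..L} (\<lambda>s. \<delta>1 s * y1 s + \<delta> s * y2 s)" "continuous_on {0..L} (\<lambda>s. \<delta>1 s * x1 s + \<delta> s * x2 s)"
    by (intro continuous_intros continuous_ivl)+
  obtain C1 where C1: "\<forall>s\<in>{0..L}. \<bar>\<delta> s * curv s\<bar> \<le> C1" using continuous_on_bounded_ivl[OF c1] by blast
  obtain C2 where C2: "\<forall>s\<in>{0..L}. \<bar>\<delta>1 s * y1 s + \<delta> s * y2 s\<bar> \<le> C2" using continuous_on_bounded_ivl[OF c2(1)] by blast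
  obtain C3 where C3: "\<forall>s\<in>{0..L}. \<bar>\<delta>1 s * x1 s + \<delta> s * x2 s\<bar> \<le> C3" using continuous_on_bounded_ivl[OF c2(2)] by blast
  obtain C4 where C4: "\<forall>s\<in>{0..L}. \<bar>\<delta> s\<bar> \<le> C4" using continuous_on_bounded_ivl[OF continuous_ivl(9)] by blast
  obtain s0 where s0: "s0 \<in> {0..L}" "\<And>s. s \<in> {0..L} \<Longrightarrow> \<delta> s0 \<le> \<delta> s"
    using continuous_attains_inf[OF compact_Icc _ continuous_ivl(9)] L by auto
  let ?C = "max (max C1 C2) (max (max C3 C4) 1)"
  have "\<delta> s \<le> ?C" "\<bar>\<delta> s * curv s\<bar> \<le> ?C" "\<bar>\<delta>1 s * y1 s + \<delta> s * y2 s\<bar> \<le> ?C" "\<bar>\<delta>1 s * x1 s + \<delta> s * x2 s\<bar> \<le> ?C"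
    if "s \<in> {0..L}" for s
    using C1[THEN bspec, OF that] C2[THEN bspec, OF that] C3[THEN bspec, OF that] C4[THEN bspec, OF that]
    by linarith+
  moreover have "0 < \<delta> s0" by (rule \<delta>_pos[OF s0(1)])
  ultimately show ?thesis using s0(2) by (intro exI[of _ ?C] exI[of _ "\<delta> s0"]) (auto simp: less_max_iff_disj)
qed

text \<open>One \<open>C\<close>, independent of \<open>e\<close>, dominates \<delta>, the curvature
  term and the perturbation of the tangent. The condition \<open>2 * C * e < 1\<close> says \<kappa>
  < 1, and \<open>e < 1\<close> makes \<open>sqrt e\<close> an admissible splitting weight.\<close>

lemma eigenvalue_bounds:
  "\<exists>C>0. \<forall>e. 0 < e \<longrightarrow> e < 1 \<longrightarrow> 2 * C * e < 1 \<longrightarrow>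
    (let \<kappa> = 2 * C * e; m = weighted_neumann_mu1 p {0<..<L} \<delta>; m' = neumann_mu1 p (thin_strip L x y \<delta> e) in
      m' \<le> m / ((1 - \<kappa>) powr (p + 1) / (1 + \<kappa>)) \<and>
      m / ((1 + \<kappa>) / (1 - \<kappa>) * ((1 - sqrt e) powr (1 - p) * (1 + \<kappa>) powr p + m * (sqrt e powr (1 - p) * (e * C) powr p))) \<le> m')"
proof -
  obtain C c where C: "0 < C" "0 < c" and all: "\<forall>s\<in>{0..L}. c \<le> \<delta> s \<and> \<delta> s \<le> C \<and> \<bar>\<delta> s * curv s\<bar> \<le> C \<and>
    \<bar>\<delta>1 s * y1 s + \<delta> s * y2 s\<bar> \<le> C \<and> \<bar>\<delta>1 s * x1 s + \<delta> s * x2 s\<bar> \<le> C"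
    using exists_bounds by blast
  have bd: "c \<le> \<delta> s" "\<delta> s \<le> C" "\<bar>\<delta> s * curv s\<bar> \<le> C" "\<bar>\<delta>1 s * y1 s + \<delta> s * y2 s\<bar> \<le> C"
    "\<bar>\<delta>1 s * x1 s + \<delta> s * x2 s\<bar> \<le> C" if "s \<in> {0..L}" for s
    using all that by blast+
  show ?thesis
  proof (intro exI[of _ C] conjI allI impI C(1))
    fix e :: real assume e: "0 < e" "e < 1" and Ce: "2 * C * e < 1"
    define \<kappa> where "\<kappa> = 2 * C * e"
    have \<kappa>: "0 \<le> \<kappa>" "\<kappa> < 1" using C e Ce by (auto simp: \<kappa>_def)
    interpret S: slicing L by standard (rule L)
    interpret Ch: planar_C2_chart Q "chart e" "chart_Ps e" "chart_Pt e" "chart_Rs e" "chart_Rt e"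
      "chart_Pss e" "chart_Pst e" "\<lambda>_. 0" "chart_Rss e" "chart_Rst e" "\<lambda>_. 0"
      using e by (intro C2_chart) auto
    interpret W0: weighted_domain "{0<..<L}" \<delta> C p
    proof
      have "continuous_on {0<..<L} \<delta>" by (rule continuous_on_subset[OF continuous_ivl(9)]) auto
      then show "\<delta> \<in> borel_measurable (restrict_space lborel {0<..<L})"
        using borel_measurable_continuous_on_restrict[of "{0<..<L}" \<delta>] by (simp cong: measurable_cong_sets)
    qed (use p L bd \<delta>_pos in auto)
    have J: "Ch.J z = e * \<delta> (fst z) * (1 + e * (1 - snd z) * \<delta> (fst z) * curv (fst z))"
      and Jb: "\<bar>e * (1 - snd z) * \<delta> (fst z) * curv (fst z)\<bar> \<le> \<kappa>"
      and ed: "0 < e * \<delta> (fst z)" if z: "z \<in> Q" for z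
    proof -
      show "Ch.J z = e * \<delta> (fst z) * (1 + e * (1 - snd z) * \<delta> (fst z) * curv (fst z))"
        unfolding Ch.J_def by (rule jacobian_eq[OF z])
      have s: "fst z \<in> {0..L}" and t: "0 \<le> 1 - snd z" "1 - snd z \<le> 1" using z by auto
      have "\<bar>e * (1 - snd z) * \<delta> (fst z) * curv (fst z)\<bar> = e * (1 - snd z) * \<bar>\<delta> (fst z) * curv (fst z)\<bar>"
        using e t by (simp add: abs_mult)
      also have "\<dots> \<le> e * 1 * C" using e t bd(3)[OF s] by (intro mult_mono) auto
      also have "\<dots> \<le> \<kappa>" using e C by (simp add: \<kappa>_def)
      finally show "\<bar>e * (1 - snd z) * \<delta> (fst z) * curv (fst z)\<bar> \<le> \<kappa>" .
      show "0 < e * \<delta> (fst z)" using e \<delta>_pos[OF s] by simp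
    qed
    interpret T: thin_chart L "chart e" "chart_Ps e" "chart_Pt e" "chart_Rs e" "chart_Rt e"
      "chart_Pss e" "chart_Pst e" "\<lambda>_. 0" "chart_Rss e" "chart_Rst e" "\<lambda>_. 0" \<delta> C p e \<kappa> c
    proof
      show "0 < e" "0 \<le> \<kappa>" "\<kappa> < 1" "0 < c" by (fact e \<kappa> C)+
      show "c \<le> \<delta> s" if "s \<in> {0<..<L}" for s using bd(1)[of s] that by simp
      fix z assume z: "z \<in> Q"
      have s: "fst z \<in> {0..L}" and t: "0 \<le> 1 - snd z" "1 - snd z \<le> 1" using z by auto
      let ?q = "e * (1 - snd z) * \<delta> (fst z) * curv (fst z)"
      have "e * \<delta> (fst z) * (1 - \<kappa>) \<le> e * \<delta> (fst z) * (1 + ?q)" "e * \<delta> (fst z) * (1 + ?q) \<le> e * \<delta> (fst z) * (1 + \<kappa>)"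
        using Jb[OF z] ed[OF z] by (intro mult_left_mono; linarith)+
      then show "e * (1 - \<kappa>) * \<delta> (fst z) \<le> Ch.J z" "Ch.J z \<le> e * (1 + \<kappa>) * \<delta> (fst z)"
        unfolding J[OF z] by (simp_all only: mult_ac)
      have "(chart_Pt e z)\<^sup>2 + (chart_Rt e z)\<^sup>2 = (e * \<delta> (fst z))\<^sup>2 * ((x1 (fst z))\<^sup>2 + (y1 (fst z))\<^sup>2)"
        by (simp add: chart_defs power_mult_distrib algebra_simps)
      then show "(chart_Pt e z)\<^sup>2 + (chart_Rt e z)\<^sup>2 = (e * \<delta> (fst z))\<^sup>2" using arc_length[OF s] by simp
      let ?a = "e * (1 - snd z) * (\<delta>1 (fst z) * y1 (fst z) + \<delta> (fst z) * y2 (fst z))"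
      let ?b = "e * (1 - snd z) * (\<delta>1 (fst z) * x1 (fst z) + \<delta> (fst z) * x2 (fst z))"
      have ab: "\<bar>?a\<bar> \<le> \<kappa> / 2" "\<bar>?b\<bar> \<le> \<kappa> / 2"
      proof -
        have "\<bar>e * (1 - snd z) * q\<bar> \<le> \<kappa> / 2" if "\<bar>q\<bar> \<le> C" for q
        proof -
          have "\<bar>e * (1 - snd z) * q\<bar> = e * (1 - snd z) * \<bar>q\<bar>" using e t by (simp add: abs_mult)
          also have "\<dots> \<le> e * 1 * C" using e t that by (intro mult_mono) auto
          finally show ?thesis by (simp add: \<kappa>_def mult.commute)
        qed
        then show "\<bar>?a\<bar> \<le> \<kappa> / 2" "\<bar>?b\<bar> \<le> \<kappa> / 2" using bd(4,5)[OF s] by blast+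
      qed
      show "(chart_Ps e z)\<^sup>2 + (chart_Rs e z)\<^sup>2 \<le> (1 + \<kappa>)\<^sup>2"
        unfolding chart_Ps_def chart_Rs_def by (rule unit_perturbation[OF arc_length[OF s] ab \<kappa>(1)])
    qed
    have D: "neumann_mu1 p (thin_strip L x y \<delta> e) = weighted_neumann_mu1 p (chart e ` Q) (\<lambda>_. 1)"
      unfolding neumann_mu1_def chart_image[OF e(1)] ..
    have pos: "0 < (1 - \<kappa>) powr (p + 1) / (1 + \<kappa>)" using \<kappa> by simp
    have "(1 - \<kappa>) powr (p + 1) / (1 + \<kappa>) * neumann_mu1 p (thin_strip L x y \<delta> e) \<le> weighted_neumann_mu1 p {0<..<L} \<delta>"
      unfolding D by (rule T.mu1_strip_le)
    then have "neumann_mu1 p (thin_strip L x y \<delta> e) \<le> weighted_neumann_mu1 p {0<..<L} \<delta> / ((1 - \<kappa>) powr (p + 1) / (1 + \<kappa>))"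
      by (subst pos_le_divide_eq[OF pos]) (simp only: mult.commute)
    then show "let \<kappa> = 2 * C * e; m = weighted_neumann_mu1 p {0<..<L} \<delta>; m' = neumann_mu1 p (thin_strip L x y \<delta> e) in
      m' \<le> m / ((1 - \<kappa>) powr (p + 1) / (1 + \<kappa>)) \<and>
      m / ((1 + \<kappa>) / (1 - \<kappa>) * ((1 - sqrt e) powr (1 - p) * (1 + \<kappa>) powr p + m * (sqrt e powr (1 - p) * (e * C) powr p))) \<le> m'"
      unfolding Let_def \<kappa>_def[symmetric] D using T.mu1_interval_le[of "sqrt e"] e by simp
  qed
qed

end

section \<open>The limit of vanishing thickness\<close>

theorem theorem1p4:
  fixes L p :: real and x y \<delta> :: "real \<Rightarrow> real"
  assumes L: "L > 0"
    and p: "p > 1"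
    and smooth_curve: "smooth_on_ivl L x" "smooth_on_ivl L y"
    and simple_nonclosed: "inj_on (\<lambda>s. (x s, y s)) {0..L}"
    and arc_length: "\<And>s. s \<in> {0..L} \<Longrightarrow> (ivl_deriv L x s)\<^sup>2 + (ivl_deriv L y s)\<^sup>2 = 1"
    and symmetric: "\<And>s. s \<in> {0..L/2} \<Longrightarrow> x (L - s) = - x s \<and> y (L - s) = y s"
    and smooth_delta: "smooth_on_ivl L \<delta>"
    and delta_pos: "\<And>s. s \<in> {0..L} \<Longrightarrow> \<delta> s > 0"
    and delta_even: "\<And>s. s \<in> {0..L} \<Longrightarrow> \<delta> (L - s) = \<delta> s"
    and injective: "inj_on (normal_map L x y) (closure (subgraph_domain L \<delta>))"
    and jacobian_pos: "\<And>s r. (s, r) \<in> closure (subgraph_domain L \<delta>) \<Longrightarrow>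
        1 + r * signed_curvature L x y s > 0"
  shows "((\<lambda>\<epsilon>. neumann_mu1 p (thin_strip L x y \<delta> \<epsilon>)) \<longlongrightarrow>
      weighted_neumann_mu1 p {0<..<L} \<delta>) (at_right 0)"
proof -
  interpret strip L p x y \<delta>
    using assms by unfold_locales
  define m where "m = weighted_neumann_mu1 p {0<..<L} \<delta>"
  obtain C where C: "0 < C" and bounds: "\<And>e. 0 < e \<Longrightarrow> e < 1 \<Longrightarrow> 2 * C * e < 1 \<Longrightarrow>
      neumann_mu1 p (thin_strip L x y \<delta> e) \<le> m / ((1 - 2 * C * e) powr (p + 1) / (1 + 2 * C * e)) \<and>
      m / ((1 + 2 * C * e) / (1 - 2 * C * e) * ((1 - sqrt e) powr (1 - p) * (1 + 2 * C * e) powr p +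
        m * (sqrt e powr (1 - p) * (e * C) powr p))) \<le> neumann_mu1 p (thin_strip L x y \<delta> e)"
    using eigenvalue_bounds unfolding Let_def m_def by blast
  have e0: "((\<lambda>e::real. e) \<longlongrightarrow> 0) (at_right 0)" by (rule tendsto_ident_at)
  have small: "\<forall>\<^sub>F e in at_right 0. 0 < e \<and> e < 1 \<and> 2 * C * e < 1"
  proof -
    have "\<forall>\<^sub>F e in at_right (0::real). e \<in> {0<..<min 1 (1 / (2 * C))}"
      by (rule eventually_at_right_real) (use C in simp)
    then show ?thesis by eventually_elim (use C in \<open>auto simp: field_simps\<close>)
  qed
  have k: "((\<lambda>e. 2 * C * e) \<longlongrightarrow> 0) (at_right 0)"
    using tendsto_mult[OF tendsto_const e0, of "2 * C"] by simp
  have s: "((\<lambda>e. sqrt e) \<longlongrightarrow> 0) (at_right 0)" using tendsto_real_sqrt[OF e0] by simp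
  \<comment> \<open>The total exponent of \<open>e\<close> is (1 - p)/2 + p = (1 + p)/2, which is
    positive: the smallness of the oscillation outweighs the large convexity factor.\<close>
  have rest: "((\<lambda>e. sqrt e powr (1 - p) * (e * C) powr p) \<longlongrightarrow> 0) (at_right 0)"
  proof -
    have "((\<lambda>e. C powr p * e powr ((1 + p) / 2)) \<longlongrightarrow> C powr p * 0 powr ((1 + p) / 2)) (at_right 0)"
      using p small by (intro tendsto_mult tendsto_const tendsto_powr' e0) (auto elim!: eventually_mono)
    moreover have "\<forall>\<^sub>F e in at_right 0. sqrt e powr (1 - p) * (e * C) powr p = C powr p * e powr ((1 + p) / 2)"
      using small
    proof eventually_elim
      case (elim e)
      have "sqrt e powr (1 - p) = e powr ((1 - p) / 2)"
        using elim by (simp add: powr_half_sqrt[symmetric] powr_powr)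
      moreover have "(e * C) powr p = e powr p * C powr p" using elim C by (simp add: powr_mult)
      ultimately show ?case by (simp add: powr_add[symmetric] field_simps)
    qed
    ultimately show ?thesis using p by (simp add: tendsto_cong)
  qed
  have "((\<lambda>e. m / ((1 - 2 * C * e) powr (p + 1) / (1 + 2 * C * e))) \<longlongrightarrow> m / ((1 - 0) powr (p + 1) / (1 + 0))) (at_right 0)"
    by (intro tendsto_intros k) auto
  then have upper: "((\<lambda>e. m / ((1 - 2 * C * e) powr (p + 1) / (1 + 2 * C * e))) \<longlongrightarrow> m) (at_right 0)" by simp
  have "((\<lambda>e. m / ((1 + 2 * C * e) / (1 - 2 * C * e) * ((1 - sqrt e) powr (1 - p) * (1 + 2 * C * e) powr p +
      m * (sqrt e powr (1 - p) * (e * C) powr p)))) \<longlongrightarrow>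
    m / ((1 + 0) / (1 - 0) * ((1 - 0) powr (1 - p) * (1 + 0) powr p + m * 0))) (at_right 0)"
    by (intro tendsto_divide[OF tendsto_const] tendsto_mult[OF tendsto_divide] tendsto_add[OF tendsto_mult]
        tendsto_mult[OF tendsto_const rest] tendsto_powr tendsto_add[OF tendsto_const k] tendsto_diff[OF tendsto_const k]
        tendsto_diff[OF tendsto_const s] tendsto_const) auto
  then have lower: "((\<lambda>e. m / ((1 + 2 * C * e) / (1 - 2 * C * e) * ((1 - sqrt e) powr (1 - p) * (1 + 2 * C * e) powr p +
      m * (sqrt e powr (1 - p) * (e * C) powr p)))) \<longlongrightarrow> m) (at_right 0)" by simp
  show ?thesis
    unfolding m_def[symmetric]
    by (rule tendsto_sandwich[OF _ _ lower upper]; rule eventually_mono[OF small]) (use bounds in auto)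
qed

end
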